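(* Let $d\ge 1$ be an integer and let $N=\binom{d+L}{d}$ with $L\ge 0$ an integer. Then $\mathfrak{X}_*^{(N)}$ is a homogeneous projection determinantal point process in $\mathbb{S}^{2d}$ with kernel $$K_*^{(N)}(p,q)=\frac{N}{\mathrm{Vol}(\mathbb{S}^{2d})}\,\frac{(1+\langle z,w\rangle)^{L}}{(1+\|z\|^2)^{L/2}(1+\|w\|^2)^{L/2}},$$ where $z=\varphi_{g_d}^{-1}(\Pi_d(p))$ and $w=\varphi_{g_d}^{-1}(\Pi_d(q))$.
   Context: Spheres $\mathbb{S}^m\subset\mathbb{R}^{m+1}$ carry their usual (unnormalized) surface measure, with total mass $\mathrm{Vol}(\mathbb{S}^m)$; $\mathbb{C}^d$ carries Lebesgue measure and $\langle z,w\rangle=\sum_i z_i\overline{w_i}$. A point process on a measure space $(\mathbb X,\mu)$ is determinantal (a DPP) with kernel $K$ if its joint intensities with respect to $\mu$ are $\rho_k(x_1,\dots,x_k)=\det(K(x_i,x_j))_{i,j=1}^k$ for all $k\ge1$. It is a projection DPP of $N$ points if $K$ is the reproducing (projection) kernel of an $N$-dimensional subspace of $L^2(\mathbb X,\mathbb C)$. A DPP on a sphere is homogeneous if $K(p,p)$ is constant in $p$. $\mathbb{C}^d\equiv\mathbb{R}^{2d}$ via $(z_1,\dots,z_d)\equiv(\mathrm{Re}\,z_1,\mathrm{Im}\,z_1,\dots,\mathrm{Re}\,z_d,\mathrm{Im}\,z_d)$. The stereographic projection is $\Pi_d:\mathbb{S}^{2d}\setminus\{(0,\dots,0,1)\}\to\mathbb{R}^{2d}$,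 $\Pi_d(p)=\frac{1}{1-p_{2d+1}}(p_1,\dots,p_{2d})$. For an increasing $C^1$ function $g:(0,\infty)\to(0,\infty)$ with $g(x)\to0$ as $x\to0$ and $g(x)\to\infty$ as $x\to\infty$, put $\varphi_g(x)=g(\|x\|)\frac{x}{\|x\|}$ on $\mathbb{R}^{2d}\setminus\{0\}$; it is a bijection of $\mathbb{R}^{2d}\setminus\{0\}$ with $\varphi_g^{-1}(y)=\frac{g^{-1}(\|y\|)}{\|y\|}y$. Let $\mathrm{B}_x(a,b)=\int_0^x t^{a-1}(1-t)^{b-1}dt$, $\mathrm{B}(a,b)=\mathrm{B}_1(a,b)$, $\mathrm{I}_x(a,b)=\mathrm{B}_x(a,b)/\mathrm{B}(a,b)$. The function $g_d:(0,\infty)\to(0,\infty)$ is defined by $\mathrm{I}_{\frac{g_d(t)^2}{1+g_d(t)^2}}(d,d)=\left(\frac{t^2}{1+t^2}\right)^d$. For $N=\binom{d+L}{d}$, let $\mathfrak{X}_{\mathcal H}$ be the projection DPP of $N$ points in $\mathbb{C}^d$ associated with the subspace of $L^2(\mathbb{C}^d,\mathbb{C})$ spanned by the functions $\frac{z_1^{\alpha_1}\cdots z_d^{\alpha_d}}{(1+\|z\|^2)^{(d+L+1)/2}}$, $\alpha_i\in\mathbb{Z}_{\ge0}$, $\alpha_1+\dots+\alpha_d\le L$. The process $\mathfrak{X}_*^{(N)}$ is the push-forward (image) of $\mathfrak{X}_{\mathcal H}$ under the map $\Pi_d^{-1}\circ\varphi_{g_d}$ into $\mathbb{S}^{2d}$.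 The poles $(0,\dots,0,\pm1)$ form a null set and are disregarded when evaluating the kernel. *)

theory Defs
  imports "HOL-Probability.Probability" "Jordan_Normal_Form.Determinant"
begin

section \<open>Point processes and joint intensities\<close>

text \<open>
  A (simple) point process on the state space \<open>(space \<mu>, \<mu>)\<close> is a random set \<open>X\<close> of points,
  defined on a probability space \<open>M\<close>, which is almost surely locally finite and for which the
  number of points in each measurable set is a random variable.
\<close>

definition num_points :: "'a set \<Rightarrow> ennreal" where
  "num_points A = emeasure (count_space UNIV) A"

definition point_process ::
    "'w measure \<Rightarrow> 'a::topological_space measure \<Rightarrow> ('w \<Rightarrow> 'a set) \<Rightarrow> bool" where
  "point_process M \<mu> X \<longleftrightarrow>
     prob_space M \<and>
     (\<forall>\<omega>\<in>space M. X \<omega> \<subseteq> space \<mu>) \<and>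
     (\<forall>D\<in>sets \<mu>. (\<lambda>\<omega>. num_points (X \<omega> \<inter> D)) \<in> borel_measurable M) \<and>
     (AE \<omega> in M. \<forall>C. compact C \<and> C \<subseteq> space \<mu> \<longrightarrow> finite (X \<omega> \<inter> C))"

text \<open>
  \<open>\<rho>\<close> is a \<open>k\<close>-point joint intensity with respect to \<open>\<mu>\<close> if, for pairwise disjoint measurable
  \<open>D\<^sub>1, \<dots>, D\<^sub>k\<close>, the expectation of \<open>#(X \<inter> D\<^sub>1) \<cdots> #(X \<inter> D\<^sub>k)\<close> is the integral of \<open>\<rho>\<close> over
  \<open>D\<^sub>1 \<times> \<cdots> \<times> D\<^sub>k\<close>.  A \<open>k\<close>-tuple of points is a function on \<open>{..<k}\<close>.
\<close>

definition joint_intensity ::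
    "'w measure \<Rightarrow> 'a measure \<Rightarrow> ('w \<Rightarrow> 'a set) \<Rightarrow> nat \<Rightarrow> ((nat \<Rightarrow> 'a) \<Rightarrow> real) \<Rightarrow> bool" where
  "joint_intensity M \<mu> X k \<rho> \<longleftrightarrow>
     \<rho> \<in> borel_measurable (PiM {..<k} (\<lambda>_. \<mu>)) \<and> (\<forall>x. \<rho> x \<ge> 0) \<and>
     (\<forall>D. (\<forall>i<k. D i \<in> sets \<mu>) \<and> disjoint_family_on D {..<k} \<longrightarrow>
        (\<integral>\<^sup>+\<omega>. (\<Prod>i<k. num_points (X \<omega> \<inter> D i)) \<partial>M) =
        (\<integral>\<^sup>+x\<in>PiE {..<k} D. ennreal (\<rho> x) \<partial>(PiM {..<k} (\<lambda>_. \<mu>))))"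

text \<open>
  Joint intensities are densities, hence determined up to null sets of \<open>\<mu>\<^sup>k\<close>.
\<close>

definition determinantal ::
    "'w measure \<Rightarrow> 'a::topological_space measure \<Rightarrow> ('w \<Rightarrow> 'a set) \<Rightarrow> ('a \<Rightarrow> 'a \<Rightarrow> complex) \<Rightarrow> bool" where
  "determinantal M \<mu> X K \<longleftrightarrow>
     point_process M \<mu> X \<and>
     (\<forall>k\<ge>1. \<exists>\<rho>. joint_intensity M \<mu> X k \<rho> \<and>
        (AE x in PiM {..<k} (\<lambda>_. \<mu>).
           complex_of_real (\<rho> x) = Determinant.det (Matrix.mat k k (\<lambda>(i, j). K (x i) (x j)))))"

section \<open>Finite-dimensional subspaces of \<open>L\<^sup>2\<close> and their reproducing kernels\<close>

definition L2_functions :: "'a measure \<Rightarrow> ('a \<Rightarrow> complex) set" where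
  "L2_functions \<mu> = {f \<in> borel_measurable \<mu>. integrable \<mu> (\<lambda>x. (cmod (f x))\<^sup>2)}"

definition span_of :: "'i set \<Rightarrow> ('i \<Rightarrow> 'a \<Rightarrow> complex) \<Rightarrow> ('a \<Rightarrow> complex) set" where
  "span_of I b = {f. \<exists>c. f = (\<lambda>x. \<Sum>i\<in>I. c i * b i x)}"

text \<open>
  A subspace of \<open>L\<^sup>2\<close> of dimension \<open>n\<close> is represented by the span of \<open>n\<close> square integrable
  functions that are linearly independent modulo equality almost everywhere.
\<close>

definition L2_subspace :: "'a measure \<Rightarrow> nat \<Rightarrow> ('a \<Rightarrow> complex) set \<Rightarrow> bool" where
  "L2_subspace \<mu> n H \<longleftrightarrow>
     (\<exists>b :: nat \<Rightarrow> 'a \<Rightarrow> complex.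
        (\<forall>i<n. b i \<in> L2_functions \<mu>) \<and>
        (\<forall>c. (AE x in \<mu>. (\<Sum>i<n. c i * b i x) = 0) \<longrightarrow> (\<forall>i<n. c i = 0)) \<and>
        H = span_of {..<n} b)"

text \<open>
  \<open>K\<close> is the reproducing kernel of \<open>H\<close>: the section \<open>K(\<cdot>, y)\<close> is an element of \<open>H\<close>
  representing the evaluation at \<open>y\<close> in the \<open>L\<^sup>2\<close> inner product.  One exceptional null set \<open>Z\<close>,
  the same for both arguments, is allowed: \<open>H\<close> depends on representatives modulo null sets.
  An exceptional null set of pairs would leave the values \<open>K x x\<close> undetermined.
\<close>

definition reproducing_kernel ::
    "'a measure \<Rightarrow> ('a \<Rightarrow> complex) set \<Rightarrow> ('a \<Rightarrow> 'a \<Rightarrow> complex) \<Rightarrow> bool" where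
  "reproducing_kernel \<mu> H K \<longleftrightarrow>
     (\<exists>Z\<in>null_sets \<mu>. \<forall>y\<in>space \<mu> - Z. \<exists>h\<in>H.
        (\<forall>x\<in>space \<mu> - Z. K x y = h x) \<and>
        (\<forall>f\<in>H. f y = (\<integral>x. f x * cnj (h x) \<partial>\<mu>)))"

definition projection_DPP ::
    "'w measure \<Rightarrow> 'a::topological_space measure \<Rightarrow> ('w \<Rightarrow> 'a set) \<Rightarrow> nat \<Rightarrow>
     ('a \<Rightarrow> complex) set \<Rightarrow> ('a \<Rightarrow> 'a \<Rightarrow> complex) \<Rightarrow> bool" where
  "projection_DPP M \<mu> X n H K \<longleftrightarrow>
     L2_subspace \<mu> n H \<and> reproducing_kernel \<mu> H K \<and> determinantal M \<mu> X K"

section \<open>The sphere\<close>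

text \<open>
  \<open>\<complex>\<^sup>d\<close>, identified with \<open>\<real>\<^sup>2\<^sup>d\<close>, is \<open>complex ^ 'd\<close> with \<open>d = CARD('d)\<close>; its norm and \<open>lborel\<close>
  are those of \<open>\<real>\<^sup>2\<^sup>d\<close>.  Accordingly \<open>\<real>\<^sup>2\<^sup>d\<^sup>+\<^sup>1\<close> is \<open>(complex ^ 'd) \<times> real\<close>, the second component
  being the last coordinate, and the sphere is \<open>sphere 0 1\<close> in this Euclidean space.

  The surface measure of the unit sphere of \<open>\<real>\<^sup>n\<close> gives a Borel set \<open>A\<close> the mass \<open>n\<close> times the
  Lebesgue measure of the cone \<open>{r x | x \<in> A, 0 < r \<le> 1}\<close>.
\<close>

definition surface_measure :: "'a::euclidean_space measure" where
  "surface_measure =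
     scale_measure (of_nat DIM('a))
       (distr (restrict_space lborel (cball 0 1 - {0})) (restrict_space borel (sphere 0 1))
         (\<lambda>x. x /\<^sub>R norm x))"

definition north_pole :: "(complex ^ 'd) \<times> real" where
  "north_pole = (0, 1)"

definition south_pole :: "(complex ^ 'd) \<times> real" where
  "south_pole = (0, -1)"

definition homogeneous_kernel ::
    "((complex ^ 'd) \<times> real \<Rightarrow> (complex ^ 'd) \<times> real \<Rightarrow> complex) \<Rightarrow> bool" where
  "homogeneous_kernel K \<longleftrightarrow>
     (\<exists>c. \<forall>p\<in>sphere 0 1 - {north_pole, south_pole}. K p p = c)"

definition stereo :: "(complex ^ 'd) \<times> real \<Rightarrow> complex ^ 'd" where
  "stereo p = (1 / (1 - snd p)) *\<^sub>R fst p"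

definition stereo_inv :: "complex ^ 'd \<Rightarrow> (complex ^ 'd) \<times> real" where
  "stereo_inv = inv_into (sphere 0 1 - {north_pole}) stereo"

definition radial_map :: "(real \<Rightarrow> real) \<Rightarrow> complex ^ 'd \<Rightarrow> complex ^ 'd" where
  "radial_map g x = g (norm x) *\<^sub>R (x /\<^sub>R norm x)"

definition radial_map_inv :: "(real \<Rightarrow> real) \<Rightarrow> complex ^ 'd \<Rightarrow> complex ^ 'd" where
  "radial_map_inv g = inv_into (- {0}) (radial_map g)"

section \<open>The process and its kernel\<close>

definition incomplete_Beta :: "real \<Rightarrow> real \<Rightarrow> real \<Rightarrow> real" where
  "incomplete_Beta x a b = integral {0..x} (\<lambda>t. t powr (a - 1) * (1 - t) powr (b - 1))"

definition regularized_Beta :: "real \<Rightarrow> real \<Rightarrow> real \<Rightarrow> real" where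
  "regularized_Beta x a b = incomplete_Beta x a b / incomplete_Beta 1 a b"

definition g_fun :: "nat \<Rightarrow> real \<Rightarrow> real" where
  "g_fun d t = (THE s. s > 0 \<and>
     regularized_Beta (s\<^sup>2 / (1 + s\<^sup>2)) (real d) (real d) = (t\<^sup>2 / (1 + t\<^sup>2)) ^ d)"

definition weighted_monomial :: "nat \<Rightarrow> ('d::finite \<Rightarrow> nat) \<Rightarrow> complex ^ 'd \<Rightarrow> complex" where
  "weighted_monomial L \<alpha> z =
     (\<Prod>i\<in>UNIV. (z $ i) ^ \<alpha> i) /
     complex_of_real ((1 + (norm z)\<^sup>2) powr ((real CARD('d) + real L + 1) / 2))"

definition H_space :: "nat \<Rightarrow> (complex ^ 'd \<Rightarrow> complex) set" where
  "H_space L = span_of {\<alpha> :: 'd \<Rightarrow> nat. (\<Sum>i\<in>UNIV. \<alpha> i) \<le> L} (weighted_monomial L)"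

definition hermitian_prod :: "complex ^ 'd \<Rightarrow> complex ^ 'd \<Rightarrow> complex" where
  "hermitian_prod z w = (\<Sum>i\<in>UNIV. z $ i * cnj (w $ i))"

text \<open>
  \<open>radial_map\<close> is meant on the complement of the origin and \<open>stereo\<close> off the north pole, so
  \<open>from_sphere\<close> and \<open>K_star\<close> have the intended meaning exactly off the two poles, a null set
  of the sphere.
\<close>

definition to_sphere :: "complex ^ 'd \<Rightarrow> (complex ^ 'd) \<times> real" where
  "to_sphere z = stereo_inv (radial_map (g_fun CARD('d)) z)"

definition from_sphere :: "(complex ^ 'd) \<times> real \<Rightarrow> complex ^ 'd" where
  "from_sphere p = radial_map_inv (g_fun CARD('d)) (stereo p)"

definition K_star :: "nat \<Rightarrow> (complex ^ 'd) \<times> real \<Rightarrow> (complex ^ 'd) \<times> real \<Rightarrow> complex" where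
  "K_star L p q =
     (let N = (CARD('d) + L) choose CARD('d);
          V = measure (surface_measure :: ((complex ^ 'd) \<times> real) measure) (sphere 0 1);
          z = from_sphere p;
          w = from_sphere q
      in complex_of_real (real N / V) * (1 + hermitian_prod z w) ^ L /
         complex_of_real ((1 + (norm z)\<^sup>2) powr (real L / 2) * (1 + (norm w)\<^sup>2) powr (real L / 2)))"

end

theory Submission
  imports Defs
begin

text \<open>
  Homogeneity (scaling and Tonelli, no polar measure) turns the surface integral
  of \<open>f \<circ> from_sphere\<close> into an integral over \<open>\<complex>\<^sup>d\<close>: with \<open>t = s / \<parallel>y\<parallel>\<close> for a point
  \<open>(y, s)\<close> of the ball, everything reduces to the image of \<open>(1 + t\<^sup>2)^(- d - 1/2) dt\<close> under
  \<open>t \<mapsto> g\<^sub>d\<inverse> (sqrt (1 + t\<^sup>2) + t)\<close>.  The equation defining \<open>g\<^sub>d\<close> says exactly that this image has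
  a density proportional to \<open>r^(2 d - 1) / (1 + r\<^sup>2)^(d + 1)\<close>, because the tails of both measures are
  affine functions of the two sides of that equation.  Hence the surface measure is carried to
  \<open>C / (1 + \<parallel>z\<parallel>\<^sup>2)^(d + 1) dz\<close>.

  The weighted monomials are orthogonal (rotate one coordinate), and their norms follow from
  \<open>m! / a^(m + 1) = \<integral> t\<^sup>m exp (- t a) dt\<close> and Gaussian moments; the multinomial theorem sums the kernel
  to a multiple of \<open>(1 + \<langle>z, w\<rangle>)\<^sup>L\<close>.  Transporting the kernel multiplies it by the square roots of
  the density at \<open>z\<close> and \<open>w\<close>, which cancels the surplus power \<open>d + 1\<close> in the denominator and makes
  the diagonal constant.
\<close>

section \<open>Radial and conical integration\<close>

text \<open>Comparing tails keeps calculus away from \<open>g_fun\<close>: it enters only as an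
  increasing bijection of the half-line, and neither it nor its inverse is ever differentiated. The
  volume of the sphere is likewise left in terms of \<open>cone_constant\<close>, the constant of
  the density; it occurs in \<open>N / V\<close> and in the weights, where it cancels.

  Two obstacles lie outside the change of variables. The kernel of the given process is known only
  as some reproducing kernel, determined off a null set; it is therefore first identified, off a
  null set of points, with the explicit \<open>H_kernel\<close>. Because the exceptional set
  consists of points and not of pairs, almost every tuple has all entries of its matrix, the
  diagonal included, given by \<open>H_kernel\<close>. Moreover, a locally finite process in C^d may
  accumulate at infinity, which the sphere closes up to a pole, so local finiteness does not carry
  over by itself. Almost sure finiteness comes from the integrable diagonal of the kernel, which
  bounds the expected number of points.\<close>

lemma nn_integral_lborel_scale:
  fixes f :: "'a::euclidean_space \<Rightarrow> ennreal"
  assumes [measurable]: "f \<in> borel_measurable borel" and c: "c > 0"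
  shows "(\<integral>\<^sup>+x. f x \<partial>lborel) = ennreal (c ^ DIM('a)) * (\<integral>\<^sup>+x. f (c *\<^sub>R x) \<partial>lborel)"
  by (subst lborel_affine[of c 0])
     (use c in \<open>simp_all add: nn_integral_density nn_integral_distr nn_integral_cmult\<close>)

lemma nn_integral_inverse_power_tail:
  fixes a :: real
  assumes a: "a > 0"
  shows "(\<integral>\<^sup>+r. ennreal (1 / r ^ (k + 2)) * indicator {a..} r \<partial>lborel) = ennreal (1 / (real (k + 1) * a ^ (k + 1)))"
proof -
  have "(\<integral>\<^sup>+r. ennreal (1 / r ^ (k + 2)) * indicator {a..} r \<partial>lborel)
      = ennreal (0 - (- (1 / (real (k + 1) * a ^ (k + 1)))))"
  proof (rule nn_integral_FTC_atLeast)
    fix x :: real assume x: "a \<le> x"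
    show "((\<lambda>x. - (1 / (real (k + 1) * x ^ (k + 1)))) has_field_derivative 1 / x ^ (k + 2)) (at x)"
    proof -
      have *: "real k * x ^ (k - Suc 0) * x = real k * x ^ k" by (cases k) auto
      show ?thesis
        using x a
        by (auto intro!: derivative_eq_intros simp: divide_simps power_add power2_eq_square)
           (simp only: * of_nat_Suc distrib_right mult_1_left add.commute)
    qed
  next
    show "((\<lambda>x. - (1 / (real (k + 1) * x ^ (k + 1)))) \<longlongrightarrow> 0) at_top"
    proof -
      have "filterlim (\<lambda>x::real. real (k + 1) * x ^ (k + 1)) at_top at_top"
        by (intro filterlim_tendsto_pos_mult_at_top[OF tendsto_const] filterlim_pow_at_top filterlim_ident) auto
      from tendsto_minus[OF tendsto_divide_0[OF tendsto_const filterlim_at_top_imp_at_infinity[OF this], of 1]]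
      show ?thesis by simp
    qed
  qed (use a in auto)
  then show ?thesis by simp
qed

text \<open>Polar coordinates with the ball in place of the sphere of directions: with
  \<open>n = DIM('a)\<close>, the weight \<open>(n + 1) * norm y\<close> has integral 1 along each
  ray of the ball against \<open>rho^(n - 1) d rho\<close>, so the direction of \<open>y\<close> is
  distributed by the unnormalized surface measure. The power \<open>norm y\<close> is the one that
  \<open>nn_integral_cone\<close> leaves behind. Rescaling \<open>r\<close> by \<open>norm y\<close>
  and then \<open>y\<close> by \<open>r\<close> leaves for each \<open>z\<close> the integral of
  \<open>norm z^(n + 1) / r^(n + 2)\<close> over \<open>r \<ge> norm z\<close>, which is
  \<open>1 / (n + 1)\<close>.\<close>

lemma nn_integral_radial:
  fixes h :: "'a::euclidean_space \<Rightarrow> ennreal"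
  assumes [measurable]: "h \<in> borel_measurable borel"
  shows "(\<integral>\<^sup>+z. h z \<partial>lborel) = ennreal (real (DIM('a) + 1)) *
    (\<integral>\<^sup>+y. indicator (cball 0 1 - {0}) y * ennreal (norm y) *
       (\<integral>\<^sup>+r. indicator {0<..} r * ennreal (r ^ (DIM('a) - 1)) * h (r *\<^sub>R (y /\<^sub>R norm y)) \<partial>lborel) \<partial>(lborel :: 'a measure))"
proof -
  define n where "n = DIM('a)"
  have [measurable]: "cball 0 1 \<in> sets (borel :: 'a measure)" by simp
  have n: "n > 0" by (simp add: n_def)
  have "(\<integral>\<^sup>+y. indicator (cball 0 1 - {0}) y * ennreal (norm y) *
       (\<integral>\<^sup>+r. indicator {0<..} r * ennreal (r ^ (n - 1)) * h (r *\<^sub>R (y /\<^sub>R norm y)) \<partial>lborel) \<partial>(lborel :: 'a measure))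
     = (\<integral>\<^sup>+y. (\<integral>\<^sup>+r. indicator (cball 0 1 - {0}) y * ennreal (norm y ^ (n + 1)) * indicator {0<..} r * ennreal (r ^ (n - 1)) * h (r *\<^sub>R y) \<partial>lborel) \<partial>lborel)"
  proof (rule nn_integral_cong)
    fix y :: 'a
    show "indicator (cball 0 1 - {0}) y * ennreal (norm y) *
       (\<integral>\<^sup>+r. indicator {0<..} r * ennreal (r ^ (n - 1)) * h (r *\<^sub>R (y /\<^sub>R norm y)) \<partial>lborel)
       = (\<integral>\<^sup>+r. indicator (cball 0 1 - {0}) y * ennreal (norm y ^ (n + 1)) * indicator {0<..} r * ennreal (r ^ (n - 1)) * h (r *\<^sub>R y) \<partial>lborel)"
    proof (cases "y = 0")
      case False
      have *: "indicator {0<..} (norm y * r) = (indicator {0<..} r :: ennreal)" for r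
        using False by (auto simp: indicator_def zero_less_mult_iff)
      have **: "norm y * r * inverse (norm y) = r" for r
        using False by simp
      have "(\<integral>\<^sup>+r. indicator {0<..} r * ennreal (r ^ (n - 1)) * h (r *\<^sub>R (y /\<^sub>R norm y)) \<partial>lborel)
         = ennreal (norm y) * (\<integral>\<^sup>+r. indicator {0<..} r * ennreal ((norm y * r) ^ (n - 1)) * h (r *\<^sub>R y) \<partial>lborel)"
        by (subst nn_integral_real_affine[where c="norm y" and t=0]) (use False in \<open>auto simp: * **\<close>)
      also have "\<dots> = ennreal (norm y) * (\<integral>\<^sup>+r. ennreal (norm y ^ (n - 1)) * (indicator {0<..} r * ennreal (r ^ (n - 1)) * h (r *\<^sub>R y)) \<partial>lborel)"
      proof (rule arg_cong, rule nn_integral_cong)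
        fix r :: real
        show "indicator {0<..} r * ennreal ((norm y * r) ^ (n - 1)) * h (r *\<^sub>R y) =
          ennreal (norm y ^ (n - 1)) * (indicator {0<..} r * ennreal (r ^ (n - 1)) * h (r *\<^sub>R y))"
          by (cases "r > 0") (simp_all add: power_mult_distrib ennreal_mult' mult_ac)
      qed
      also have "\<dots> = ennreal (norm y ^ n) * (\<integral>\<^sup>+r. (indicator {0<..} r * ennreal (r ^ (n - 1)) * h (r *\<^sub>R y)) \<partial>lborel)"
        using n by (subst nn_integral_cmult) (auto simp: mult.assoc[symmetric] ennreal_mult'[symmetric] power_Suc[symmetric] simp del: power_Suc)
      finally have "indicator (cball 0 1 - {0}) y * ennreal (norm y) *
         (\<integral>\<^sup>+r. indicator {0<..} r * ennreal (r ^ (n - 1)) * h (r *\<^sub>R (y /\<^sub>R norm y)) \<partial>lborel)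
         = (indicator (cball 0 1 - {0}) y * ennreal (norm y ^ (n + 1))) * (\<integral>\<^sup>+r. indicator {0<..} r * ennreal (r ^ (n - 1)) * h (r *\<^sub>R y) \<partial>lborel)"
        by (simp only:) (simp add: ennreal_mult' mult_ac)
      also have "\<dots> = (\<integral>\<^sup>+r. (indicator (cball 0 1 - {0}) y * ennreal (norm y ^ (n + 1))) * (indicator {0<..} r * ennreal (r ^ (n - 1)) * h (r *\<^sub>R y)) \<partial>lborel)"
        by (rule nn_integral_cmult[symmetric]) simp
      finally show ?thesis by (simp only: mult.assoc)
    qed simp
  qed
  also have "\<dots> = (\<integral>\<^sup>+r. (\<integral>\<^sup>+y. indicator (cball 0 1 - {0}) y * ennreal (norm y ^ (n + 1)) * indicator {0<..} r * ennreal (r ^ (n - 1)) * h (r *\<^sub>R y) \<partial>lborel) \<partial>lborel)"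
    by (rule lborel_pair.Fubini') measurable
  also have "\<dots> = (\<integral>\<^sup>+r. (\<integral>\<^sup>+z. indicator {0<..} r * indicator (cball 0 r - {0}) z * ennreal (norm z ^ (n + 1) / r ^ (n + 2)) * h z \<partial>(lborel::'a measure)) \<partial>lborel)"
  proof (rule nn_integral_cong)
    fix r :: real
    show "(\<integral>\<^sup>+y. indicator (cball 0 1 - {0}) y * ennreal (norm y ^ (n + 1)) * indicator {0<..} r * ennreal (r ^ (n - 1)) * h (r *\<^sub>R y) \<partial>lborel)
      = (\<integral>\<^sup>+z. indicator {0<..} r * indicator (cball 0 r - {0}) z * ennreal (norm z ^ (n + 1) / r ^ (n + 2)) * h z \<partial>(lborel::'a measure))"
    proof (cases "r > 0")
      case True
      have [measurable]: "cball 0 r \<in> sets (borel :: 'a measure)" by simp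
      have *: "indicator (cball 0 r - {0}) (r *\<^sub>R y) = (indicator (cball 0 1 - {0}) y :: ennreal)" for y :: 'a
        using True by (auto simp: indicator_def)
      have "(\<integral>\<^sup>+z. indicator {0<..} r * indicator (cball 0 r - {0}) z * ennreal (norm z ^ (n + 1) / r ^ (n + 2)) * h z \<partial>(lborel::'a measure))
         = ennreal (r ^ n) * (\<integral>\<^sup>+y. indicator (cball 0 1 - {0}) y * ennreal ((r * norm y) ^ (n + 1) / r ^ (n + 2)) * h (r *\<^sub>R y) \<partial>(lborel::'a measure))"
        by (subst nn_integral_lborel_scale[OF _ True]) (use True in \<open>simp_all add: * flip: n_def\<close>)
      also have "\<dots> = (\<integral>\<^sup>+y. indicator (cball 0 1 - {0}) y * (ennreal (r ^ n) * ennreal ((r * norm y) ^ (n + 1) / r ^ (n + 2))) * h (r *\<^sub>R y) \<partial>(lborel::'a measure))"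
        by (subst nn_integral_cmult[symmetric]) (auto simp: mult_ac)
      also have "\<dots> = (\<integral>\<^sup>+y. indicator (cball 0 1 - {0}) y * (ennreal (norm y ^ (n + 1)) * ennreal (r ^ (n - 1))) * h (r *\<^sub>R y) \<partial>lborel)"
      proof (rule nn_integral_cong)
        fix y :: 'a
        have "r ^ n * ((r * norm y) ^ (n + 1) / r ^ (n + 2)) = norm y ^ (n + 1) * r ^ (n - 1)"
          using True n by (cases n) (simp_all add: field_simps power_mult_distrib)
        then have "ennreal (r ^ n) * ennreal ((r * norm y) ^ (n + 1) / r ^ (n + 2)) = ennreal (norm y ^ (n + 1)) * ennreal (r ^ (n - 1))"
          using True by (simp add: ennreal_mult'[symmetric])
        then show "indicator (cball 0 1 - {0}) y * (ennreal (r ^ n) * ennreal ((r * norm y) ^ (n + 1) / r ^ (n + 2))) * h (r *\<^sub>R y)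
          = indicator (cball 0 1 - {0}) y * (ennreal (norm y ^ (n + 1)) * ennreal (r ^ (n - 1))) * h (r *\<^sub>R y)"
          by simp
      qed
      finally show ?thesis using True by (simp add: mult_ac)
    qed simp
  qed
  also have "\<dots> = (\<integral>\<^sup>+z. (\<integral>\<^sup>+r. indicator {0<..} r * indicator (cball 0 r - {0}) z * ennreal (norm z ^ (n + 1) / r ^ (n + 2)) * h z \<partial>lborel) \<partial>(lborel::'a measure))"
  proof (rule lborel_pair.Fubini')
    have "(\<lambda>x. indicator {(z, r). norm z \<le> r \<and> z \<noteq> 0} x :: ennreal) \<in> borel_measurable ((borel :: 'a measure) \<Otimes>\<^sub>M borel)"
      by measurable
    also have "(\<lambda>x. indicator {(z, r). norm z \<le> r \<and> z \<noteq> 0} x :: ennreal) = (\<lambda>(z :: 'a, r). indicator (cball 0 r - {0}) z)"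
      by (auto simp: indicator_def fun_eq_iff)
    finally have [measurable]: "(\<lambda>(z, r). indicator (cball 0 r - {0}) z :: ennreal) \<in> borel_measurable ((borel :: 'a measure) \<Otimes>\<^sub>M borel)" .
    show "(\<lambda>(z, r). indicator {0<..} r * indicator (cball 0 r - {0}) z * ennreal (norm z ^ (n + 1) / r ^ (n + 2)) * h z) \<in> borel_measurable ((lborel :: 'a measure) \<Otimes>\<^sub>M lborel)"
      by measurable
  qed
  also have "\<dots> = (\<integral>\<^sup>+z. ennreal (1 / real (n + 1)) * h z \<partial>lborel)"
  proof (rule nn_integral_cong_AE, rule AE_mp[OF AE_lborel_singleton[of 0]], rule AE_I2, rule impI)
    fix z :: 'a assume z: "z \<noteq> 0"
    have "(\<integral>\<^sup>+r. indicator {0<..} r * indicator (cball 0 r - {0}) z * ennreal (norm z ^ (n + 1) / r ^ (n + 2)) * h z \<partial>lborel)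
       = (\<integral>\<^sup>+r. (ennreal (norm z ^ (n + 1)) * h z) * (ennreal (1 / r ^ (n + 2)) * indicator {norm z..} r) \<partial>lborel)"
    proof (rule nn_integral_cong)
      fix r :: real
      have "r > 0" if "norm z \<le> r" using that z by (meson less_le_trans zero_less_norm_iff)
      then show "indicator {0<..} r * indicator (cball 0 r - {0}) z * ennreal (norm z ^ (n + 1) / r ^ (n + 2)) * h z
        = (ennreal (norm z ^ (n + 1)) * h z) * (ennreal (1 / r ^ (n + 2)) * indicator {norm z..} r)"
        using z by (auto simp: indicator_def divide_inverse ennreal_mult' mult_ac)
    qed
    also have "\<dots> = ennreal (norm z ^ (n + 1)) * h z * ennreal (1 / (real (n + 1) * norm z ^ (n + 1)))"
      using z by (subst nn_integral_cmult) (simp, subst nn_integral_inverse_power_tail, auto)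
    also have "\<dots> = (ennreal (norm z ^ (n + 1)) * ennreal (1 / (real (n + 1) * norm z ^ (n + 1)))) * h z"
      by (simp add: mult_ac)
    also have "ennreal (norm z ^ (n + 1)) * ennreal (1 / (real (n + 1) * norm z ^ (n + 1))) = ennreal (1 / real (n + 1))"
      using z by (subst ennreal_mult'[symmetric]) (simp_all del: power_Suc)
    finally show "(\<integral>\<^sup>+r. indicator {0<..} r * indicator (cball 0 r - {0}) z * ennreal (norm z ^ (n + 1) / r ^ (n + 2)) * h z \<partial>lborel) = ennreal (1 / real (n + 1)) * h z" .
  qed
  also have "\<dots> = ennreal (1 / real (n + 1)) * (\<integral>\<^sup>+z. h z \<partial>lborel)"
    by (rule nn_integral_cmult) simp
  finally have "(\<integral>\<^sup>+y. indicator (cball 0 1 - {0}) y * ennreal (norm y) *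
       (\<integral>\<^sup>+r. indicator {0<..} r * ennreal (r ^ (n - 1)) * h (r *\<^sub>R (y /\<^sub>R norm y)) \<partial>lborel) \<partial>(lborel :: 'a measure))
     = ennreal (1 / real (n + 1)) * (\<integral>\<^sup>+z. h z \<partial>lborel)" .
  then show ?thesis
    by (simp add: n_def[symmetric] mult.assoc[symmetric] ennreal_mult'[symmetric] del: of_nat_add of_nat_Suc)
qed

text \<open>The integrand is constant on rays, so the ball is sliced by the slope
  \<open>t = s / norm y\<close>. The slice is a ball of radius \<open>1 / sqrt (1 + t^2)\<close>;
  scaling it to the unit ball costs that radius to the power \<open>DIM('a) + 1\<close>, the last
  factor coming from \<open>ds = norm y dt\<close>. The outer integral over directions is the one of
  \<open>nn_integral_radial\<close>.\<close>

lemma nn_integral_cone: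
  fixes f :: "real \<Rightarrow> 'a::euclidean_space \<Rightarrow> ennreal"
  assumes [measurable]: "case_prod f \<in> borel_measurable (borel \<Otimes>\<^sub>M borel)"
  shows "(\<integral>\<^sup>+(y, s). indicator (cball 0 1 - {0}) (y, s) * f (s / norm y) (y /\<^sub>R norm y) \<partial>lborel) =
    (\<integral>\<^sup>+y. indicator (cball 0 1 - {0}) y * ennreal (norm y) *
       (\<integral>\<^sup>+t. ennreal (1 / sqrt (1 + t\<^sup>2) ^ (DIM('a) + 1)) * f t (y /\<^sub>R norm y) \<partial>lborel) \<partial>(lborel :: 'a measure))"
proof -
  define n where "n = DIM('a)"
  have [measurable]: "cball 0 1 \<in> sets (borel :: 'a measure)" by simp
  define I where "I t y = (indicator {(t, y). norm y * sqrt (1 + t\<^sup>2) \<le> 1 \<and> y \<noteq> 0} (t, y) :: ennreal)" for t :: real and y :: 'a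
  have [measurable]: "case_prod I \<in> borel_measurable (borel \<Otimes>\<^sub>M borel)"
    unfolding I_def by measurable
  have [measurable]: "(\<lambda>p. indicator (cball 0 1 - {0}) p :: ennreal) \<in> borel_measurable (lborel \<Otimes>\<^sub>M lborel :: ('a \<times> real) measure)"
    unfolding lborel_prod by (intro borel_measurable_indicator) auto
  have [measurable]: "(\<lambda>p. case_prod f (snd p / norm (fst p), fst p /\<^sub>R norm (fst p))) \<in> borel_measurable (lborel \<Otimes>\<^sub>M lborel)"
    by (rule measurable_compose[OF _ assms]) measurable
  have norm_eq: "norm (y, norm y * t) = norm y * sqrt (1 + t\<^sup>2)" for t and y :: 'a
  proof -
    have "norm (y, norm y * t) = sqrt ((norm y)\<^sup>2 * (1 + t\<^sup>2))"
      by (simp add: norm_Pair power_mult_distrib algebra_simps)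
    then show ?thesis by (simp add: real_sqrt_mult)
  qed
  have "(\<integral>\<^sup>+(y, s). indicator (cball 0 1 - {0}) (y, s) * f (s / norm y) (y /\<^sub>R norm y) \<partial>lborel)
     = (\<integral>\<^sup>+y. \<integral>\<^sup>+s. indicator (cball 0 1 - {0}) (y, s) * f (s / norm y) (y /\<^sub>R norm y) \<partial>lborel \<partial>lborel)"
  proof -
    have "(\<lambda>p. indicator (cball 0 1 - {0}) p * case_prod f (snd p / norm (fst p), fst p /\<^sub>R norm (fst p))) \<in> borel_measurable (lborel \<Otimes>\<^sub>M lborel)"
      by measurable
    from lborel.nn_integral_fst[OF this] show ?thesis
      by (simp add: lborel_prod case_prod_beta')
  qed
  also have "\<dots> = (\<integral>\<^sup>+y. \<integral>\<^sup>+t. I t y * ennreal (norm y) * f t (y /\<^sub>R norm y) \<partial>lborel \<partial>lborel)"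
  proof (rule nn_integral_cong_AE, rule AE_mp[OF AE_lborel_singleton[of 0]], rule AE_I2, rule impI)
    fix y :: 'a assume y: "y \<noteq> 0"
    have "indicator (cball 0 1 - {0}) (y, norm y * t) = I t y" for t
      using y norm_eq[of y t] by (simp add: I_def indicator_def prod_eq_iff)
    then have "(\<integral>\<^sup>+s. indicator (cball 0 1 - {0}) (y, s) * f (s / norm y) (y /\<^sub>R norm y) \<partial>lborel)
      = ennreal (norm y) * (\<integral>\<^sup>+t. I t y * f t (y /\<^sub>R norm y) \<partial>lborel)"
      by (subst nn_integral_real_affine[where c="norm y" and t=0]) (use y in \<open>auto\<close>)
    also have "\<dots> = (\<integral>\<^sup>+t. I t y * ennreal (norm y) * f t (y /\<^sub>R norm y) \<partial>lborel)"
      by (subst nn_integral_cmult[symmetric]) (auto simp: mult_ac)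
    finally show "(\<integral>\<^sup>+s. indicator (cball 0 1 - {0}) (y, s) * f (s / norm y) (y /\<^sub>R norm y) \<partial>lborel)
      = (\<integral>\<^sup>+t. I t y * ennreal (norm y) * f t (y /\<^sub>R norm y) \<partial>lborel)" .
  qed
  also have "\<dots> = (\<integral>\<^sup>+t. \<integral>\<^sup>+y. I t y * ennreal (norm y) * f t (y /\<^sub>R norm y) \<partial>lborel \<partial>lborel)"
    by (rule lborel_pair.Fubini') measurable
  also have "\<dots> = (\<integral>\<^sup>+t. \<integral>\<^sup>+y. indicator (cball 0 1 - {0}) y * ennreal (norm y) * (ennreal (1 / sqrt (1 + t\<^sup>2) ^ (n + 1)) * f t (y /\<^sub>R norm y)) \<partial>lborel \<partial>lborel)"
  proof (rule nn_integral_cong)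
    fix t :: real
    define c where "c = 1 / sqrt (1 + t\<^sup>2)"
    have c: "c > 0" unfolding c_def by (simp add: add_pos_nonneg)
    have "I t (c *\<^sub>R y) = indicator (cball 0 1 - {0}) y" for y
      unfolding I_def using c
      by (auto simp: indicator_def c_def)
    moreover have "(c *\<^sub>R y) /\<^sub>R norm (c *\<^sub>R y) = y /\<^sub>R norm y" for y :: 'a
      using c by simp
    ultimately have "(\<integral>\<^sup>+y. I t y * ennreal (norm y) * f t (y /\<^sub>R norm y) \<partial>lborel)
      = ennreal (c ^ n) * (\<integral>\<^sup>+y. indicator (cball 0 1 - {0}) y * ennreal (c * norm y) * f t (y /\<^sub>R norm y) \<partial>lborel)"
      by (subst nn_integral_lborel_scale[OF _ c]) (use c in \<open>auto simp: n_def simp del: norm_scaleR scaleR_scaleR, simp\<close>)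
    also have "\<dots> = (\<integral>\<^sup>+y. indicator (cball 0 1 - {0}) y * ennreal (norm y) * (ennreal (c ^ (n + 1)) * f t (y /\<^sub>R norm y)) \<partial>lborel)"
      using c by (subst nn_integral_cmult[symmetric]) (auto simp: mult_ac ennreal_mult' ennreal_power[symmetric])
    finally show "(\<integral>\<^sup>+y. I t y * ennreal (norm y) * f t (y /\<^sub>R norm y) \<partial>lborel) =
       (\<integral>\<^sup>+y. indicator (cball 0 1 - {0}) y * ennreal (norm y) * (ennreal (1 / sqrt (1 + t\<^sup>2) ^ (n + 1)) * f t (y /\<^sub>R norm y)) \<partial>lborel)"
      by (simp add: c_def power_one_over)
  qed
  also have "\<dots> = (\<integral>\<^sup>+y. \<integral>\<^sup>+t. indicator (cball 0 1 - {0}) y * ennreal (norm y) * (ennreal (1 / sqrt (1 + t\<^sup>2) ^ (n + 1)) * f t (y /\<^sub>R norm y)) \<partial>lborel \<partial>lborel)"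
    by (rule lborel_pair.Fubini') measurable
  also have "\<dots> = (\<integral>\<^sup>+y. indicator (cball 0 1 - {0}) y * ennreal (norm y) *
       (\<integral>\<^sup>+t. ennreal (1 / sqrt (1 + t\<^sup>2) ^ (n + 1)) * f t (y /\<^sub>R norm y) \<partial>lborel) \<partial>(lborel :: 'a measure))"
    by (intro nn_integral_cong nn_integral_cmult) measurable
  finally show ?thesis by (simp add: n_def)
qed

section \<open>The radial function and its inverse\<close>

lemma incomplete_Beta_nat:
  assumes d: "d \<ge> 1" and x: "0 \<le> x" "x \<le> 1"
  shows "incomplete_Beta x (real d) (real d) = integral {0..x} (\<lambda>t. (t * (1 - t)) ^ (d - 1))"
  unfolding incomplete_Beta_def
proof (rule integral_spike)
  \<comment> \<open>The end points matter for \<open>d = 1\<close>, where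
    \<open>0 powr 0 = 0\<close> but \<open>0 ^ 0 = 1\<close>.\<close>
  show "negligible {0, 1::real}" by simp
  fix t assume "t \<in> {0..x} - {0, 1}"
  then have "0 < t" "t < 1" using x by auto
  then show "(t * (1 - t)) ^ (d - 1) = t powr (real d - 1) * (1 - t) powr (real d - 1)"
    using d by (simp add: powr_realpow[symmetric] of_nat_diff power_mult_distrib)
qed

lemma integral_beta_pos:
  shows "integral {0..1::real} (\<lambda>t. (t * (1 - t)) ^ k) > 0"
proof -
  have "integral {0..1::real} (\<lambda>t. (t * (1 - t)) ^ k) \<ge> 0"
    by (rule integral_nonneg) (auto intro!: integrable_continuous_real continuous_intros)
  moreover have "integral {0..1::real} (\<lambda>t. (t * (1 - t)) ^ k) \<noteq> 0"
  proof
    assume "integral {0..1::real} (\<lambda>t. (t * (1 - t)) ^ k) = 0"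
    moreover have "((\<lambda>t::real. (t * (1 - t)) ^ k) has_integral integral {0..1::real} (\<lambda>t. (t * (1 - t)) ^ k)) (cbox 0 1)"
      by (auto intro!: integrable_integral integrable_continuous_real continuous_intros)
    ultimately have "((\<lambda>t::real. (t * (1 - t)) ^ k) has_integral 0) (cbox 0 1)" by simp
    then have "(1/2 * (1 - 1/2)) ^ k = (0::real)"
      by (intro has_integral_0_cbox_imp_0[of 0 1 "\<lambda>t. (t * (1 - t)) ^ k" "1/2"])
         (auto intro!: continuous_intros)
    then show False by simp
  qed
  ultimately show ?thesis by linarith
qed

lemma regularized_Beta_deriv:
  assumes d: "d \<ge> 1" and x: "0 \<le> x" "x \<le> 1"
  shows "((\<lambda>x. regularized_Beta x (real d) (real d)) has_real_derivative
    (x * (1 - x)) ^ (d - 1) / incomplete_Beta 1 (real d) (real d)) (at x within {0..1})"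
proof -
  have "((\<lambda>x. integral {0..x} (\<lambda>t. (t * (1 - t)) ^ (d - 1))) has_real_derivative (x * (1 - x)) ^ (d - 1)) (at x within {0..1})"
    by (rule integral_has_real_derivative) (use x in \<open>auto intro!: continuous_intros\<close>)
  then have "((\<lambda>x. incomplete_Beta x (real d) (real d)) has_real_derivative (x * (1 - x)) ^ (d - 1)) (at x within {0..1})"
    unfolding has_field_derivative_def
    by (rule has_derivative_transform[rotated 2]) (use x d in \<open>auto simp: incomplete_Beta_nat\<close>)
  then show ?thesis
    unfolding regularized_Beta_def by (rule DERIV_cdivide)
qed

lemma incomplete_Beta_one_pos:
  assumes d: "d \<ge> 1"
  shows "incomplete_Beta 1 (real d) (real d) > 0"
  by (simp add: incomplete_Beta_nat[OF d] integral_beta_pos)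

lemma regularized_Beta_0 [simp]: "regularized_Beta 0 a b = 0"
  by (simp add: regularized_Beta_def incomplete_Beta_def)

lemma regularized_Beta_1:
  assumes "d \<ge> 1" shows "regularized_Beta 1 (real d) (real d) = 1"
  using incomplete_Beta_one_pos[OF assms] by (simp add: regularized_Beta_def)

lemma continuous_on_regularized_Beta:
  assumes d: "d \<ge> 1"
  shows "continuous_on {0..1} (\<lambda>x. regularized_Beta x (real d) (real d))"
  by (rule DERIV_continuous_on) (use regularized_Beta_deriv[OF d] in auto)

lemma regularized_Beta_strict_mono:
  assumes d: "d \<ge> 1" and "0 \<le> x" "x < y" "y \<le> 1"
  shows "regularized_Beta x (real d) (real d) < regularized_Beta y (real d) (real d)"
proof (rule DERIV_pos_imp_increasing_open[OF \<open>x < y\<close>])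
  fix u assume u: "x < u" "u < y"
  have "at u within {0..1} = at u"
    by (rule at_within_interior) (use u assms in auto)
  with regularized_Beta_deriv[OF d, of u] u assms
  have "((\<lambda>x. regularized_Beta x (real d) (real d)) has_real_derivative
    (u * (1 - u)) ^ (d - 1) / incomplete_Beta 1 (real d) (real d)) (at u)"
    by auto
  moreover have "(u * (1 - u)) ^ (d - 1) / incomplete_Beta 1 (real d) (real d) > 0"
    using u assms incomplete_Beta_one_pos[OF d] by auto
  ultimately show "\<exists>y. ((\<lambda>x. regularized_Beta x (real d) (real d)) has_real_derivative y) (at u) \<and> 0 < y"
    by blast
next
  show "continuous_on {x..y} (\<lambda>x. regularized_Beta x (real d) (real d))"
    by (rule continuous_on_subset[OF continuous_on_regularized_Beta[OF d]]) (use assms in auto)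
qed

section \<open>Well-definedness and bijectivity of \<open>g_fun\<close>\<close>

lemma square_ratio_bounds:
  fixes s :: real assumes "s > 0"
  shows "0 < s\<^sup>2 / (1 + s\<^sup>2)" "s\<^sup>2 / (1 + s\<^sup>2) < 1"
  using assms by (auto simp: field_simps add_pos_pos)

lemma square_ratio_less_iff:
  fixes s t :: real assumes "s > 0" "t > 0"
  shows "s\<^sup>2 / (1 + s\<^sup>2) < t\<^sup>2 / (1 + t\<^sup>2) \<longleftrightarrow> s < t"
proof -
  have "x / (1 + x) < y / (1 + y) \<longleftrightarrow> x < y" if "x > 0" "y > 0" for x y :: real
    using that by (simp add: divide_less_eq less_divide_eq add_pos_pos distrib_left mult.commute)
  from this[of "s\<^sup>2" "t\<^sup>2"] have "s\<^sup>2 / (1 + s\<^sup>2) < t\<^sup>2 / (1 + t\<^sup>2) \<longleftrightarrow> s\<^sup>2 < t\<^sup>2"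
    using assms by simp
  also have "\<dots> \<longleftrightarrow> s < t"
    using assms by (simp flip: not_le)
  finally show ?thesis .
qed

lemma square_ratio_surj:
  fixes u :: real assumes "0 < u" "u < 1"
  obtains s where "s > 0" "s\<^sup>2 / (1 + s\<^sup>2) = u"
proof
  show "sqrt (u / (1 - u)) > 0" using assms by simp
  show "(sqrt (u / (1 - u)))\<^sup>2 / (1 + (sqrt (u / (1 - u)))\<^sup>2) = u"
    using assms by (simp add: field_simps)
qed

text \<open>The left side of the defining equation grows continuously and strictly from 0 to 1 as
  \<open>s^2 / (1 + s^2)\<close> does, and the right side lies strictly between 0 and 1, so the
  description in \<open>g_fun\<close> has exactly one solution. The third claim is the working form:
  whatever solves the equation is the value.\<close>

lemma g_fun_works:
  assumes d: "d \<ge> 1" and t: "t > 0"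
  shows "g_fun d t > 0"
    and "regularized_Beta ((g_fun d t)\<^sup>2 / (1 + (g_fun d t)\<^sup>2)) (real d) (real d) = (t\<^sup>2 / (1 + t\<^sup>2)) ^ d"
    and "\<And>s. s > 0 \<Longrightarrow> regularized_Beta (s\<^sup>2 / (1 + s\<^sup>2)) (real d) (real d) = (t\<^sup>2 / (1 + t\<^sup>2)) ^ d \<Longrightarrow> g_fun d t = s"
proof -
  let ?P = "\<lambda>s. s > 0 \<and> regularized_Beta (s\<^sup>2 / (1 + s\<^sup>2)) (real d) (real d) = (t\<^sup>2 / (1 + t\<^sup>2)) ^ d"
  define x where "x = (t\<^sup>2 / (1 + t\<^sup>2)) ^ d"
  have x: "0 < x" "x < 1"
    using square_ratio_bounds[OF t] d unfolding x_def
    by (auto intro!: zero_less_power simp: power_Suc_less_one) (simp add: power_less_one_iff)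
  obtain u where u: "0 \<le> u" "u \<le> 1" "regularized_Beta u (real d) (real d) = x"
    using IVT'[of "\<lambda>x. regularized_Beta x (real d) (real d)" 0 x 1] x
      continuous_on_regularized_Beta[OF d] regularized_Beta_1[OF d] by auto
  have "u \<noteq> 0" "u \<noteq> 1" using u x regularized_Beta_1[OF d] by auto
  then have "0 < u" "u < 1" using u by auto
  then obtain s where s: "s > 0" "s\<^sup>2 / (1 + s\<^sup>2) = u" by (rule square_ratio_surj)
  have Ps: "?P s" using s u by (simp add: x_def)
  have uniq: "r = s" if "?P r" for r
  proof (rule ccontr)
    assume "r \<noteq> s"
    then consider "r < s" | "s < r" by linarith
    then show False
    proof cases
      case 1
      then have "r\<^sup>2 / (1 + r\<^sup>2) < s\<^sup>2 / (1 + s\<^sup>2)" using square_ratio_less_iff[of r s] that s by auto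
      from regularized_Beta_strict_mono[OF d _ this] square_ratio_bounds[of r] square_ratio_bounds[of s] that Ps
      show False by auto
    next
      case 2
      then have "s\<^sup>2 / (1 + s\<^sup>2) < r\<^sup>2 / (1 + r\<^sup>2)" using square_ratio_less_iff[of s r] that s by auto
      from regularized_Beta_strict_mono[OF d _ this] square_ratio_bounds[of r] square_ratio_bounds[of s] that Ps
      show False by auto
    qed
  qed
  have "?P (g_fun d t)"
    unfolding g_fun_def by (rule theI[of ?P, OF Ps]) (rule uniq)
  then show "g_fun d t > 0"
    and "regularized_Beta ((g_fun d t)\<^sup>2 / (1 + (g_fun d t)\<^sup>2)) (real d) (real d) = (t\<^sup>2 / (1 + t\<^sup>2)) ^ d"
    by auto
  fix r assume "r > 0" "regularized_Beta (r\<^sup>2 / (1 + r\<^sup>2)) (real d) (real d) = (t\<^sup>2 / (1 + t\<^sup>2)) ^ d"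
  then show "g_fun d t = r" using uniq \<open>?P (g_fun d t)\<close> by metis
qed

lemma g_fun_strict_mono:
  assumes d: "d \<ge> 1" and t: "0 < s" "s < t"
  shows "g_fun d s < g_fun d t"
proof (rule ccontr)
  have t0: "0 < t" using t by simp
  assume "\<not> ?thesis"
  then have "g_fun d t < g_fun d s \<or> g_fun d t = g_fun d s" by auto
  then have "regularized_Beta ((g_fun d t)\<^sup>2 / (1 + (g_fun d t)\<^sup>2)) (real d) (real d)
      \<le> regularized_Beta ((g_fun d s)\<^sup>2 / (1 + (g_fun d s)\<^sup>2)) (real d) (real d)"
    using regularized_Beta_strict_mono[OF d, of "(g_fun d t)\<^sup>2 / (1 + (g_fun d t)\<^sup>2)" "(g_fun d s)\<^sup>2 / (1 + (g_fun d s)\<^sup>2)"]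
      square_ratio_less_iff[of "g_fun d t" "g_fun d s"] g_fun_works(1)[OF d t0] g_fun_works(1)[OF d t(1)]
      square_ratio_bounds[of "g_fun d t"] square_ratio_bounds[of "g_fun d s"]
    by auto
  then have "(t\<^sup>2 / (1 + t\<^sup>2)) ^ d \<le> (s\<^sup>2 / (1 + s\<^sup>2)) ^ d"
    using g_fun_works(2)[OF d] t t0 by simp
  moreover have "(s\<^sup>2 / (1 + s\<^sup>2)) ^ d < (t\<^sup>2 / (1 + t\<^sup>2)) ^ d"
    using square_ratio_less_iff[of s t] t t0 d square_ratio_bounds[of s]
    by (intro power_strict_mono) auto
  ultimately show False by simp
qed

lemma g_fun_less_iff:
  assumes d: "d \<ge> 1" and "0 < s" "0 < t"
  shows "g_fun d s < g_fun d t \<longleftrightarrow> s < t"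
  using g_fun_strict_mono[OF d, of s t] g_fun_strict_mono[OF d, of t s] assms
  by (cases s t rule: linorder_cases) auto

text \<open>The equation is solved for \<open>t\<close> as it was for \<open>s\<close>, with a
  \<open>d\<close>-th root in place of the inverse of the Beta function.\<close>

lemma g_fun_surj:
  assumes d: "d \<ge> 1" and s: "s > 0"
  obtains t where "t > 0" "g_fun d t = s"
proof -
  define x where "x = regularized_Beta (s\<^sup>2 / (1 + s\<^sup>2)) (real d) (real d)"
  have x: "0 < x" "x < 1"
    using regularized_Beta_strict_mono[OF d, of 0 "s\<^sup>2 / (1 + s\<^sup>2)"]
      regularized_Beta_strict_mono[OF d, of "s\<^sup>2 / (1 + s\<^sup>2)" 1] square_ratio_bounds[OF s]
    by (auto simp: x_def regularized_Beta_1[OF d])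
  then have "0 < root d x" "root d x < 1" using d by auto
  then obtain t where t: "t > 0" "t\<^sup>2 / (1 + t\<^sup>2) = root d x" by (rule square_ratio_surj)
  then have "(t\<^sup>2 / (1 + t\<^sup>2)) ^ d = x" using d x by (simp add: real_root_pow_pos2)
  then show ?thesis
    using that[OF t(1)] g_fun_works(3)[OF d t(1) s] by (simp add: x_def)
qed

definition g_inv :: "nat \<Rightarrow> real \<Rightarrow> real" where
  "g_inv d = inv_into {0<..} (g_fun d)"

lemma g_inv_works:
  assumes d: "d \<ge> 1" and s: "s > 0"
  shows "g_inv d s > 0" "g_fun d (g_inv d s) = s"
proof -
  have "s \<in> g_fun d ` {0<..}" using g_fun_surj[OF d s] by (metis greaterThan_iff imageI)
  from inv_into_into[OF this] f_inv_into_f[OF this]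
  show "g_inv d s > 0" "g_fun d (g_inv d s) = s"
    by (simp_all add: g_inv_def)
qed

lemma g_inv_g_fun:
  assumes d: "d \<ge> 1" and t: "t > 0"
  shows "g_inv d (g_fun d t) = t"
  using g_inv_works[OF d g_fun_works(1)[OF d t]] g_fun_less_iff[OF d t, of "g_inv d (g_fun d t)"]
    g_fun_less_iff[OF d _ t, of "g_inv d (g_fun d t)"] by auto

lemma less_g_inv_iff:
  assumes d: "d \<ge> 1" and "t > 0" "s > 0"
  shows "t < g_inv d s \<longleftrightarrow> g_fun d t < s"
  using g_fun_less_iff[OF d \<open>t > 0\<close> g_inv_works(1)[OF d \<open>s > 0\<close>]] g_inv_works(2)[OF d \<open>s > 0\<close>] by simp

section \<open>The radius as a function of the slope on the sphere\<close>

lemma sqrt_one_plus_square_add_pos: "sqrt (1 + t\<^sup>2) + t > (0::real)"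
proof -
  have "sqrt (t\<^sup>2) < sqrt (1 + t\<^sup>2)" by (rule real_sqrt_less_mono) simp
  then show ?thesis by simp
qed

text \<open>For \<open>t = sinh u\<close> the function \<open>sqrt (1 + t^2) + t\<close> is
  \<open>exp u\<close>, and \<open>(s - 1 / s) / 2\<close> is its inverse
  \<open>sinh (ln s)\<close>.\<close>

lemma sqrt_one_plus_square_add_greater_iff:
  fixes s t :: real
  assumes s: "s > 0"
  shows "s < sqrt (1 + t\<^sup>2) + t \<longleftrightarrow> (s - 1 / s) / 2 < t"
proof
  assume "s < sqrt (1 + t\<^sup>2) + t"
  then have *: "s - t < sqrt (1 + t\<^sup>2)" by simp
  show "(s - 1 / s) / 2 < t"
  proof (cases "s \<le> t")
    case True
    have "1 / s > 0" using s by simp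
    then show ?thesis using True s by argo
  next
    case False
    then have "(s - t)\<^sup>2 < (sqrt (1 + t\<^sup>2))\<^sup>2"
      using * by (intro power_strict_mono) auto
    then have "s\<^sup>2 - 2 * s * t < 1" by (simp add: power2_diff add_nonneg_nonneg)
    then show ?thesis using s by (simp add: field_simps power2_eq_square)
  qed
next
  assume "(s - 1 / s) / 2 < t"
  then have "s\<^sup>2 - 2 * s * t < 1" using s by (simp add: field_simps power2_eq_square)
  then have "(s - t)\<^sup>2 < 1 + t\<^sup>2" by (simp add: power2_diff)
  then have "s - t < sqrt (1 + t\<^sup>2)" by (rule real_less_rsqrt)
  then show "s < sqrt (1 + t\<^sup>2) + t" by simp
qed

text \<open>
  The norm of the point of \<open>\<complex>\<^sup>d\<close> that corresponds to a point \<open>(y, s)\<close> of the sphere, as a function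
  of \<open>t = s / \<parallel>y\<parallel>\<close>: stereographic projection gives norm \<open>\<parallel>y\<parallel> / (1 - s) = sqrt (1 + t\<^sup>2) + t\<close>.
\<close>

definition angle_radius :: "nat \<Rightarrow> real \<Rightarrow> real" where
  "angle_radius d t = g_inv d (sqrt (1 + t\<^sup>2) + t)"

lemma angle_radius_pos: "d \<ge> 1 \<Longrightarrow> angle_radius d t > 0"
  unfolding angle_radius_def by (rule g_inv_works(1)[OF _ sqrt_one_plus_square_add_pos])

text \<open>Superlevel sets become half-lines whose end point is expressed by \<open>g_fun\<close>
  and not by its inverse. Measurability of \<open>angle_radius\<close> and the tails of the image
  measure are both read off from this.\<close>

lemma less_angle_radius_iff:
  assumes "d \<ge> 1" "r > 0"
  shows "r < angle_radius d t \<longleftrightarrow> (g_fun d r - 1 / g_fun d r) / 2 < t"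
  using assms g_fun_works(1)[OF assms]
  by (simp add: angle_radius_def less_g_inv_iff sqrt_one_plus_square_add_pos sqrt_one_plus_square_add_greater_iff)

lemma angle_radius_measurable [measurable]:
  assumes "d \<ge> 1"
  shows "angle_radius d \<in> borel_measurable borel"
proof (rule borel_measurableI_greater)
  fix r :: real
  show "{t \<in> space borel. r < angle_radius d t} \<in> sets borel"
  proof (cases "r > 0")
    case True
    then have "{t \<in> space borel. r < angle_radius d t} = {(g_fun d r - 1 / g_fun d r) / 2 <..}"
      by (simp add: less_angle_radius_iff[OF assms True] greaterThan_def)
    then show ?thesis by simp
  next
    case False
    then have "r < angle_radius d t" for t
      using angle_radius_pos[OF assms, of t] by linarith
    then have "{t \<in> space borel. r < angle_radius d t} = UNIV" by simp
    then show ?thesis by simp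
  qed
qed

section \<open>The image of the slope measure under \<open>angle_radius\<close>\<close>

text \<open>This is \<open>2 d\<close> times the total mass \<open>4^d B(d, d) / 2\<close> of the
  measure \<open>(1 + t^2)^(- d - 1/2) dt\<close>; the factor \<open>2 d\<close> is the one produced
  by differentiating \<open>(r^2 / (1 + r^2))^d\<close>.\<close>

definition cone_constant :: "nat \<Rightarrow> real" where
  "cone_constant d = 4 ^ d * real d * incomplete_Beta 1 (real d) (real d)"

lemma cone_constant_pos: "d \<ge> 1 \<Longrightarrow> cone_constant d > 0"
  by (simp add: cone_constant_def incomplete_Beta_one_pos)

lemma half_one_plus_ratio_bounds:
  fixes t :: real
  shows "0 < (1 + t / sqrt (1 + t\<^sup>2)) / 2" "(1 + t / sqrt (1 + t\<^sup>2)) / 2 < 1"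
proof -
  have s: "sqrt (1 + t\<^sup>2) > 0" by (simp add: add_pos_nonneg)
  have "\<bar>t\<bar> < sqrt (1 + t\<^sup>2)" by (rule real_less_rsqrt) simp
  then show "0 < (1 + t / sqrt (1 + t\<^sup>2)) / 2" "(1 + t / sqrt (1 + t\<^sup>2)) / 2 < 1"
    using s by (auto simp: field_simps)
qed

text \<open>The ratio \<open>t / sqrt (1 + t^2)\<close> is the last coordinate of a point of the
  sphere with slope \<open>t\<close>, so this says that the last coordinate, moved affinely to
  \<open>[0, 1]\<close>, is Beta(d, d) distributed up to normalization. With
  \<open>s = sqrt (1 + t^2)\<close> and \<open>u\<close> the argument of the Beta function,
  \<open>u * (1 - u) = 1 / (4 s^2)\<close> and \<open>u' = 1 / (2 s^3)\<close>; the powers of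
  \<open>s\<close> combine to \<open>2 d + 1\<close>.\<close>

lemma DERIV_regularized_Beta_cone:
  fixes t :: real
  assumes d: "d \<ge> 1"
  shows "((\<lambda>t. cone_constant d / (2 * real d) * regularized_Beta ((1 + t / sqrt (1 + t\<^sup>2)) / 2) (real d) (real d))
    has_real_derivative 1 / sqrt (1 + t\<^sup>2) ^ (2 * d + 1)) (at t)"
proof -
  define s where "s = sqrt (1 + t\<^sup>2)"
  have s: "s > 0" by (simp add: s_def add_pos_nonneg)
  have s2: "s\<^sup>2 = 1 + t\<^sup>2" by (simp add: s_def add_nonneg_nonneg)
  define u where "u = (1 + t / s) / 2"
  have u: "0 < u" "u < 1" using half_one_plus_ratio_bounds[of t] by (auto simp: u_def s_def)
  define Z where "Z = incomplete_Beta 1 (real d) (real d)"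
  have Z: "Z > 0" unfolding Z_def by (rule incomplete_Beta_one_pos[OF d])
  have "at u within {0..1} = at u"
    by (rule at_within_interior) (use u in auto)
  with regularized_Beta_deriv[OF d, of u] u
  have B: "((\<lambda>x. regularized_Beta x (real d) (real d)) has_real_derivative (u * (1 - u)) ^ (d - 1) / Z) (at u)"
    by (auto simp: Z_def)
  have "1 + t\<^sup>2 > 0" by (simp add: add_pos_nonneg)
  note D0 = DERIV_chain2[OF DERIV_real_sqrt[OF this] DERIV_add[OF DERIV_const DERIV_power[OF DERIV_ident, of 2]]]
  have D: "((\<lambda>t. sqrt (1 + t\<^sup>2)) has_real_derivative t / s) (at t)"
    by (rule DERIV_cong[OF D0]) (simp add: s_def inverse_eq_divide)
  have "sqrt (1 + t\<^sup>2) \<noteq> 0" using s by (simp add: s_def)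
  from DERIV_cdivide[OF DERIV_add[OF DERIV_const[of 1] DERIV_divide[OF DERIV_ident D this]], of 2]
  have "((\<lambda>t. (1 + t / sqrt (1 + t\<^sup>2)) / 2) has_real_derivative ((s - t * (t / s)) / s\<^sup>2) / 2) (at t)"
    by (simp add: s_def[symmetric] power2_eq_square[of s] mult.commute)
  also have "s - t * (t / s) = (s\<^sup>2 - t\<^sup>2) / s"
    using s by (simp add: diff_divide_distrib power2_eq_square)
  also have "s\<^sup>2 - t\<^sup>2 = 1" by (simp add: s2)
  also have "1 / s / s\<^sup>2 / 2 = 1 / (2 * s ^ 3)"
    by (simp add: power3_eq_cube power2_eq_square)
  finally have T: "((\<lambda>t. (1 + t / sqrt (1 + t\<^sup>2)) / 2) has_real_derivative 1 / (2 * s ^ 3)) (at t)" .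
  have uu: "u * (1 - u) = 1 / (4 * s\<^sup>2)"
  proof -
    have "(1 + x) / 2 * (1 - (1 + x) / 2) = (1 - x\<^sup>2) / 4" for x :: real
      by (simp add: field_simps power2_eq_square)
    from this[of "t / s"] have "u * (1 - u) = (1 - t\<^sup>2 / s\<^sup>2) / 4"
      by (simp add: u_def power_divide)
    also have "1 - t\<^sup>2 / s\<^sup>2 = (s\<^sup>2 - t\<^sup>2) / s\<^sup>2" using s by (simp add: diff_divide_distrib)
    also have "s\<^sup>2 - t\<^sup>2 = 1" by (simp add: s2)
    finally show ?thesis by simp
  qed
  have "((\<lambda>t. regularized_Beta ((1 + t / sqrt (1 + t\<^sup>2)) / 2) (real d) (real d))
     has_real_derivative (u * (1 - u)) ^ (d - 1) / Z * (1 / (2 * s ^ 3))) (at t)"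
    by (rule DERIV_chain2[OF _ T]) (use B in \<open>simp add: u_def s_def\<close>)
  from DERIV_cmult[OF this, of "cone_constant d / (2 * real d)"]
  have "((\<lambda>t. cone_constant d / (2 * real d) * regularized_Beta ((1 + t / sqrt (1 + t\<^sup>2)) / 2) (real d) (real d))
     has_real_derivative cone_constant d / (2 * real d) * ((u * (1 - u)) ^ (d - 1) / Z * (1 / (2 * s ^ 3)))) (at t)" .
  also have "cone_constant d / (2 * real d) * ((u * (1 - u)) ^ (d - 1) / Z * (1 / (2 * s ^ 3))) = 1 / s ^ (2 * d + 1)"
  proof -
    obtain k where k: "d = Suc k" using d by (cases d) auto
    define A where "A = (s\<^sup>2) ^ k"
    have A: "A > 0" using s by (simp add: A_def)
    have "s ^ (2 * d + 1) = A * s ^ 3"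
      unfolding A_def k power_mult[symmetric] power_add[symmetric] by (rule arg_cong) simp
    moreover have "(u * (1 - u)) ^ (d - 1) = 1 / (4 ^ k * A)"
      by (simp add: uu k A_def power_divide power_mult_distrib)
    moreover have "cone_constant d = 4 * 4 ^ k * real d * Z"
      by (simp add: cone_constant_def Z_def k)
    ultimately show ?thesis
      using s Z A d by simp
  qed
  finally show ?thesis by (simp add: s_def)
qed

lemma DERIV_square_ratio_power:
  fixes r :: real
  assumes d: "d \<ge> 1" and r: "r > 0"
  shows "((\<lambda>r. (r\<^sup>2 / (1 + r\<^sup>2)) ^ d) has_real_derivative 2 * real d * (r ^ (2 * d - 1) / (1 + r\<^sup>2) ^ (d + 1))) (at r)"
proof -
  obtain k where k: "d = Suc k" using d by (cases d) auto
  have p: "1 + r\<^sup>2 > 0" by (simp add: add_pos_nonneg)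
  have "((\<lambda>r. r\<^sup>2 / (1 + r\<^sup>2)) has_real_derivative 2 * r / (1 + r\<^sup>2)\<^sup>2) (at r)"
    using p by (auto intro!: derivative_eq_intros) (simp add: field_simps power2_eq_square)
  from DERIV_power[OF this, of d]
  have "((\<lambda>r. (r\<^sup>2 / (1 + r\<^sup>2)) ^ d) has_real_derivative real d * (2 * r / (1 + r\<^sup>2)\<^sup>2 * (r\<^sup>2 / (1 + r\<^sup>2)) ^ (d - 1))) (at r)"
    by simp
  also have "real d * (2 * r / (1 + r\<^sup>2)\<^sup>2 * (r\<^sup>2 / (1 + r\<^sup>2)) ^ (d - 1)) = 2 * real d * (r ^ (2 * d - 1) / (1 + r\<^sup>2) ^ (d + 1))"
  proof -
    have "real d * (2 * r / a\<^sup>2 * (r\<^sup>2 / a) ^ (d - 1)) = 2 * real d * (r ^ (2 * d - 1) / a ^ (d + 1))" if "a > 0" for a :: real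
    proof -
      have "(r\<^sup>2 / a) ^ (d - 1) = r ^ (2 * k) / a ^ k" by (simp add: k power_divide power_mult)
      moreover have "r ^ (2 * d - 1) = r * r ^ (2 * k)" by (simp add: k)
      moreover have "a ^ (d + 1) = a\<^sup>2 * a ^ k" by (simp add: k power2_eq_square)
      ultimately show ?thesis by simp
    qed
    from this[OF p] show ?thesis .
  qed
  finally show ?thesis .
qed

text \<open>The point of the sphere whose stereographic projection has norm \<open>s\<close> has
  height \<open>(s^2 - 1) / (s^2 + 1)\<close>. This matches the argument of the Beta function in
  \<open>DERIV_regularized_Beta_cone\<close> with the one in the definition of
  \<open>g_fun\<close>.\<close>

lemma square_ratio_half:
  fixes s :: real
  assumes s: "s > 0"
  defines "t \<equiv> (s - 1 / s) / 2"
  shows "(1 + t / sqrt (1 + t\<^sup>2)) / 2 = s\<^sup>2 / (1 + s\<^sup>2)"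
proof -
  have "1 + t\<^sup>2 = ((s + 1 / s) / 2)\<^sup>2"
    using s by (simp add: t_def field_simps power2_eq_square)
  then have "sqrt (1 + t\<^sup>2) = (s + 1 / s) / 2" using s by simp
  moreover have "s + 1 / s > 0" using s by (simp add: add_pos_pos)
  moreover have "s * s + 1 > 0" by (simp add: add_nonneg_pos)
  ultimately show ?thesis using s by (simp add: t_def field_simps power2_eq_square)
qed

lemma distr_angle_radius:
  assumes d: "d \<ge> 1"
  shows "distr (density lborel (\<lambda>t. ennreal (1 / sqrt (1 + t\<^sup>2) ^ (2 * d + 1)))) borel (angle_radius d)
    = density lborel (\<lambda>r. indicator {0<..} r * ennreal (cone_constant d * (r ^ (2 * d - 1) / (1 + r\<^sup>2) ^ (d + 1))))"
    (is "?M1 = ?M2")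
proof -
  note [measurable] = angle_radius_measurable[OF d]
  define c where "c = cone_constant d"
  have c: "c > 0" unfolding c_def by (rule cone_constant_pos[OF d])
  \<comment> \<open>The common mass that both measures give to \<open>{x<..}\<close> for positive
    \<open>x\<close>.\<close>
  define v where "v x = c / (2 * real d) * (1 - (x\<^sup>2 / (1 + x\<^sup>2)) ^ d)" for x :: real
  have v: "v x \<le> c / (2 * real d)" for x
  proof -
    have "(x\<^sup>2 / (1 + x\<^sup>2)) ^ d \<ge> 0" by simp
    then have "c / (2 * real d) * (1 - (x\<^sup>2 / (1 + x\<^sup>2)) ^ d) \<le> c / (2 * real d) * 1"
      using c by (intro mult_left_mono) auto
    then show ?thesis by (simp add: v_def)
  qed
  have M1: "emeasure ?M1 {x<..} = ennreal (v x)" if x: "x > 0" for x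
  proof -
    \<comment> \<open>The slope that \<open>angle_radius d\<close> maps to \<open>x\<close>.\<close>
    define T where "T = (g_fun d x - 1 / g_fun d x) / 2"
    have "emeasure ?M1 {x<..} = emeasure (density lborel (\<lambda>t. ennreal (1 / sqrt (1 + t\<^sup>2) ^ (2 * d + 1)))) {T<..}"
      by (subst emeasure_distr) (auto simp: T_def less_angle_radius_iff[OF d x] vimage_def intro!: arg_cong2[where f=emeasure])
    also have "\<dots> = (\<integral>\<^sup>+t. ennreal (1 / sqrt (1 + t\<^sup>2) ^ (2 * d + 1)) * indicator {T<..} t \<partial>lborel)"
      by (rule emeasure_density) auto
    also have "\<dots> = (\<integral>\<^sup>+t. ennreal (1 / sqrt (1 + t\<^sup>2) ^ (2 * d + 1)) * indicator {T..} t \<partial>lborel)"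
      by (rule nn_integral_cong_AE, rule AE_mp[OF AE_lborel_singleton[of T]]) (auto simp: indicator_def)
    also have "\<dots> = ennreal (c / (2 * real d) - c / (2 * real d) * regularized_Beta ((1 + T / sqrt (1 + T\<^sup>2)) / 2) (real d) (real d))"
    proof (rule nn_integral_FTC_atLeast)
      show "((\<lambda>t. c / (2 * real d) * regularized_Beta ((1 + t / sqrt (1 + t\<^sup>2)) / 2) (real d) (real d)) has_real_derivative
        1 / sqrt (1 + t\<^sup>2) ^ (2 * d + 1)) (at t)" for t
        unfolding c_def by (rule DERIV_regularized_Beta_cone[OF d])
      have "((\<lambda>t. regularized_Beta ((1 + t / sqrt (1 + t\<^sup>2)) / 2) (real d) (real d)) \<longlongrightarrow> regularized_Beta 1 (real d) (real d)) at_top"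
      proof (rule continuous_on_tendsto_compose[OF continuous_on_regularized_Beta[OF d]])
        have "((\<lambda>t::real. t / sqrt (1 + t\<^sup>2)) \<longlongrightarrow> 1) at_top" by real_asymp
        then have "((\<lambda>t::real. (1 + t / sqrt (1 + t\<^sup>2)) / 2) \<longlongrightarrow> (1 + 1) / 2) at_top"
          by (intro tendsto_intros) auto
        then show "((\<lambda>t::real. (1 + t / sqrt (1 + t\<^sup>2)) / 2) \<longlongrightarrow> 1) at_top" by simp
      next
        have "(1 + t / sqrt (1 + t\<^sup>2)) / 2 \<in> {0..1}" for t :: real
          using half_one_plus_ratio_bounds[of t] by (simp only: atLeastAtMost_iff less_imp_le)
        then show "\<forall>\<^sub>F t::real in at_top. (1 + t / sqrt (1 + t\<^sup>2)) / 2 \<in> {0..1}" by (intro always_eventually allI)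
      qed simp
      from tendsto_mult_left[OF this, of "c / (2 * real d)"]
      show "((\<lambda>t. c / (2 * real d) * regularized_Beta ((1 + t / sqrt (1 + t\<^sup>2)) / 2) (real d) (real d)) \<longlongrightarrow> c / (2 * real d)) at_top"
        by (simp add: regularized_Beta_1[OF d])
    qed (auto simp: add_nonneg_nonneg)
    also have "(1 + T / sqrt (1 + T\<^sup>2)) / 2 = (g_fun d x)\<^sup>2 / (1 + (g_fun d x)\<^sup>2)"
      unfolding T_def by (rule square_ratio_half) (rule g_fun_works(1)[OF d x])
    also have "regularized_Beta ((g_fun d x)\<^sup>2 / (1 + (g_fun d x)\<^sup>2)) (real d) (real d) = (x\<^sup>2 / (1 + x\<^sup>2)) ^ d"
      by (rule g_fun_works(2)[OF d x])
    finally show ?thesis by (simp add: v_def right_diff_distrib)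
  qed
  have M2: "emeasure ?M2 {x<..} = ennreal (v x)" if x: "x > 0" for x
  proof -
    have "emeasure ?M2 {x<..} = (\<integral>\<^sup>+r. indicator {0<..} r * ennreal (c * (r ^ (2 * d - 1) / (1 + r\<^sup>2) ^ (d + 1))) * indicator {x<..} r \<partial>lborel)"
      unfolding c_def by (rule emeasure_density) auto
    also have "\<dots> = (\<integral>\<^sup>+r. ennreal (c * (r ^ (2 * d - 1) / (1 + r\<^sup>2) ^ (d + 1))) * indicator {x..} r \<partial>lborel)"
      by (rule nn_integral_cong_AE, rule AE_mp[OF AE_lborel_singleton[of x]]) (use x in \<open>auto simp: indicator_def\<close>)
    also have "\<dots> = ennreal (c / (2 * real d) - c / (2 * real d) * (x\<^sup>2 / (1 + x\<^sup>2)) ^ d)"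
    proof (rule nn_integral_FTC_atLeast)
      fix r assume "x \<le> r"
      then have r: "r > 0" using x by simp
      from DERIV_cmult[OF DERIV_square_ratio_power[OF d r], of "c / (2 * real d)"]
      show "((\<lambda>r. c / (2 * real d) * (r\<^sup>2 / (1 + r\<^sup>2)) ^ d) has_real_derivative c * (r ^ (2 * d - 1) / (1 + r\<^sup>2) ^ (d + 1))) (at r)"
        using d by simp
      show "0 \<le> c * (r ^ (2 * d - 1) / (1 + r\<^sup>2) ^ (d + 1))"
        using r c by (auto intro!: mult_nonneg_nonneg divide_nonneg_nonneg simp: add_nonneg_nonneg)
    next
      have "((\<lambda>r::real. r\<^sup>2 / (1 + r\<^sup>2)) \<longlongrightarrow> 1) at_top" by real_asymp
      from tendsto_mult_left[OF tendsto_power[OF this, of d], of "c / (2 * real d)"]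
      show "((\<lambda>r. c / (2 * real d) * (r\<^sup>2 / (1 + r\<^sup>2)) ^ d) \<longlongrightarrow> c / (2 * real d)) at_top"
        by simp
    qed auto
    finally show ?thesis by (simp add: v_def right_diff_distrib)
  qed
  \<comment> \<open>The two tail formulas are available for positive end points only; the mass of
    \<open>{0<..}\<close> is their limit along \<open>1 / (n + 1)\<close>.\<close>
  have U: "{0<..} = (\<Union>n. {1 / real (Suc n) <..})"
  proof (intro equalityI subsetI)
    fix x :: real assume "x \<in> {0<..}"
    then obtain n where "1 / real (Suc n) < x" using nat_approx_posE by auto
    then show "x \<in> (\<Union>n. {1 / real (Suc n) <..})" by auto
  next
    fix x :: real assume "x \<in> (\<Union>n. {1 / real (Suc n) <..})"
    then obtain n where n: "1 / real (Suc n) < x" by blast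
    have "0 < 1 / real (Suc n)" by simp
    then have "0 < x" using n by (rule less_trans)
    then show "x \<in> {0<..}" by simp
  qed
  have inc: "incseq (\<lambda>n. {1 / real (Suc n) <..})"
  proof (rule incseq_SucI, rule subsetI)
    fix n and x :: real assume "x \<in> {1 / real (Suc n) <..}"
    moreover have "1 / real (Suc (Suc n)) \<le> 1 / real (Suc n)" by (rule divide_left_mono) auto
    ultimately show "x \<in> {1 / real (Suc (Suc n)) <..}" by (simp only: greaterThan_iff)
  qed
  have lim: "emeasure M {0<..} = (SUP n. emeasure M {1 / real (Suc n) <..})" if "sets M = sets borel" for M :: "real measure"
  proof -
    have "range (\<lambda>n. {1 / real (Suc n) <..}) \<subseteq> sets M" unfolding that by (rule image_subsetI) simp
    from SUP_emeasure_incseq[OF this inc] show ?thesis by (simp only: U)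
  qed
  have eq0: "emeasure ?M1 {0<..} = emeasure ?M2 {0<..}"
  proof -
    have "emeasure ?M1 {1 / real (Suc n) <..} = emeasure ?M2 {1 / real (Suc n) <..}" for n
      using M1[of "1 / real (Suc n)"] M2[of "1 / real (Suc n)"] by simp
    then show ?thesis using lim[of ?M1] lim[of ?M2] by (simp only: sets_distr sets_density sets_lborel)
  qed
  have le0: "emeasure ?M1 {0<..} \<le> ennreal (c / (2 * real d))"
  proof -
    have "emeasure ?M1 {1 / real (Suc n) <..} \<le> ennreal (c / (2 * real d))" for n
      using M1[of "1 / real (Suc n)"] ennreal_leI[OF v[of "1 / real (Suc n)"]] by simp
    then have "(SUP n. emeasure ?M1 {1 / real (Suc n) <..}) \<le> ennreal (c / (2 * real d))"
      by (rule SUP_least)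
    then show ?thesis using lim[of ?M1] by (simp only: sets_distr)
  qed
  \<comment> \<open>Both measures are carried by the positive half-line, so tails do not change
    below 0.\<close>
  have neg: "emeasure ?M1 {x<..} = emeasure ?M1 {0<..}" "emeasure ?M2 {x<..} = emeasure ?M2 {0<..}" if "x \<le> 0" for x
  proof -
    have "angle_radius d t > x" for t using angle_radius_pos[OF d] that by (rule le_less_trans[rotated])
    then show "emeasure ?M1 {x<..} = emeasure ?M1 {0<..}"
      using angle_radius_pos[OF d]
      by (simp add: emeasure_distr vimage_def)
    have "emeasure ?M2 {x<..} = (\<integral>\<^sup>+r. indicator {0<..} r * ennreal (cone_constant d * (r ^ (2 * d - 1) / (1 + r\<^sup>2) ^ (d + 1))) * indicator {x<..} r \<partial>lborel)"
      by (rule emeasure_density) auto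
    also have "\<dots> = (\<integral>\<^sup>+r. indicator {0<..} r * ennreal (cone_constant d * (r ^ (2 * d - 1) / (1 + r\<^sup>2) ^ (d + 1))) * indicator {0<..} r \<partial>lborel)"
      by (rule nn_integral_cong) (use that in \<open>auto simp: indicator_def\<close>)
    also have "\<dots> = emeasure ?M2 {0<..}"
      by (rule emeasure_density[symmetric]) auto
    finally show "emeasure ?M2 {x<..} = emeasure ?M2 {0<..}" .
  qed
  show ?thesis
  proof (rule measure_eqI_lessThan)
    fix x :: real
    show "emeasure ?M1 {x<..} < \<infinity>"
      using M1[of x] neg(1)[of x] le0 by (cases "x > 0") (auto simp: less_top[symmetric] top_unique)
    show "emeasure ?M1 {x<..} = emeasure ?M2 {x<..}"
      using M1[of x] M2[of x] neg[of x] eq0 by (cases "x > 0") auto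
  qed auto
qed

section \<open>Integration over the sphere\<close>

lemma stereo_inv_explicit:
  fixes x :: "complex ^ 'd"
  defines "p \<equiv> ((2 / (1 + (norm x)\<^sup>2)) *\<^sub>R x, ((norm x)\<^sup>2 - 1) / (1 + (norm x)\<^sup>2))"
  shows "p \<in> sphere 0 1 - {north_pole}" "stereo p = x"
proof -
  define a where "a = 1 + (norm x)\<^sup>2"
  have a: "a > 0" by (simp add: a_def add_pos_nonneg)
  have s: "snd p = 1 - 2 / a" using a by (simp add: p_def a_def field_simps)
  have f: "fst p = (2 / a) *\<^sub>R x" by (simp add: p_def a_def)
  have "(norm p)\<^sup>2 = (norm (fst p))\<^sup>2 + (snd p)\<^sup>2"
    by (cases p) (simp add: norm_Pair)
  also have "\<dots> = (2 / a)\<^sup>2 * (a - 1) + (1 - 2 / a)\<^sup>2"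
    by (simp add: f s power_mult_distrib power_divide) (simp add: a_def)
  also have "\<dots> = 1" using a by (simp add: field_simps power2_eq_square)
  finally have "norm p = 1" using norm_ge_zero[of p] by (auto simp: power2_eq_1_iff simp del: norm_ge_zero)
  moreover have "p \<noteq> north_pole" using s a by (auto simp: north_pole_def)
  ultimately show "p \<in> sphere 0 1 - {north_pole}" by simp
  show "stereo p = x" using a by (simp add: stereo_def f s)
qed

lemma sphere_pair_iff:
  fixes p :: "(complex ^ 'd) \<times> real"
  shows "p \<in> sphere 0 1 \<longleftrightarrow> (norm (fst p))\<^sup>2 = 1 - (snd p)\<^sup>2"
proof -
  have "p \<in> sphere 0 1 \<longleftrightarrow> (norm p)\<^sup>2 = 1"
    using norm_ge_zero[of p] by (auto simp: power2_eq_1_iff simp del: norm_ge_zero)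
  also have "(norm p)\<^sup>2 = (norm (fst p))\<^sup>2 + (snd p)\<^sup>2"
    by (cases p) (simp add: norm_Pair)
  finally show ?thesis by auto
qed

lemma inj_on_stereo: "inj_on (stereo :: (complex ^ 'd) \<times> real \<Rightarrow> _) (sphere 0 1 - {north_pole})"
proof (rule inj_on_inverseI)
  fix p :: "(complex ^ 'd) \<times> real"
  assume p: "p \<in> sphere 0 1 - {north_pole}"
  obtain y s where ps: "p = (y, s)" by (cases p)
  have n: "(norm y)\<^sup>2 = 1 - s\<^sup>2" using p sphere_pair_iff[of p] by (simp add: ps)
  have s1: "s \<noteq> 1" using p n by (auto simp: ps north_pole_def)
  have "s\<^sup>2 \<le> 1" using n zero_le_power2[of "norm y"] by linarith
  then have "s \<le> 1" by (simp add: abs_square_le_1)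
  then have s: "s < 1" using s1 by simp
  define x where "x = stereo p"
  have x: "x = (1 / (1 - s)) *\<^sub>R y" by (simp add: x_def stereo_def ps)
  have "(norm x)\<^sup>2 = (norm y)\<^sup>2 / (1 - s)\<^sup>2"
    by (simp add: x power_divide)
  also have "\<dots> = (1 - s) * (1 + s) / (1 - s)\<^sup>2"
    unfolding n by (simp add: power2_eq_square algebra_simps)
  also have "\<dots> = (1 + s) / (1 - s)" using s by (simp add: power2_eq_square)
  finally have nx: "1 + (norm x)\<^sup>2 = 2 / (1 - s)" using s by (simp add: field_simps)
  have "((2 / (1 + (norm x)\<^sup>2)) *\<^sub>R x, 1 - 2 / (1 + (norm x)\<^sup>2)) = p"
    unfolding nx using s by (simp add: x ps diff_divide_distrib)
  then show "(\<lambda>x. ((2 / (1 + (norm x)\<^sup>2)) *\<^sub>R x, 1 - 2 / (1 + (norm x)\<^sup>2))) (stereo p) = p"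
    by (simp add: x_def)
qed

lemma stereo_inv_eq:
  fixes x :: "complex ^ 'd"
  shows "stereo_inv x = ((2 / (1 + (norm x)\<^sup>2)) *\<^sub>R x, ((norm x)\<^sup>2 - 1) / (1 + (norm x)\<^sup>2))"
  unfolding stereo_inv_def by (rule inv_into_f_eq[OF inj_on_stereo]) (rule stereo_inv_explicit)+

lemma stereo_stereo_inv: "stereo (stereo_inv x) = x"
  unfolding stereo_inv_eq by (rule stereo_inv_explicit)

lemma stereo_inv_in_sphere: "stereo_inv x \<in> sphere 0 1 - {north_pole}"
  unfolding stereo_inv_eq by (rule stereo_inv_explicit)

lemma stereo_inv_stereo: "p \<in> sphere 0 1 - {north_pole} \<Longrightarrow> stereo_inv (stereo p) = p"
  unfolding stereo_inv_def by (rule inv_into_f_f[OF inj_on_stereo])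

lemma radial_map_g_fun:
  fixes z :: "complex ^ 'd"
  assumes d: "d \<ge> 1" and z: "z \<noteq> 0"
  shows "norm (radial_map (g_fun d) z) = g_fun d (norm z)"
    and "radial_map (g_fun d) z /\<^sub>R norm (radial_map (g_fun d) z) = z /\<^sub>R norm z"
    and "radial_map (g_fun d) z \<noteq> 0"
proof -
  have g: "g_fun d (norm z) > 0" using g_fun_works(1)[OF d] z by simp
  show n: "norm (radial_map (g_fun d) z) = g_fun d (norm z)"
    using g z by (simp add: radial_map_def)
  show "radial_map (g_fun d) z /\<^sub>R norm (radial_map (g_fun d) z) = z /\<^sub>R norm z"
    unfolding n using g by (simp add: radial_map_def)
  show "radial_map (g_fun d) z \<noteq> 0"
    using g n by auto
qed

lemma radial_map_g_fun_right_inverse: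
  fixes x :: "complex ^ 'd"
  assumes d: "d \<ge> 1" and x: "x \<noteq> 0"
  shows "radial_map (g_fun d) (g_inv d (norm x) *\<^sub>R (x /\<^sub>R norm x)) = x"
proof -
  define w where "w = x /\<^sub>R norm x"
  have w: "norm w = 1" "norm x *\<^sub>R w = x" using x by (simp_all add: w_def)
  have g: "g_inv d (norm x) > 0" "g_fun d (g_inv d (norm x)) = norm x"
    using g_inv_works[OF d, of "norm x"] x by simp_all
  then have "norm (g_inv d (norm x) *\<^sub>R w) = g_inv d (norm x)" using w by simp
  then have "radial_map (g_fun d) (g_inv d (norm x) *\<^sub>R w) = norm x *\<^sub>R (g_inv d (norm x) *\<^sub>R w /\<^sub>R g_inv d (norm x))"
    using g by (simp only: radial_map_def)
  also have "\<dots> = x" using g w by simp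
  finally show ?thesis by (simp only: w_def)
qed

lemma radial_map_g_fun_left_inverse:
  fixes z :: "complex ^ 'd"
  assumes d: "d \<ge> 1" and z: "z \<noteq> 0"
  shows "(\<lambda>x. g_inv d (norm x) *\<^sub>R (x /\<^sub>R norm x)) (radial_map (g_fun d) z) = z"
  unfolding radial_map_g_fun(2)[OF d z] unfolding radial_map_g_fun(1)[OF d z] using z by (simp add: g_inv_g_fun[OF d])

lemma inj_on_radial_map_g_fun:
  "d \<ge> 1 \<Longrightarrow> inj_on (radial_map (g_fun d) :: complex ^ 'd \<Rightarrow> _) (- {0})"
  by (rule inj_on_inverseI[where g="\<lambda>x. g_inv d (norm x) *\<^sub>R (x /\<^sub>R norm x)"])
     (rule radial_map_g_fun_left_inverse, auto)

lemma radial_map_inv_eq: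
  fixes x :: "complex ^ 'd"
  assumes d: "d \<ge> 1" and x: "x \<noteq> 0"
  shows "radial_map_inv (g_fun d) x = g_inv d (norm x) *\<^sub>R (x /\<^sub>R norm x)"
  unfolding radial_map_inv_def
proof (rule inv_into_f_eq[OF inj_on_radial_map_g_fun[OF d]])
  show "g_inv d (norm x) *\<^sub>R (x /\<^sub>R norm x) \<in> - {0}"
    using g_inv_works(1)[OF d, of "norm x"] x by auto
qed (rule radial_map_g_fun_right_inverse[OF d x])

lemma one_le_CARD: "CARD('d::finite) \<ge> 1"
  by (simp add: Suc_le_eq)

lemma to_sphere_from_sphere:
  fixes p :: "(complex ^ 'd) \<times> real"
  assumes p: "p \<in> sphere 0 1" "fst p \<noteq> 0"
  shows "to_sphere (from_sphere p) = p"
proof -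
  have np: "p \<in> sphere 0 1 - {north_pole}" using p by (auto simp: north_pole_def)
  have "snd p \<noteq> 1" using p sphere_pair_iff[of p] by auto
  then have "stereo p \<noteq> 0" using p by (simp add: stereo_def)
  then show ?thesis
    unfolding from_sphere_def to_sphere_def
    using stereo_inv_stereo[OF np]
    by (simp only: radial_map_inv_eq[OF one_le_CARD] radial_map_g_fun_right_inverse[OF one_le_CARD] not_False_eq_True)
qed

text \<open>The origin is included: \<open>radial_map\<close> sends 0 to 0 whatever value
  \<open>g_fun\<close> has there, and sends nothing else to 0. Point counts are therefore
  transported for every realization, without an exceptional set.\<close>

lemma inj_to_sphere: "inj (to_sphere :: complex ^ 'd \<Rightarrow> _)"
proof (rule injI)
  fix x y :: "complex ^ 'd"
  assume "to_sphere x = to_sphere y"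
  then have *: "radial_map (g_fun CARD('d)) x = radial_map (g_fun CARD('d)) y"
    unfolding to_sphere_def by (metis stereo_stereo_inv)
  have 0: "radial_map (g_fun CARD('d)) (0 :: complex ^ 'd) = 0" by (simp add: radial_map_def)
  show "x = y"
  proof (cases "x = 0 \<or> y = 0")
    case True
    then show ?thesis using * 0 radial_map_g_fun(3)[OF one_le_CARD] by metis
  next
    case False
    then show ?thesis using * inj_on_radial_map_g_fun[OF one_le_CARD, unfolded inj_on_def] by auto
  qed
qed

text \<open>At both poles \<open>stereo\<close> returns 0, by \<open>fst p = 0\<close> and
  regardless of division by zero. Since 0 is not a value of \<open>radial_map\<close> off the
  origin, \<open>from_sphere\<close> then has an unspecified but fixed value. Recording it gives a
  formula on the whole sphere, from which measurability is immediate.\<close>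

lemma from_sphere_eq:
  fixes p :: "(complex ^ 'd) \<times> real"
  assumes p: "p \<in> sphere 0 1"
  shows "from_sphere p = (if fst p = 0 then radial_map_inv (g_fun CARD('d)) 0
    else angle_radius CARD('d) (snd p / norm (fst p)) *\<^sub>R (fst p /\<^sub>R norm (fst p)))"
proof (cases "fst p = 0")
  case True
  then show ?thesis by (simp add: from_sphere_def stereo_def)
next
  case False
  obtain y s where ps: "p = (y, s)" by (cases p)
  have y: "norm y > 0" using False by (simp add: ps)
  have n: "(norm y)\<^sup>2 = 1 - s\<^sup>2" using p sphere_pair_iff[of p] by (simp add: ps)
  have "s\<^sup>2 < 1" using n zero_less_power[OF y, of 2] by linarith
  then have s: "s < 1" "-1 < s" by (auto simp: abs_square_less_1)
  define x where "x = stereo p"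
  have x: "x = (1 / (1 - s)) *\<^sub>R y" by (simp add: x_def stereo_def ps)
  have x0: "x \<noteq> 0" using y s by (auto simp: x)
  have nx: "norm x = norm y / (1 - s)" using s by (simp add: x)
  have dir: "x /\<^sub>R norm x = y /\<^sub>R norm y" using s y unfolding nx by (simp add: x inverse_eq_divide)
  have "1 + (s / norm y)\<^sup>2 = ((norm y)\<^sup>2 + s\<^sup>2) / (norm y)\<^sup>2"
    using y by (simp add: power_divide add_divide_distrib)
  also have "\<dots> = (1 / norm y)\<^sup>2" by (simp add: n power_divide)
  finally have "sqrt (1 + (s / norm y)\<^sup>2) = 1 / norm y" using y by simp
  then have "sqrt (1 + (s / norm y)\<^sup>2) + s / norm y = (1 + s) / norm y"
    by (simp add: add_divide_distrib)
  also have "\<dots> = norm x"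
  proof -
    have "norm y * norm y = (1 + s) * (1 - s)" using n by (simp add: power2_eq_square algebra_simps)
    then show ?thesis using y s by (simp add: nx frac_eq_eq)
  qed
  finally have "angle_radius CARD('d) (s / norm y) = g_inv CARD('d) (norm x)"
    by (simp add: angle_radius_def)
  then show ?thesis
    using False radial_map_inv_eq[OF one_le_CARD[where 'd='d] x0] dir
    by (simp add: from_sphere_def ps flip: x_def[unfolded ps])
qed

section \<open>Surface measure and its image in C^d\<close>

lemma space_surface_measure [simp]: "space (surface_measure :: 'a::euclidean_space measure) = sphere 0 1"
  by (simp add: surface_measure_def space_scale_measure space_restrict_space)

lemma sets_surface_measure [simp, measurable_cong]:
  "sets (surface_measure :: 'a::euclidean_space measure) = sets (restrict_space borel (sphere 0 1))"
  by (simp add: surface_measure_def)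

lemma nn_integral_surface_measure:
  fixes f :: "'a::euclidean_space \<Rightarrow> ennreal"
  assumes f: "f \<in> borel_measurable (restrict_space borel (sphere 0 1))"
  shows "(\<integral>\<^sup>+p. f p \<partial>surface_measure) =
    of_nat DIM('a) * (\<integral>\<^sup>+x. indicator (cball 0 1 - {0}) x * f (x /\<^sub>R norm x) \<partial>lborel)"
proof -
  have m: "(\<lambda>x::'a. x /\<^sub>R norm x) \<in> restrict_space lborel (cball 0 1 - {0}) \<rightarrow>\<^sub>M restrict_space borel (sphere 0 1)"
    by (rule measurable_restrict_space2)
       (auto simp: space_restrict_space intro!: measurable_restrict_space1)
  have "cball 0 1 - {0} \<in> sets (lborel :: 'a measure)" by auto
  then have "(\<integral>\<^sup>+x. f (x /\<^sub>R norm x) \<partial>restrict_space lborel (cball 0 1 - {0})) =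
     (\<integral>\<^sup>+x. indicator (cball 0 1 - {0}) x * f (x /\<^sub>R norm x) \<partial>lborel)"
    by (subst nn_integral_restrict_space) (simp_all add: mult.commute)
  then show ?thesis
    unfolding surface_measure_def
    by (simp add: nn_integral_scale_measure nn_integral_distr[OF m] f)
qed

lemma from_sphere_measurable [measurable]:
  "from_sphere \<in> borel_measurable (restrict_space borel (sphere 0 1 :: ((complex ^ 'd) \<times> real) set))"
proof -
  note [measurable] = angle_radius_measurable[OF one_le_CARD[where 'd='d]]
  have [measurable]: "fst \<in> borel_measurable (borel :: ((complex ^ 'd) \<times> real) measure)"
     "snd \<in> borel_measurable (borel :: ((complex ^ 'd) \<times> real) measure)"
    by (auto intro!: borel_measurable_continuous_onI continuous_intros)
  have "(\<lambda>p::(complex ^ 'd) \<times> real. if fst p = 0 then radial_map_inv (g_fun CARD('d)) 0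
    else angle_radius CARD('d) (snd p / norm (fst p)) *\<^sub>R (fst p /\<^sub>R norm (fst p))) \<in> borel_measurable borel"
    by measurable
  then have "(\<lambda>p::(complex ^ 'd) \<times> real. if fst p = 0 then radial_map_inv (g_fun CARD('d)) 0
    else angle_radius CARD('d) (snd p / norm (fst p)) *\<^sub>R (fst p /\<^sub>R norm (fst p))) \<in> borel_measurable (restrict_space borel (sphere 0 1))"
    by (rule measurable_restrict_space1)
  then show ?thesis
    by (rule measurable_cong[THEN iffD1, rotated]) (simp add: from_sphere_eq space_restrict_space)
qed

lemma to_sphere_in_sphere: "to_sphere z \<in> sphere 0 1"
  unfolding to_sphere_def using stereo_inv_in_sphere by blast

lemma to_sphere_measurable [measurable]:
  "to_sphere \<in> borel \<rightarrow>\<^sub>M restrict_space borel (sphere 0 1 :: ((complex ^ 'd) \<times> real) set)"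
proof (rule measurable_restrict_space2)
  \<comment> \<open>Setting \<open>g_fun\<close> to 0 at nonpositive arguments makes it monotone,
    hence Borel. The radial map does not notice, because at \<open>z = 0\<close> the scaled vector
    is 0 anyway.\<close>
  define g where "g t = (if t > 0 then g_fun CARD('d) t else 0)" for t
  have "mono g"
    using g_fun_strict_mono[OF one_le_CARD[where 'd='d]] g_fun_works(1)[OF one_le_CARD[where 'd='d]]
    by (auto simp: mono_def g_def le_less)
  then have [measurable]: "g \<in> borel_measurable borel" by (rule borel_measurable_mono)
  have eq: "radial_map (g_fun CARD('d)) z = g (norm z) *\<^sub>R (z /\<^sub>R norm z)" for z :: "complex ^ 'd"
    by (simp add: radial_map_def g_def)
  have [measurable]: "radial_map (g_fun CARD('d)) \<in> borel_measurable (borel :: (complex ^ 'd) measure)"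
    unfolding eq[abs_def] by measurable
  show "(to_sphere :: complex ^ 'd \<Rightarrow> _) \<in> borel_measurable borel"
    unfolding to_sphere_def[abs_def] stereo_inv_eq by measurable
qed (use to_sphere_in_sphere in auto)

text \<open>\<open>nn_integral_cone\<close> and \<open>nn_integral_radial\<close> have the same
  outer integral over directions, so only the inner integrals over \<open>t\<close> and
  \<open>r\<close> have to be matched, which is \<open>distr_angle_radius\<close>. The factor
  \<open>2 d + 1\<close>, the ambient dimension in \<open>surface_measure\<close>, is also the
  factor \<open>DIM + 1\<close> in the radial formula; hence no constant of the sphere of directions
  appears.\<close>

lemma nn_integral_surface_from_sphere:
  fixes f :: "complex ^ 'd \<Rightarrow> ennreal"
  assumes f [measurable]: "f \<in> borel_measurable borel"
  shows "(\<integral>\<^sup>+p. f (from_sphere p) \<partial>surface_measure) =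
    (\<integral>\<^sup>+z. ennreal (cone_constant CARD('d) / (1 + (norm z)\<^sup>2) ^ (CARD('d) + 1)) * f z \<partial>lborel)"
proof -
  define d where "d = CARD('d)"
  have d: "d \<ge> 1" unfolding d_def by (rule one_le_CARD)
  note [measurable] = angle_radius_measurable[OF d]
  define c where "c = cone_constant d"
  have c: "c > 0" unfolding c_def by (rule cone_constant_pos[OF d])
  have DIM: "DIM(complex ^ 'd) = 2 * d" by (simp add: d_def)
  define F where "F t w = f (angle_radius d t *\<^sub>R w)" for t and w :: "complex ^ 'd"
  have mF [measurable]: "case_prod F \<in> borel_measurable (borel \<Otimes>\<^sub>M borel)"
    unfolding F_def by measurable
  have "(\<integral>\<^sup>+p. f (from_sphere p) \<partial>surface_measure) = of_nat (2 * d + 1) *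
     (\<integral>\<^sup>+x. indicator (cball 0 1 - {0}) x * f (from_sphere (x /\<^sub>R norm x :: (complex ^ 'd) \<times> real)) \<partial>lborel)"
    by (subst nn_integral_surface_measure) (auto simp: d_def mult.commute)
  also have "(\<integral>\<^sup>+x. indicator (cball 0 1 - {0}) x * f (from_sphere (x /\<^sub>R norm x :: (complex ^ 'd) \<times> real)) \<partial>lborel)
    = (\<integral>\<^sup>+(y, s). indicator (cball 0 1 - {0}) (y, s) * F (s / norm y) (y /\<^sub>R norm y) \<partial>lborel)"
  proof (rule nn_integral_cong_AE)
    \<comment> \<open>The axis \<open>fst x = 0\<close> is the cone over the two poles, where the
      formula for \<open>from_sphere\<close> is a different one; it is a null set.\<close>
    have "AE y in (lborel :: (complex ^ 'd) measure). AE s in (lborel :: real measure). fst (y, s) \<noteq> 0"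
      by (rule AE_mp[OF AE_lborel_singleton[of 0]]) auto
    moreover have "{x \<in> space ((lborel :: (complex ^ 'd) measure) \<Otimes>\<^sub>M (lborel :: real measure)). fst x \<noteq> 0} = (- {0}) \<times> UNIV"
      by (auto simp: space_pair_measure)
    then have "{x \<in> space ((lborel :: (complex ^ 'd) measure) \<Otimes>\<^sub>M (lborel :: real measure)). fst x \<noteq> 0} \<in> sets (lborel \<Otimes>\<^sub>M lborel)"
      by simp
    ultimately have "AE x in lborel \<Otimes>\<^sub>M (lborel :: real measure). fst x \<noteq> (0 :: complex ^ 'd)"
      by (intro lborel_pair.AE_pair_measure) auto
    then have "AE x in (lborel :: ((complex ^ 'd) \<times> real) measure). fst x \<noteq> 0"
      by (simp only: lborel_prod)
    then show "AE x in (lborel :: ((complex ^ 'd) \<times> real) measure). indicator (cball 0 1 - {0}) x * f (from_sphere (x /\<^sub>R norm x)) =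
       (case x of (y, s) \<Rightarrow> indicator (cball 0 1 - {0}) (y, s) * F (s / norm y) (y /\<^sub>R norm y))"
    proof (rule AE_mp, intro AE_I2 impI)
      fix x :: "(complex ^ 'd) \<times> real"
      assume x: "fst x \<noteq> 0"
      obtain y s where ys: "x = (y, s)" by (cases x)
      have n: "norm x > 0" using x by auto
      have y: "y \<noteq> 0" using x by (simp add: ys)
      have "x /\<^sub>R norm x \<in> sphere 0 1" using n by simp
      from from_sphere_eq[OF this] have "from_sphere (x /\<^sub>R norm x) = angle_radius d (s / norm y) *\<^sub>R (y /\<^sub>R norm y)"
        using n y by (simp add: ys d_def) 
      then show "indicator (cball 0 1 - {0}) x * f (from_sphere (x /\<^sub>R norm x)) =
       (case x of (y, s) \<Rightarrow> indicator (cball 0 1 - {0}) (y, s) * F (s / norm y) (y /\<^sub>R norm y))"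
        by (simp add: ys F_def)
    qed
  qed
  also have "\<dots> = (\<integral>\<^sup>+y. indicator (cball 0 1 - {0}) y * ennreal (norm y) *
       (\<integral>\<^sup>+t. ennreal (1 / sqrt (1 + t\<^sup>2) ^ (2 * d + 1)) * F t (y /\<^sub>R norm y) \<partial>lborel) \<partial>lborel)"
    by (rule nn_integral_cone[OF mF, unfolded DIM])
  also have "\<dots> = (\<integral>\<^sup>+y. indicator (cball 0 1 - {0}) y * ennreal (norm y) *
       (\<integral>\<^sup>+r. indicator {0<..} r * ennreal (r ^ (2 * d - 1)) *
          (ennreal (c / (1 + (norm (r *\<^sub>R (y /\<^sub>R norm y)))\<^sup>2) ^ (d + 1)) * f (r *\<^sub>R (y /\<^sub>R norm y))) \<partial>lborel) \<partial>lborel)"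
  proof (rule nn_integral_cong)
    fix y :: "complex ^ 'd"
    show "indicator (cball 0 1 - {0}) y * ennreal (norm y) *
       (\<integral>\<^sup>+t. ennreal (1 / sqrt (1 + t\<^sup>2) ^ (2 * d + 1)) * F t (y /\<^sub>R norm y) \<partial>lborel) =
       indicator (cball 0 1 - {0}) y * ennreal (norm y) *
       (\<integral>\<^sup>+r. indicator {0<..} r * ennreal (r ^ (2 * d - 1)) *
          (ennreal (c / (1 + (norm (r *\<^sub>R (y /\<^sub>R norm y)))\<^sup>2) ^ (d + 1)) * f (r *\<^sub>R (y /\<^sub>R norm y))) \<partial>lborel)"
    proof (cases "y = 0")
      case False
      define w where "w = y /\<^sub>R norm y"
      have w: "norm w = 1" using False by (simp add: w_def)
      have "(\<integral>\<^sup>+t. ennreal (1 / sqrt (1 + t\<^sup>2) ^ (2 * d + 1)) * F t w \<partial>lborel)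
         = (\<integral>\<^sup>+t. f (angle_radius d t *\<^sub>R w) \<partial>density lborel (\<lambda>t. ennreal (1 / sqrt (1 + t\<^sup>2) ^ (2 * d + 1))))"
        unfolding F_def by (rule nn_integral_density[symmetric]) measurable
      also have "\<dots> = (\<integral>\<^sup>+r. f (r *\<^sub>R w) \<partial>distr (density lborel (\<lambda>t. ennreal (1 / sqrt (1 + t\<^sup>2) ^ (2 * d + 1)))) borel (angle_radius d))"
        by (rule nn_integral_distr[symmetric]) measurable
      also have "\<dots> = (\<integral>\<^sup>+r. indicator {0<..} r * ennreal (c * (r ^ (2 * d - 1) / (1 + r\<^sup>2) ^ (d + 1))) * f (r *\<^sub>R w) \<partial>lborel)"
        unfolding distr_angle_radius[OF d] c_def[symmetric] by (rule nn_integral_density) measurable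
      also have "\<dots> = (\<integral>\<^sup>+r. indicator {0<..} r * ennreal (r ^ (2 * d - 1)) *
          (ennreal (c / (1 + (norm (r *\<^sub>R w))\<^sup>2) ^ (d + 1)) * f (r *\<^sub>R w)) \<partial>lborel)"
      proof (rule nn_integral_cong)
        fix r :: real
        have "ennreal (c * (r ^ (2 * d - 1) / (1 + r\<^sup>2) ^ (d + 1))) = ennreal (r ^ (2 * d - 1)) * ennreal (c / (1 + r\<^sup>2) ^ (d + 1))" if "r > 0"
          using that c by (subst ennreal_mult'[symmetric]) (auto simp: mult.commute)
        then show "indicator {0<..} r * ennreal (c * (r ^ (2 * d - 1) / (1 + r\<^sup>2) ^ (d + 1))) * f (r *\<^sub>R w)
          = indicator {0<..} r * ennreal (r ^ (2 * d - 1)) *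
          (ennreal (c / (1 + (norm (r *\<^sub>R w))\<^sup>2) ^ (d + 1)) * f (r *\<^sub>R w))"
          by (cases "r > 0") (auto simp: w mult.assoc)
      qed
      finally show ?thesis by (simp add: w_def)
    qed simp
  qed
  also have "of_nat (2 * d + 1) * \<dots> = (\<integral>\<^sup>+z. ennreal (c / (1 + (norm z)\<^sup>2) ^ (d + 1)) * f z \<partial>lborel)"
  proof -
    have "(\<lambda>z :: complex ^ 'd. ennreal (c / (1 + (norm z)\<^sup>2) ^ (d + 1)) * f z) \<in> borel_measurable borel"
      by measurable
    from nn_integral_radial[OF this, unfolded DIM] show ?thesis
      by (simp only: ennreal_of_nat_eq_real_of_nat)
  qed
  finally show ?thesis by (simp only: c_def d_def)
qed

section \<open>Orthogonality and norms of monomials\<close>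

lemma nn_integral_lborel_complex:
  assumes f [measurable]: "f \<in> borel_measurable (borel :: complex measure)"
  shows "(\<integral>\<^sup>+z. f z \<partial>lborel) = (\<integral>\<^sup>+x. \<integral>\<^sup>+y. f (Complex x y) \<partial>lborel \<partial>lborel)"
proof -
  have Cm [measurable]: "(\<lambda>p. Complex (fst p) (snd p)) \<in> borel_measurable (borel \<Otimes>\<^sub>M borel)"
    unfolding Complex_eq by measurable
  have "lborel = distr (lborel \<Otimes>\<^sub>M lborel) borel (\<lambda>p. Complex (fst p) (snd p))"
  proof (rule lborel_eqI)
    fix l u :: complex
    assume "\<And>b. b \<in> Basis \<Longrightarrow> l \<bullet> b \<le> u \<bullet> b"
    from this[of 1] this[of \<i>] have le: "Re l \<le> Re u" "Im l \<le> Im u"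
      by (auto simp: Basis_complex_def)
    have "(\<lambda>p. Complex (fst p) (snd p)) -` box l u \<inter> space (lborel \<Otimes>\<^sub>M lborel) = box (Re l) (Re u) \<times> box (Im l) (Im u)"
      by (auto simp: box_def Basis_complex_def space_pair_measure)
    then have "emeasure (distr (lborel \<Otimes>\<^sub>M lborel) borel (\<lambda>p. Complex (fst p) (snd p))) (box l u)
      = emeasure (lborel \<Otimes>\<^sub>M lborel) (box (Re l) (Re u) \<times> box (Im l) (Im u))"
      by (subst emeasure_distr) auto
    also have "\<dots> = ennreal ((Re u - Re l) * (Im u - Im l))"
      using le by (subst lborel.emeasure_pair_measure_Times) (auto simp: ennreal_mult')
    finally show "emeasure (distr (lborel \<Otimes>\<^sub>M lborel) borel (\<lambda>p. Complex (fst p) (snd p))) (box l u)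
      = ennreal (\<Prod>b\<in>Basis. (u - l) \<bullet> b)"
      by (simp add: Basis_complex_def)
  qed simp
  then have "(\<integral>\<^sup>+z. f z \<partial>lborel) = (\<integral>\<^sup>+z. f z \<partial>distr (lborel \<Otimes>\<^sub>M lborel) borel (\<lambda>p. Complex (fst p) (snd p)))"
    by simp
  also have "\<dots> = (\<integral>\<^sup>+p. f (Complex (fst p) (snd p)) \<partial>(lborel \<Otimes>\<^sub>M lborel))"
    by (rule nn_integral_distr) auto
  also have "\<dots> = (\<integral>\<^sup>+x. \<integral>\<^sup>+y. f (Complex x y) \<partial>lborel \<partial>lborel)"
    by (subst lborel.nn_integral_fst[symmetric]) auto
  finally show ?thesis .
qed

lemma nn_integral_lborel_shift:
  fixes f :: "real \<Rightarrow> ennreal"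
  assumes "f \<in> borel_measurable borel"
  shows "(\<integral>\<^sup>+x. f (x + a) \<partial>lborel) = (\<integral>\<^sup>+x. f x \<partial>lborel)"
  using nn_integral_real_affine[OF assms, of 1 a] by (simp add: add.commute)

text \<open>A rotation is a product of three shears.\<close>

lemma nn_integral_lborel_rotate:
  assumes f [measurable]: "f \<in> borel_measurable (borel :: complex measure)" and c: "cmod c = 1" "Re c \<noteq> -1"
  shows "(\<integral>\<^sup>+z. f (c * z) \<partial>lborel) = (\<integral>\<^sup>+z. f z \<partial>lborel)"
proof -
  define a b where "a = Re c" and "b = Im c"
  have ab: "a\<^sup>2 + b\<^sup>2 = 1" using c by (simp add: a_def b_def cmod_def)
  \<comment> \<open>The tangent of half the angle of rotation: the rotation is the shear
    \<open>x - t y\<close>, then \<open>y + b x\<close>, then \<open>x - t y\<close> again. The half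
    turn, where \<open>t\<close> would be infinite, is excluded by the condition on
    \<open>Re c\<close>.\<close>
  define t where "t = b / (1 + a)"
  have a: "1 + a \<noteq> 0" using c by (simp add: a_def add_eq_0_iff)
  have t: "t * (1 + a) = b" using a by (simp add: t_def)
  have bt: "1 - b * t = a"
  proof -
    have "b * b = (1 - a) * (1 + a)" using ab by (simp add: power2_eq_square algebra_simps)
    then have "b * t = 1 - a" using a by (simp add: t_def)
    then show ?thesis by simp
  qed
  have [measurable]: "(\<lambda>p. Complex (g p) (h p)) \<in> borel_measurable M"
    if "g \<in> borel_measurable M" "h \<in> borel_measurable M" for g h and M :: "'b measure"
    unfolding Complex_eq using that by measurable
  have sx: "(\<integral>\<^sup>+x. \<integral>\<^sup>+y. f (Complex (x - t * y) y) \<partial>lborel \<partial>lborel) = (\<integral>\<^sup>+z. f z \<partial>lborel)"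
    if [measurable]: "f \<in> borel_measurable borel" for f :: "complex \<Rightarrow> ennreal"
  proof -
    have "(\<integral>\<^sup>+x. \<integral>\<^sup>+y. f (Complex (x - t * y) y) \<partial>lborel \<partial>lborel) = (\<integral>\<^sup>+y. \<integral>\<^sup>+x. f (Complex (x + (- (t * y))) y) \<partial>lborel \<partial>lborel)"
      by (subst lborel_pair.Fubini') simp_all
    also have "\<dots> = (\<integral>\<^sup>+y. \<integral>\<^sup>+x. f (Complex x y) \<partial>lborel \<partial>lborel)"
    proof (rule nn_integral_cong)
      show "(\<integral>\<^sup>+x. f (Complex (x + (- (t * y))) y) \<partial>lborel) = (\<integral>\<^sup>+x. f (Complex x y) \<partial>lborel)" for y
        by (rule nn_integral_lborel_shift[of "\<lambda>x. f (Complex x y)"]) measurable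
    qed
    also have "\<dots> = (\<integral>\<^sup>+x. \<integral>\<^sup>+y. f (Complex x y) \<partial>lborel \<partial>lborel)"
      by (rule lborel_pair.Fubini'[symmetric]) simp
    finally show ?thesis by (simp add: nn_integral_lborel_complex)
  qed
  have sy: "(\<integral>\<^sup>+x. \<integral>\<^sup>+y. f (Complex x (y + b * x)) \<partial>lborel \<partial>lborel) = (\<integral>\<^sup>+z. f z \<partial>lborel)"
    if [measurable]: "f \<in> borel_measurable borel" for f :: "complex \<Rightarrow> ennreal"
  proof -
    have "(\<integral>\<^sup>+x. \<integral>\<^sup>+y. f (Complex x (y + b * x)) \<partial>lborel \<partial>lborel) = (\<integral>\<^sup>+x. \<integral>\<^sup>+y. f (Complex x y) \<partial>lborel \<partial>lborel)"
    proof (rule nn_integral_cong)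
      show "(\<integral>\<^sup>+y. f (Complex x (y + b * x)) \<partial>lborel) = (\<integral>\<^sup>+y. f (Complex x y) \<partial>lborel)" for x
        by (rule nn_integral_lborel_shift[of "\<lambda>y. f (Complex x y)"]) measurable
    qed
    then show ?thesis by (simp add: nn_integral_lborel_complex)
  qed
  define f1 where "f1 z = f (Complex (Re z - t * Im z) (Im z))" for z
  define f2 where "f2 z = f1 (Complex (Re z) (Im z + b * Re z))" for z
  have [measurable]: "f1 \<in> borel_measurable borel" unfolding f1_def[abs_def] by measurable
  have [measurable]: "f2 \<in> borel_measurable borel" unfolding f2_def[abs_def] by measurable
  have "f (c * z) = f2 (Complex (Re z - t * Im z) (Im z))" for z
  proof -
    have 1: "Im z + b * (Re z - t * Im z) = b * Re z + a * Im z"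
      unfolding bt[symmetric] by (simp add: algebra_simps)
    have "Re z - t * Im z - t * (b * Re z + a * Im z) = (1 - b * t) * Re z - (t * (1 + a)) * Im z"
      by (simp add: algebra_simps)
    then have 2: "Re z - t * Im z - t * (b * Re z + a * Im z) = a * Re z - b * Im z"
      by (simp only: bt t)
    have "c * z = Complex (a * Re z - b * Im z) (b * Re z + a * Im z)"
      by (simp add: complex_eq_iff a_def b_def)
    then show ?thesis
      by (simp add: f1_def f2_def 1 2)
  qed
  then have "(\<integral>\<^sup>+z. f (c * z) \<partial>lborel) = (\<integral>\<^sup>+z. f2 (Complex (Re z - t * Im z) (Im z)) \<partial>lborel)"
    by simp
  also have "\<dots> = (\<integral>\<^sup>+z. f2 z \<partial>lborel)"
    by (subst nn_integral_lborel_complex) (simp_all add: sx)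
  also have "\<dots> = (\<integral>\<^sup>+z. f1 z \<partial>lborel)"
    unfolding f2_def by (subst nn_integral_lborel_complex) (simp_all add: sy)
  also have "\<dots> = (\<integral>\<^sup>+z. f z \<partial>lborel)"
    unfolding f1_def by (subst nn_integral_lborel_complex) (simp_all add: sx)
  finally show ?thesis .
qed

section \<open>Gaussian moments and Gamma integrals\<close>

lemma nn_integral_complex_gaussian: "(\<integral>\<^sup>+z. ennreal (exp (- (cmod z)\<^sup>2)) \<partial>lborel) = ennreal pi"
proof -
  have g: "(\<integral>\<^sup>+x. ennreal (exp (- x\<^sup>2)) \<partial>(lborel :: real measure)) = ennreal (sqrt pi)"
    using gaussian_moment_even_pos[of 0] has_bochner_integral_even_function[OF gaussian_moment_0]
    by (subst nn_integral_eq_integral) (auto simp: has_bochner_integral_iff)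
  have "(\<integral>\<^sup>+z. ennreal (exp (- (cmod z)\<^sup>2)) \<partial>lborel)
    = (\<integral>\<^sup>+x. \<integral>\<^sup>+y. ennreal (exp (- x\<^sup>2)) * ennreal (exp (- y\<^sup>2)) \<partial>lborel \<partial>lborel)"
    by (subst nn_integral_lborel_complex)
       (auto simp: cmod_power2 ennreal_mult'[symmetric] exp_add[symmetric])
  also have "\<dots> = ennreal (sqrt pi) * ennreal (sqrt pi)"
    by (simp add: nn_integral_cmult nn_integral_multc g)
  finally show ?thesis by (simp add: ennreal_mult'[symmetric])
qed

text \<open>In radial form every moment for \<open>t = 1\<close> is a one-dimensional moment times
  the same constant \<open>3 * A\<close>, the total mass of directions. The case
  \<open>k = 0\<close>, where the integral is \<open>pi\<close>, fixes this constant, so the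
  circumference of the circle is never computed.\<close>

lemma nn_integral_complex_gaussian_moment:
  assumes t: "t > 0"
  shows "(\<integral>\<^sup>+z. ennreal (cmod z ^ (2 * k) * exp (- (t * (cmod z)\<^sup>2))) \<partial>lborel) = ennreal (pi * fact k / t ^ (k + 1))"
proof -
  define A where "A = (\<integral>\<^sup>+y. indicator (cball 0 1 - {0}) y * ennreal (norm y) \<partial>(lborel :: complex measure))"
  have one: "(\<integral>\<^sup>+z. ennreal (cmod z ^ (2 * k) * exp (- (cmod z)\<^sup>2)) \<partial>lborel) = ennreal 3 * A * ennreal (fact k / 2)" for k
  proof -
    have "(\<integral>\<^sup>+z. ennreal (cmod z ^ (2 * k) * exp (- (cmod z)\<^sup>2)) \<partial>lborel) = ennreal 3 *
      (\<integral>\<^sup>+y. indicator (cball 0 1 - {0}) y * ennreal (norm y) *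
       (\<integral>\<^sup>+r. indicator {0<..} r * ennreal r * ennreal (cmod (r *\<^sub>R (y /\<^sub>R norm y)) ^ (2 * k) * exp (- (cmod (r *\<^sub>R (y /\<^sub>R norm y)))\<^sup>2)) \<partial>lborel) \<partial>(lborel :: complex measure))"
      by (subst nn_integral_radial) auto
    also have "\<dots> = ennreal 3 * (\<integral>\<^sup>+y. indicator (cball 0 1 - {0}) y * ennreal (norm y) * ennreal (fact k / 2) \<partial>(lborel :: complex measure))"
    proof (rule arg_cong, rule nn_integral_cong)
      fix y :: complex
      show "indicator (cball 0 1 - {0}) y * ennreal (norm y) *
       (\<integral>\<^sup>+r. indicator {0<..} r * ennreal r * ennreal (cmod (r *\<^sub>R (y /\<^sub>R norm y)) ^ (2 * k) * exp (- (cmod (r *\<^sub>R (y /\<^sub>R norm y)))\<^sup>2)) \<partial>lborel)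
       = indicator (cball 0 1 - {0}) y * ennreal (norm y) * ennreal (fact k / 2)"
      proof (cases "y = 0")
        case False
        have "(\<integral>\<^sup>+r. indicator {0<..} r * ennreal r * ennreal (cmod (r *\<^sub>R (y /\<^sub>R norm y)) ^ (2 * k) * exp (- (cmod (r *\<^sub>R (y /\<^sub>R norm y)))\<^sup>2)) \<partial>lborel)
          = (\<integral>\<^sup>+r. ennreal (indicator {0..} r *\<^sub>R (exp (- r\<^sup>2) * r ^ (2 * k + 1))) \<partial>lborel)"
          by (intro nn_integral_cong)
             (use False in \<open>auto simp: indicator_def ennreal_mult'[symmetric] mult_ac norm_mult norm_inverse\<close>)
        also have "\<dots> = ennreal (fact k / 2)"
          using gaussian_moment_odd_pos[of k]
          by (subst nn_integral_eq_integral) (auto simp: has_bochner_integral_iff indicator_def)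
        finally show ?thesis by simp
      qed simp
    qed
    also have "\<dots> = ennreal 3 * A * ennreal (fact k / 2)"
    proof -
      have [measurable]: "cball 0 1 \<in> sets (borel :: complex measure)" by simp
      show ?thesis unfolding A_def by (subst nn_integral_multc) (auto simp: mult.assoc)
    qed
    finally show ?thesis .
  qed
  have "ennreal pi = ennreal 3 * A * ennreal (1 / 2)"
    using one[of 0] nn_integral_complex_gaussian by simp
  then have A: "ennreal 3 * A * ennreal (fact k / 2) = ennreal (pi * fact k)"
  proof -
    assume *: "ennreal pi = ennreal 3 * A * ennreal (1 / 2)"
    have "ennreal (fact k / 2) = ennreal (1 / 2) * ennreal (fact k)" by (subst ennreal_mult'[symmetric]) simp_all
    then have "ennreal 3 * A * ennreal (fact k / 2) = ennreal 3 * A * ennreal (1 / 2) * ennreal (fact k)"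
      by (simp add: mult.assoc)
    also have "\<dots> = ennreal pi * ennreal (fact k)" by (simp only: *)
    finally show ?thesis by (simp add: ennreal_mult')
  qed
  \<comment> \<open>Scaling by \<open>1 / sqrt t\<close> reduces the general exponent to
    \<open>t = 1\<close>.\<close>
  have sc: "1 / sqrt t > 0" using t by simp
  have "(\<integral>\<^sup>+z. ennreal (cmod z ^ (2 * k) * exp (- (t * (cmod z)\<^sup>2))) \<partial>lborel)
    = ennreal ((1 / sqrt t) ^ 2) * (\<integral>\<^sup>+z. ennreal (1 / t ^ k) * ennreal (cmod z ^ (2 * k) * exp (- (cmod z)\<^sup>2)) \<partial>lborel)"
  proof (subst nn_integral_lborel_scale[OF _ sc], simp, simp only: DIM_complex, rule arg_cong, rule nn_integral_cong)
    fix z :: complex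
    have "cmod ((1 / sqrt t) *\<^sub>R z) ^ (2 * k) = 1 / t ^ k * cmod z ^ (2 * k)"
      using t by (simp add: power_mult power_mult_distrib power_divide)
    moreover have "t * (cmod ((1 / sqrt t) *\<^sub>R z))\<^sup>2 = (cmod z)\<^sup>2"
      using t by (simp add: power_divide)
    ultimately show "ennreal (cmod ((1 / sqrt t) *\<^sub>R z) ^ (2 * k) * exp (- (t * (cmod ((1 / sqrt t) *\<^sub>R z))\<^sup>2)))
       = ennreal (1 / t ^ k) * ennreal (cmod z ^ (2 * k) * exp (- (cmod z)\<^sup>2))"
      using t by (subst ennreal_mult'[symmetric]) (simp_all only: mult.assoc, simp)
  qed
  also have "\<dots> = ennreal (1 / t) * (ennreal (1 / t ^ k) * ennreal (pi * fact k))"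
    using t one[of k] A by (simp add: nn_integral_cmult power_divide)
  also have "\<dots> = ennreal (pi * fact k / t ^ (k + 1))"
    using t by (simp add: ennreal_mult'[symmetric] ac_simps)
  finally show ?thesis .
qed

lemma nn_integral_power_times_exp_scale:
  assumes s: "s > 0"
  shows "(\<integral>\<^sup>+t. indicator {0<..} t * ennreal (t ^ M * exp (- (t * s))) \<partial>lborel) = ennreal (fact M / s ^ (M + 1))"
proof -
  have "ennreal (fact M) = (\<integral>\<^sup>+x. ennreal (x ^ M * exp (- x)) * indicator {0..} x \<partial>lborel)"
    by (subst nn_intergal_power_times_exp_Ici) simp
  also have "\<dots> = (\<integral>\<^sup>+x. indicator {0<..} x * ennreal (x ^ M * exp (- x)) \<partial>lborel)"
    by (rule nn_integral_cong_AE, rule AE_mp[OF AE_lborel_singleton[of 0]]) (auto simp: indicator_def)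
  also have "\<dots> = ennreal s * (\<integral>\<^sup>+t. indicator {0<..} (s * t) * ennreal ((s * t) ^ M * exp (- (s * t))) \<partial>lborel)"
    by (subst nn_integral_real_affine[where c=s and t=0]) (use s in auto)
  also have "\<dots> = ennreal s * (\<integral>\<^sup>+t. ennreal (s ^ M) * (indicator {0<..} t * ennreal (t ^ M * exp (- (t * s)))) \<partial>lborel)"
    by (rule arg_cong, rule nn_integral_cong)
       (use s in \<open>auto simp: indicator_def zero_less_mult_iff ennreal_mult'[symmetric] power_mult_distrib mult_ac\<close>)
  also have "\<dots> = ennreal (s ^ (M + 1)) * (\<integral>\<^sup>+t. indicator {0<..} t * ennreal (t ^ M * exp (- (t * s))) \<partial>lborel)"
    using s by (subst nn_integral_cmult) (auto simp: ennreal_mult' mult.assoc)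
  finally have "ennreal (1 / s ^ (M + 1)) * ennreal (fact M) = ennreal (1 / s ^ (M + 1)) * ennreal (s ^ (M + 1)) * (\<integral>\<^sup>+t. indicator {0<..} t * ennreal (t ^ M * exp (- (t * s))) \<partial>lborel)"
    by (simp only: mult.assoc)
  also have "ennreal (1 / s ^ (M + 1)) * ennreal (s ^ (M + 1)) = 1"
    using s by (subst ennreal_mult'[symmetric]) (auto simp del: power_Suc)
  finally show ?thesis using s by (simp add: ennreal_mult'[symmetric])
qed

section \<open>Product structure of Lebesgue measure on C^d\<close>

lemma vec_lambda_measurable [measurable]:
  "(vec_lambda :: ('d::finite \<Rightarrow> 'a::euclidean_space) \<Rightarrow> _) \<in> PiM UNIV (\<lambda>_. borel) \<rightarrow>\<^sub>M borel"
proof -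
  have *: "vec_lambda x = (\<Sum>i\<in>UNIV. axis i (x i))" for x :: "'d \<Rightarrow> 'a"
    by (auto simp: Finite_Cartesian_Product.vec_eq_iff axis_def if_distrib[of "\<lambda>f. f _"] sum.delta cong: if_cong)
  have [measurable]: "(axis i :: 'a \<Rightarrow> 'a ^ 'd) \<in> borel_measurable borel" for i
  proof (rule borel_measurable_continuous_onI)
    have "linear (axis i :: 'a \<Rightarrow> 'a ^ 'd)"
      by (rule linearI) (auto simp: axis_def Finite_Cartesian_Product.vec_eq_iff)
    then show "continuous_on UNIV (axis i :: 'a \<Rightarrow> 'a ^ 'd)"
      by (rule linear_continuous_on[OF linear_conv_bounded_linear[THEN iffD1]])
  qed
  show ?thesis unfolding * by measurable
qed

lemma vec_nth_measurable [measurable]: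
  "(\<lambda>z. z $ i) \<in> borel_measurable (borel :: ('a::euclidean_space ^ 'd) measure)"
  by (intro borel_measurable_continuous_onI continuous_intros)

lemma lborel_vec:
  "lborel = distr (PiM UNIV (\<lambda>_::'d::finite. lborel :: 'a::euclidean_space measure)) borel vec_lambda"
proof (rule lborel_eqI)
  interpret product_sigma_finite "\<lambda>_::'d. lborel :: 'a measure" by standard
  fix l u :: "'a ^ 'd"
  assume le: "\<And>b. b \<in> Basis \<Longrightarrow> l \<bullet> b \<le> u \<bullet> b"
  have le': "l $ i \<bullet> b \<le> u $ i \<bullet> b" if "b \<in> Basis" for i b
    using le[of "axis i b"] that by (simp add: inner_axis axis_in_Basis_iff)
  have "vec_lambda -` box l u \<inter> space (PiM UNIV (\<lambda>_::'d. lborel :: 'a measure)) = PiE UNIV (\<lambda>i. box (l $ i) (u $ i))"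
    by (auto simp: space_PiM PiE_def Pi_def box_def Basis_vec_def inner_axis)
  then have "emeasure (distr (PiM UNIV (\<lambda>_::'d. lborel :: 'a measure)) borel vec_lambda) (box l u) =
     emeasure (PiM UNIV (\<lambda>_::'d. lborel :: 'a measure)) (PiE UNIV (\<lambda>i. box (l $ i) (u $ i)))"
    by (subst emeasure_distr) auto
  also have "\<dots> = (\<Prod>i\<in>UNIV. emeasure lborel (box (l $ i) (u $ i)))"
    by (rule emeasure_PiM) auto
  also have "\<dots> = (\<Prod>i\<in>UNIV. ennreal (\<Prod>b\<in>Basis. (u $ i - l $ i) \<bullet> b))"
    using le' by (intro prod.cong refl emeasure_lborel_box) auto
  also have "\<dots> = ennreal (\<Prod>i\<in>UNIV. \<Prod>b\<in>Basis. (u $ i - l $ i) \<bullet> b)"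
    using le' by (intro prod_ennreal prod_nonneg) (auto simp: inner_diff_left)
  also have "(\<Prod>i\<in>UNIV. \<Prod>b\<in>Basis. (u $ i - l $ i) \<bullet> b) = (\<Prod>b\<in>Basis. (u - l) \<bullet> b)"
  proof -
    have "(\<Prod>b\<in>Basis. (u - l) \<bullet> b) = (\<Prod>(i, b)\<in>UNIV \<times> Basis. (u - l) \<bullet> axis i b)"
    proof -
      have "bij_betw (\<lambda>(i, b). axis i b) (UNIV \<times> Basis) (Basis :: ('a ^ 'd) set)"
        by (auto simp: bij_betw_def inj_on_def axis_eq_axis Basis_vec_def image_iff)
      from prod.reindex_bij_betw[OF this, of "\<lambda>b. (u - l) \<bullet> b"] show ?thesis
        by (simp add: case_prod_beta')
    qed
    also have "\<dots> = (\<Prod>i\<in>UNIV. \<Prod>b\<in>Basis. (u $ i - l $ i) \<bullet> b)"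
      by (simp add: prod.cartesian_product inner_axis)
    finally show ?thesis by simp
  qed
  finally show "emeasure (distr (PiM UNIV (\<lambda>_::'d. lborel :: 'a measure)) borel vec_lambda) (box l u) = ennreal (\<Prod>b\<in>Basis. (u - l) \<bullet> b)" .
qed simp

lemma nn_integral_lborel_vec_prod:
  fixes f :: "'d::finite \<Rightarrow> 'a::euclidean_space \<Rightarrow> ennreal"
  assumes f [measurable]: "\<And>i. f i \<in> borel_measurable borel"
  shows "(\<integral>\<^sup>+z. (\<Prod>i\<in>UNIV. f i (z $ i)) \<partial>(lborel :: ('a ^ 'd) measure)) = (\<Prod>i\<in>UNIV. \<integral>\<^sup>+x. f i x \<partial>lborel)"
proof -
  interpret product_sigma_finite "\<lambda>_::'d. lborel :: 'a measure" by standard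
  have "(\<integral>\<^sup>+z. (\<Prod>i\<in>UNIV. f i (z $ i)) \<partial>(lborel :: ('a ^ 'd) measure)) =
    (\<integral>\<^sup>+z. (\<Prod>i\<in>UNIV. f i (z $ i)) \<partial>distr (PiM UNIV (\<lambda>_::'d. lborel :: 'a measure)) borel vec_lambda)"
    by (simp add: lborel_vec[symmetric])
  also have "\<dots> = (\<integral>\<^sup>+x. (\<Prod>i\<in>UNIV. f i (vec_lambda x $ i)) \<partial>PiM UNIV (\<lambda>_::'d. lborel :: 'a measure))"
    by (rule nn_integral_distr) auto
  also have "\<dots> = (\<Prod>i\<in>UNIV. \<integral>\<^sup>+x. f i x \<partial>lborel)"
    by (simp add: product_nn_integral_prod)
  finally show ?thesis .
qed

definition rotate_coord :: "'d \<Rightarrow> complex \<Rightarrow> complex ^ 'd \<Rightarrow> complex ^ 'd" where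
  "rotate_coord i c z = (\<chi> j. if j = i then c * z $ j else z $ j)"

lemma rotate_coord_measurable [measurable]: "rotate_coord i c \<in> borel_measurable borel"
proof -
  have "linear (rotate_coord i c)"
    by (rule linearI) (auto simp: rotate_coord_def Finite_Cartesian_Product.vec_eq_iff algebra_simps)
  then have "continuous_on UNIV (rotate_coord i c)"
    by (rule linear_continuous_on[OF linear_conv_bounded_linear[THEN iffD1]])
  then show ?thesis by (rule borel_measurable_continuous_onI)
qed

lemma distr_rotate_coord:
  fixes i :: "'d::finite"
  assumes c: "cmod c = 1" "Re c \<noteq> -1"
  shows "distr lborel borel (rotate_coord i c) = lborel"
proof -
  interpret product_sigma_finite "\<lambda>_::'d. lborel :: complex measure" by standard
  let ?P = "PiM UNIV (\<lambda>_::'d. lborel :: complex measure)"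
  define R where "R x = (\<lambda>j. if j = i then c * x j else x j)" for x :: "'d \<Rightarrow> complex"
  have R [measurable]: "R \<in> ?P \<rightarrow>\<^sub>M ?P"
    unfolding R_def[abs_def] by (rule measurable_PiM_single') (auto simp: space_PiM PiE_def)
  have rot: "emeasure lborel ((\<lambda>z. c * z) -` A) = emeasure lborel A" if A: "A \<in> sets borel" for A
  proof -
    have "(\<lambda>z. c * z) -` A \<in> sets borel"
      using measurable_sets[of "\<lambda>z. c * z" borel borel A] A by simp
    then have "emeasure lborel ((\<lambda>z. c * z) -` A) = (\<integral>\<^sup>+z. indicator ((\<lambda>z. c * z) -` A) z \<partial>lborel)"
      by simp
    also have "\<dots> = (\<integral>\<^sup>+z. indicator A (c * z) \<partial>lborel)"
      by (simp only: indicator_vimage comp_def)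
    also have "\<dots> = (\<integral>\<^sup>+z. indicator A z \<partial>lborel)"
      by (rule nn_integral_lborel_rotate[OF _ c]) (use A in simp)
    finally show ?thesis using A by simp
  qed
  have "distr ?P ?P R = ?P"
  proof (rule PiM_eqI)
    fix A :: "'d \<Rightarrow> complex set" assume A: "\<And>j. j \<in> UNIV \<Longrightarrow> A j \<in> sets lborel"
    define B where "B j = (if j = i then (\<lambda>z. c * z) -` A j else A j)" for j
    have B: "B j \<in> sets lborel" for j
      using A[of j] measurable_sets[of "\<lambda>z. c * z" borel borel "A j"] by (auto simp: B_def)
    have "R -` PiE UNIV A \<inter> space ?P = PiE UNIV B"
      by (auto simp: R_def B_def space_PiM PiE_def Pi_def split: if_splits)
    then have "emeasure (distr ?P ?P R) (PiE UNIV A) = emeasure ?P (PiE UNIV B)"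
      using A by (subst emeasure_distr) (auto intro!: sets_PiM_I_finite)
    also have "\<dots> = (\<Prod>j\<in>UNIV. emeasure lborel (B j))"
      by (rule emeasure_PiM) (use B in auto)
    also have "\<dots> = (\<Prod>j\<in>UNIV. emeasure lborel (A j))"
      using A rot by (intro prod.cong) (auto simp: B_def)
    finally show "emeasure (distr ?P ?P R) (PiE UNIV A) = (\<Prod>j\<in>UNIV. emeasure lborel (A j))" .
  qed auto
  have "distr lborel borel (rotate_coord i c) = distr (distr ?P borel vec_lambda) borel (rotate_coord i c)"
    by (simp add: lborel_vec[symmetric])
  also have "\<dots> = distr ?P borel (rotate_coord i c \<circ> vec_lambda)"
    by (rule distr_distr) auto
  also have "rotate_coord i c \<circ> vec_lambda = vec_lambda \<circ> R"
    by (auto simp: rotate_coord_def R_def fun_eq_iff Finite_Cartesian_Product.vec_eq_iff)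
  also have "distr ?P borel (vec_lambda \<circ> R) = distr (distr ?P ?P R) borel vec_lambda"
    by (rule distr_distr[symmetric]) auto
  also have "\<dots> = lborel" using \<open>distr ?P ?P R = ?P\<close> by (simp add: lborel_vec[symmetric])
  finally show ?thesis .
qed

lemma norm_vec_power2: "(norm (z :: complex ^ 'd))\<^sup>2 = (\<Sum>i\<in>UNIV. (cmod (z $ i))\<^sup>2)"
  by (simp add: norm_vec_def L2_set_def sum_nonneg)

text \<open>The denominator couples the coordinates. Written as a Gamma integral over
  \<open>t\<close> it becomes a Gaussian in each coordinate, and for fixed \<open>t\<close> the
  integral over \<open>z\<close> factors into moments.\<close>

lemma nn_integral_monomial_norm:
  fixes \<alpha> :: "'d::finite \<Rightarrow> nat"
  assumes \<alpha>: "(\<Sum>i\<in>UNIV. \<alpha> i) \<le> L"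
  shows "(\<integral>\<^sup>+z. ennreal ((\<Prod>i\<in>UNIV. cmod (z $ i) ^ (2 * \<alpha> i)) / (1 + (norm z)\<^sup>2) ^ (CARD('d) + L + 1)) \<partial>(lborel :: (complex ^ 'd) measure))
    = ennreal (pi ^ CARD('d) * (\<Prod>i\<in>UNIV. fact (\<alpha> i)) * fact (L - (\<Sum>i\<in>UNIV. \<alpha> i)) / fact (CARD('d) + L))"
proof -
  define d where "d = CARD('d)"
  define S where "S = (\<Sum>i\<in>UNIV. \<alpha> i)"
  define P where "P z = (\<Prod>i\<in>UNIV. cmod (z $ i) ^ (2 * \<alpha> i))" for z :: "complex ^ 'd"
  have P0: "P z \<ge> 0" for z by (simp add: P_def prod_nonneg)
  have [measurable]: "P \<in> borel_measurable borel" unfolding P_def[abs_def] by measurable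
  have "ennreal (P z / (1 + (norm z)\<^sup>2) ^ (d + L + 1)) = ennreal (1 / fact (d + L)) *
     (\<integral>\<^sup>+t. indicator {0<..} t * ennreal (t ^ (d + L) * exp (- t) * (P z * exp (- (t * (norm z)\<^sup>2)))) \<partial>lborel)" for z
  proof -
    have p: "1 + (norm z)\<^sup>2 > 0" by (simp add: add_pos_nonneg)
    have "(\<integral>\<^sup>+t. indicator {0<..} t * ennreal (t ^ (d + L) * exp (- t) * (P z * exp (- (t * (norm z)\<^sup>2)))) \<partial>lborel)
       = (\<integral>\<^sup>+t. ennreal (P z) * (indicator {0<..} t * ennreal (t ^ (d + L) * exp (- (t * (1 + (norm z)\<^sup>2))))) \<partial>lborel)"
    proof (rule nn_integral_cong)
      fix t :: real
      have "t ^ (d + L) * exp (- t) * (P z * exp (- (t * (norm z)\<^sup>2))) = P z * (t ^ (d + L) * exp (- (t * (1 + (norm z)\<^sup>2))))"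
        by (simp add: distrib_left exp_add[symmetric] mult_ac)
      then show "indicator {0<..} t * ennreal (t ^ (d + L) * exp (- t) * (P z * exp (- (t * (norm z)\<^sup>2))))
        = ennreal (P z) * (indicator {0<..} t * ennreal (t ^ (d + L) * exp (- (t * (1 + (norm z)\<^sup>2)))))"
        by (simp only: ennreal_mult'[OF P0] mult.left_commute)
    qed
    also have "\<dots> = ennreal (P z) * ennreal (fact (d + L) / (1 + (norm z)\<^sup>2) ^ (d + L + 1))"
      by (subst nn_integral_cmult) (simp, simp only: nn_integral_power_times_exp_scale[OF p])
    finally show ?thesis
      using P0[of z] by (simp add: ennreal_mult'[symmetric] del: power_Suc)
  qed
  then have "(\<integral>\<^sup>+z. ennreal (P z / (1 + (norm z)\<^sup>2) ^ (d + L + 1)) \<partial>lborel) = ennreal (1 / fact (d + L)) *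
     (\<integral>\<^sup>+z. \<integral>\<^sup>+t. indicator {0<..} t * ennreal (t ^ (d + L) * exp (- t) * (P z * exp (- (t * (norm z)\<^sup>2)))) \<partial>lborel \<partial>lborel)"
    by (simp only: ) (rule nn_integral_cmult, measurable)
  also have "(\<integral>\<^sup>+z. \<integral>\<^sup>+t. indicator {0<..} t * ennreal (t ^ (d + L) * exp (- t) * (P z * exp (- (t * (norm z)\<^sup>2)))) \<partial>lborel \<partial>lborel)
    = (\<integral>\<^sup>+t. \<integral>\<^sup>+z. indicator {0<..} t * ennreal (t ^ (d + L) * exp (- t) * (P z * exp (- (t * (norm z)\<^sup>2)))) \<partial>lborel \<partial>lborel)"
    by (rule lborel_pair.Fubini') measurable
  also have "\<dots> = (\<integral>\<^sup>+t. ennreal (pi ^ d * (\<Prod>i\<in>UNIV. fact (\<alpha> i))) * (indicator {0<..} t * ennreal (t ^ (L - S) * exp (- (t * 1)))) \<partial>lborel)"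
  proof (rule nn_integral_cong)
    fix t :: real
    show "(\<integral>\<^sup>+z. indicator {0<..} t * ennreal (t ^ (d + L) * exp (- t) * (P z * exp (- (t * (norm z)\<^sup>2)))) \<partial>lborel)
      = ennreal (pi ^ d * (\<Prod>i\<in>UNIV. fact (\<alpha> i))) * (indicator {0<..} t * ennreal (t ^ (L - S) * exp (- (t * 1))))"
    proof (cases "t > 0")
      case True
      have "(\<integral>\<^sup>+z. indicator {0<..} t * ennreal (t ^ (d + L) * exp (- t) * (P z * exp (- (t * (norm z)\<^sup>2)))) \<partial>lborel)
        = (\<integral>\<^sup>+z. ennreal (t ^ (d + L) * exp (- t)) * (\<Prod>i\<in>UNIV. ennreal (cmod (z $ i) ^ (2 * \<alpha> i) * exp (- (t * (cmod (z $ i))\<^sup>2)))) \<partial>(lborel :: (complex ^ 'd) measure))"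
        using True
        by (intro nn_integral_cong)
           (simp add: ennreal_mult' prod_ennreal prod.distrib P_def exp_sum norm_vec_power2 sum_distrib_left prod_nonneg flip: sum_negf)
      also have "\<dots> = ennreal (t ^ (d + L) * exp (- t)) * (\<Prod>i\<in>UNIV. ennreal (pi * fact (\<alpha> i) / t ^ (\<alpha> i + 1)))"
        by (subst nn_integral_cmult, simp, subst nn_integral_lborel_vec_prod, simp, simp only: nn_integral_complex_gaussian_moment[OF True])
      also have "(\<Prod>i\<in>(UNIV::'d set). ennreal (pi * fact (\<alpha> i) / t ^ (\<alpha> i + 1))) = ennreal (pi ^ d * (\<Prod>i\<in>UNIV. fact (\<alpha> i)) / t ^ (S + d))"
        using True by (subst prod_ennreal)
          (auto simp: prod_dividef prod.distrib d_def S_def power_add power_sum mult.commute simp del: power_Suc, simp add: prod.distrib mult.commute)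
      also have "ennreal (t ^ (d + L) * exp (- t)) * ennreal (pi ^ d * (\<Prod>i\<in>UNIV. fact (\<alpha> i)) / t ^ (S + d))
        = ennreal (pi ^ d * (\<Prod>i\<in>UNIV. fact (\<alpha> i)) * (t ^ (L - S) * exp (- t)))"
      proof -
        \<comment> \<open>The degree bound enters here: the moments remove \<open>S + d\<close> of
          the \<open>d + L\<close> powers of \<open>t\<close>, and what remains is a natural power,
          whose Gamma integral is \<open>fact (L - S)\<close>.\<close>
        have "t ^ (d + L) = t ^ (L - S) * t ^ (S + d)"
          using \<alpha> by (simp add: power_add[symmetric] S_def add.commute)
        then show ?thesis using True
          by (subst ennreal_mult'[symmetric]) (auto simp: mult_ac)
      qed
      finally show ?thesis using True by (simp add: ennreal_mult' prod_nonneg)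
    qed simp
  qed
  also have "\<dots> = ennreal (pi ^ d * (\<Prod>i\<in>UNIV. fact (\<alpha> i))) * ennreal (fact (L - S))"
    by (subst nn_integral_cmult) (simp, subst nn_integral_power_times_exp_scale, simp_all)
  also have "ennreal (1 / fact (d + L)) * \<dots> = ennreal (pi ^ d * (\<Prod>i\<in>UNIV. fact (\<alpha> i)) * fact (L - S) / fact (d + L))"
    by (simp add: ennreal_mult'[symmetric] prod_nonneg)
  finally show ?thesis by (simp add: d_def S_def P_def)
qed

section \<open>The reproducing kernel of the weighted polynomials\<close>

text \<open>The slack variable \<open>a\<close> takes up the missing degree. In the induction step
  the binomial theorem splits off \<open>x j\<close> while \<open>a\<close> stays with the other
  variables. Division by \<open>fact L\<close> turns the coefficients into products over the
  variables. Exponents vanish off \<open>S\<close>, so that updating at \<open>j\<close> is a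
  bijection of index sets; finiteness is carried along because the sums are rearranged.\<close>

lemma multinomial_with_slack:
  fixes x :: "'i \<Rightarrow> 'a::field_char_0"
  assumes "finite S"
  shows "(a + (\<Sum>i\<in>S. x i)) ^ L / fact L =
    (\<Sum>\<alpha> | (\<forall>i. i \<notin> S \<longrightarrow> \<alpha> i = 0) \<and> (\<Sum>i\<in>S. \<alpha> i) \<le> L.
       a ^ (L - (\<Sum>i\<in>S. \<alpha> i)) / fact (L - (\<Sum>i\<in>S. \<alpha> i)) * (\<Prod>i\<in>S. x i ^ \<alpha> i / fact (\<alpha> i)))"
    and "finite {\<alpha> :: 'i \<Rightarrow> nat. (\<forall>i. i \<notin> S \<longrightarrow> \<alpha> i = 0) \<and> (\<Sum>i\<in>S. \<alpha> i) \<le> L}"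
  using assms
proof (induction S arbitrary: L rule: finite_induct)
  case empty
  {
    case 1
    have "{\<alpha> :: 'i \<Rightarrow> nat. \<forall>i. \<alpha> i = 0} = {\<lambda>_. 0}" by auto
    then show ?case by simp
  next
    case 2
    have "{\<alpha> :: 'i \<Rightarrow> nat. \<forall>i. \<alpha> i = 0} = {\<lambda>_. 0}" by auto
    then show ?case by simp
  }
next
  case (insert j S)
  define A where "A S L = {\<alpha> :: 'i \<Rightarrow> nat. (\<forall>i. i \<notin> S \<longrightarrow> \<alpha> i = 0) \<and> (\<Sum>i\<in>S. \<alpha> i) \<le> L}" for S L
  define F where "F S L \<alpha> = a ^ (L - (\<Sum>i\<in>S. \<alpha> i)) / fact (L - (\<Sum>i\<in>S. \<alpha> i)) * (\<Prod>i\<in>S. x i ^ \<alpha> i / fact (\<alpha> i))" for S L and \<alpha> :: "'i \<Rightarrow> nat"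
  have IH: "(a + (\<Sum>i\<in>S. x i)) ^ L / fact L = sum (F S L) (A S L)" "finite (A S L)" for L
    using insert.IH[of L] by (simp_all add: A_def F_def)
  define T where "T L = (SIGMA k:{..L}. A S (L - k))" for L
  have T: "finite (T L)" for L unfolding T_def using IH(2) by auto
  have upd: "(\<Sum>i\<in>S. (\<beta>(j := k)) i) = (\<Sum>i\<in>S. \<beta> i)" for \<beta> :: "'i \<Rightarrow> nat" and k
    using insert by (intro sum.cong) auto
  have upd': "(\<Sum>i\<in>S. if i = j then k else \<beta> i) = (\<Sum>i\<in>S. \<beta> i)" for \<beta> :: "'i \<Rightarrow> nat" and k
    using insert by (intro sum.cong) auto
  have bij: "bij_betw (\<lambda>(k, \<beta>). \<beta>(j := k)) (T L) (A (insert j S) L)" for L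
  proof (rule bij_betwI[where g="\<lambda>\<alpha>. (\<alpha> j, \<alpha>(j := 0))"])
    show "(\<lambda>(k, \<beta>). \<beta>(j := k)) \<in> T L \<rightarrow> A (insert j S) L"
      using insert by (auto simp: T_def A_def upd')
    show "(\<lambda>\<alpha>. (\<alpha> j, \<alpha>(j := 0))) \<in> A (insert j S) L \<rightarrow> T L"
      using insert by (auto simp: T_def A_def upd')
    show "(\<lambda>\<alpha>. (\<alpha> j, \<alpha>(j := 0))) ((\<lambda>(k, \<beta>). \<beta>(j := k)) p) = p" if "p \<in> T L" for p
      using that insert by (auto simp: T_def A_def fun_eq_iff)
  qed auto
  {
    case (2 L)
    show ?case using bij_betw_finite[OF bij] T by (simp add: A_def)
  next
    case (1 L)
    have "(a + (\<Sum>i\<in>insert j S. x i)) ^ L / fact L = (x j + (a + (\<Sum>i\<in>S. x i))) ^ L / fact L"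
      using insert by (simp add: algebra_simps)
    also have "\<dots> = (\<Sum>k\<le>L. x j ^ k / fact k * ((a + (\<Sum>i\<in>S. x i)) ^ (L - k) / fact (L - k)))"
    proof -
      have "(u + b) ^ L / fact L = (\<Sum>k\<le>L. u ^ k / fact k * (b ^ (L - k) / fact (L - k)))" for u b :: 'a
        by (simp add: binomial_ring sum_divide_distrib binomial_fact)
      then show ?thesis .
    qed
    also have "\<dots> = (\<Sum>k\<le>L. \<Sum>\<beta>\<in>A S (L - k). x j ^ k / fact k * F S (L - k) \<beta>)"
      by (simp add: IH(1) sum_distrib_left)
    also have "\<dots> = (\<Sum>(k, \<beta>)\<in>T L. x j ^ k / fact k * F S (L - k) \<beta>)"
      unfolding T_def by (rule sum.Sigma) (use IH(2) in auto)
    also have "\<dots> = (\<Sum>p\<in>T L. F (insert j S) L ((\<lambda>(k, \<beta>). \<beta>(j := k)) p))"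
    proof (intro sum.cong refl, clarify)
      fix k \<beta> assume "(k, \<beta>) \<in> T L"
      have "(\<Prod>i\<in>S. x i ^ (\<beta>(j := k)) i / fact ((\<beta>(j := k)) i)) = (\<Prod>i\<in>S. x i ^ \<beta> i / fact (\<beta> i))"
        using insert by (intro prod.cong) auto
      then show "x j ^ k / fact k * F S (L - k) \<beta> = F (insert j S) L (\<beta>(j := k))"
        using insert upd[of \<beta> k] by (simp add: F_def mult_ac)
    qed
    also have "\<dots> = sum (F (insert j S) L) (A (insert j S) L)"
      by (rule sum.reindex_bij_betw[OF bij])
    finally show ?case by (simp only: A_def F_def[abs_def])
  }
qed

lemma multinomial_one_plus:
  fixes x :: "'d::finite \<Rightarrow> 'a::field_char_0"
  shows "(1 + (\<Sum>i\<in>UNIV. x i)) ^ L =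
    (\<Sum>\<alpha> | (\<Sum>i\<in>UNIV. \<alpha> i) \<le> L. fact L / (fact (L - (\<Sum>i\<in>UNIV. \<alpha> i)) * (\<Prod>i\<in>UNIV. fact (\<alpha> i))) * (\<Prod>i\<in>UNIV. x i ^ \<alpha> i))"
proof -
  have "(1 + (\<Sum>i\<in>UNIV. x i)) ^ L / fact L = (\<Sum>\<alpha> | (\<Sum>i\<in>UNIV. \<alpha> i) \<le> L.
     1 / fact (L - (\<Sum>i\<in>UNIV. \<alpha> i)) * (\<Prod>i\<in>UNIV. x i ^ \<alpha> i / fact (\<alpha> i)))"
    using multinomial_with_slack(1)[of UNIV 1 x L] by simp
  then have "(1 + (\<Sum>i\<in>UNIV. x i)) ^ L = fact L * (\<Sum>\<alpha> | (\<Sum>i\<in>UNIV. \<alpha> i) \<le> L.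
     1 / fact (L - (\<Sum>i\<in>UNIV. \<alpha> i)) * (\<Prod>i\<in>UNIV. x i ^ \<alpha> i / fact (\<alpha> i)))"
    by (simp add: field_simps)
  also have "\<dots> = (\<Sum>\<alpha> | (\<Sum>i\<in>UNIV. \<alpha> i) \<le> L. fact L / (fact (L - (\<Sum>i\<in>UNIV. \<alpha> i)) * (\<Prod>i\<in>UNIV. fact (\<alpha> i))) * (\<Prod>i\<in>UNIV. x i ^ \<alpha> i))"
    by (simp add: sum_distrib_left prod_dividef mult_ac)
  finally show ?thesis .
qed

lemma finite_multi_indices: "finite {\<alpha> :: 'd::finite \<Rightarrow> nat. (\<Sum>i\<in>UNIV. \<alpha> i) \<le> L}"
  using multinomial_with_slack(2)[of "UNIV :: 'd set" L] by simp

section \<open>Orthogonality of the weighted monomials\<close>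

text \<open>The denominator of the weighted monomials, a power of the Fubini--Study weight.\<close>

definition FS_weight :: "nat \<Rightarrow> complex ^ 'd \<Rightarrow> real" where
  "FS_weight L z = (1 + (norm z)\<^sup>2) powr ((real CARD('d) + real L + 1) / 2)"

lemma FS_weight_square: "(FS_weight L (z :: complex ^ 'd))\<^sup>2 = (1 + (norm z)\<^sup>2) ^ (CARD('d) + L + 1)"
proof -
  have p: "1 + (norm z)\<^sup>2 > 0" by (simp add: add_pos_nonneg)
  have "(FS_weight L z)\<^sup>2 = (1 + (norm z)\<^sup>2) powr (real (CARD('d) + L + 1))"
    unfolding FS_weight_def power2_eq_square powr_add[symmetric] field_sum_of_halves by (simp add: add_ac)
  then show ?thesis using p by (simp only: powr_realpow)
qed

lemma weighted_monomial_eq: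
  "weighted_monomial L \<alpha> (z :: complex ^ 'd) = (\<Prod>i\<in>UNIV. (z $ i) ^ \<alpha> i) / complex_of_real (FS_weight L z)"
  by (simp add: weighted_monomial_def FS_weight_def)

lemma weighted_monomial_measurable [measurable]:
  "weighted_monomial L \<alpha> \<in> borel_measurable (borel :: (complex ^ 'd) measure)"
  unfolding weighted_monomial_def[abs_def] by measurable

definition monomial_norm2 :: "nat \<Rightarrow> ('d::finite \<Rightarrow> nat) \<Rightarrow> real" where
  "monomial_norm2 L \<alpha> = pi ^ CARD('d) * (\<Prod>i\<in>UNIV. fact (\<alpha> i)) * fact (L - (\<Sum>i\<in>UNIV. \<alpha> i)) / fact (CARD('d) + L)"

lemma monomial_norm2_pos: "monomial_norm2 L \<alpha> > 0"
  by (auto simp: monomial_norm2_def intro!: divide_pos_pos mult_pos_pos prod_pos)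

lemma weighted_monomial_norm:
  fixes \<alpha> :: "'d::finite \<Rightarrow> nat"
  assumes "(\<Sum>i\<in>UNIV. \<alpha> i) \<le> L"
  shows "has_bochner_integral lborel (\<lambda>z :: complex ^ 'd. (cmod (weighted_monomial L \<alpha> z))\<^sup>2) (monomial_norm2 L \<alpha>)"
proof (rule has_bochner_integral_nn_integral)
  have "(cmod (weighted_monomial L \<alpha> z))\<^sup>2 = (\<Prod>i\<in>UNIV. cmod (z $ i) ^ (2 * \<alpha> i)) / (1 + (norm z)\<^sup>2) ^ (CARD('d) + L + 1)" for z :: "complex ^ 'd"
  proof -
    have "(cmod (weighted_monomial L \<alpha> z))\<^sup>2 = (\<Prod>i\<in>UNIV. cmod (z $ i) ^ \<alpha> i)\<^sup>2 / (FS_weight L z)\<^sup>2"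
      by (simp add: weighted_monomial_eq norm_divide prod_norm[symmetric] norm_power power_divide)
    then show ?thesis
      by (simp only: FS_weight_square prod_power_distrib power_mult[symmetric] mult.commute)
  qed
  then show "(\<integral>\<^sup>+z. ennreal ((cmod (weighted_monomial L \<alpha> z))\<^sup>2) \<partial>(lborel :: (complex ^ 'd) measure)) = ennreal (monomial_norm2 L \<alpha>)"
    unfolding monomial_norm2_def by (simp only: nn_integral_monomial_norm[OF assms])
qed (use monomial_norm2_pos[of L \<alpha>] in auto)

lemma norm_rotate_coord:
  assumes "cmod c = 1" shows "norm (rotate_coord i c z) = norm z"
proof -
  have "(norm (rotate_coord i c z))\<^sup>2 = (norm z)\<^sup>2"
    unfolding norm_vec_power2 by (rule sum.cong) (auto simp: rotate_coord_def norm_mult assms)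
  then show ?thesis by simp
qed

lemma weighted_monomial_rotate_coord:
  assumes "cmod c = 1"
  shows "weighted_monomial L \<alpha> (rotate_coord i c z) = c ^ \<alpha> i * weighted_monomial L \<alpha> z"
proof -
  have "(\<Prod>j\<in>UNIV. (rotate_coord i c z $ j) ^ \<alpha> j) = (\<Prod>j\<in>UNIV. (if j = i then c ^ \<alpha> i else 1) * (z $ j) ^ \<alpha> j)"
    by (rule prod.cong) (auto simp: rotate_coord_def power_mult_distrib)
  also have "\<dots> = c ^ \<alpha> i * (\<Prod>j\<in>UNIV. (z $ j) ^ \<alpha> j)"
    by (simp add: prod.distrib)
  finally show ?thesis
    by (simp add: weighted_monomial_eq FS_weight_def norm_rotate_coord[OF assms])
qed

lemma integrable_mult_cnj:
  fixes f g :: "'a \<Rightarrow> complex"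
  assumes [measurable]: "f \<in> borel_measurable M" "g \<in> borel_measurable M"
    and "integrable M (\<lambda>x. (cmod (f x))\<^sup>2)" "integrable M (\<lambda>x. (cmod (g x))\<^sup>2)"
  shows "integrable M (\<lambda>x. f x * cnj (g x))"
proof (rule Bochner_Integration.integrable_bound)
  show "integrable M (\<lambda>x. (cmod (f x))\<^sup>2 + (cmod (g x))\<^sup>2)"
    using assms by simp
  have "norm (f x * cnj (g x)) \<le> norm ((cmod (f x))\<^sup>2 + (cmod (g x))\<^sup>2)" for x
  proof -
    have "0 \<le> (cmod (f x) - cmod (g x))\<^sup>2 + ((cmod (f x))\<^sup>2 + (cmod (g x))\<^sup>2)" by simp
    then show ?thesis by (simp add: norm_mult power2_diff)
  qed
  then show "AE x in M. norm (f x * cnj (g x)) \<le> norm ((cmod (f x))\<^sup>2 + (cmod (g x))\<^sup>2)" by simp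
  show "(\<lambda>x. f x * cnj (g x)) \<in> borel_measurable M"
    by (intro borel_measurable_times assms(1) measurable_compose[OF assms(2)] borel_measurable_continuous_onI continuous_intros)
qed

text \<open>A rotation that tells the exponents \<open>a\<close> and \<open>b\<close> apart. The
  angle \<open>1 / |a - b|\<close> makes the product \<open>cis 1\<close> or
  \<open>cis (- 1)\<close>, both different from 1; being positive and at most 1, it stays clear of
  the half turn that \<open>nn_integral_lborel_rotate\<close> excludes.\<close>

lemma cis_inverse_nat_neq:
  assumes "(a::nat) \<noteq> b"
  obtains c where "cmod c = 1" "Re c \<noteq> -1" "c ^ a * cnj c ^ b \<noteq> 1"
proof -
  define \<theta> where "\<theta> = 1 / \<bar>real a - real b\<bar>"
  have k: "\<bar>real a - real b\<bar> \<ge> 1" using assms by linarith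
  have \<theta>: "0 < \<theta>" "\<theta> \<le> 1" using k assms by (auto simp: \<theta>_def)
  have s: "sin \<theta> > 0" using \<theta> pi_gt3 by (intro sin_gt_zero) auto
  have "Re (cis \<theta>) \<noteq> -1"
  proof
    assume "Re (cis \<theta>) = -1"
    then have "(cos \<theta>)\<^sup>2 = 1" by simp
    with sin_cos_squared_add[of \<theta>] s show False by simp
  qed
  moreover have "cis \<theta> ^ a * cnj (cis \<theta>) ^ b = cis ((real a - real b) * \<theta>)"
    by (simp add: cis_cnj Complex.DeMoivre cis_mult left_diff_distrib)
  moreover have "cis ((real a - real b) * \<theta>) \<noteq> 1"
  proof -
    have "(real a - real b) * \<theta> = 1 \<or> (real a - real b) * \<theta> = -1"
    proof -
      have "r * (1 / \<bar>r\<bar>) = 1 \<or> r * (1 / \<bar>r\<bar>) = -1" if "r \<noteq> 0" for r :: real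
        using that by (cases "r > 0") auto
      from this[of "real a - real b"] assms show ?thesis by (simp add: \<theta>_def)
    qed
    moreover have "sin (1::real) > 0" using pi_gt3 by (intro sin_gt_zero) auto
    ultimately show ?thesis by (auto simp: complex_eq_iff)
  qed
  ultimately show ?thesis using that[of "cis \<theta>"] by simp
qed

lemma weighted_monomial_inner:
  fixes \<alpha> \<beta> :: "'d::finite \<Rightarrow> nat"
  assumes "(\<Sum>i\<in>UNIV. \<alpha> i) \<le> L" "(\<Sum>i\<in>UNIV. \<beta> i) \<le> L"
  shows "has_bochner_integral lborel (\<lambda>z :: complex ^ 'd. weighted_monomial L \<alpha> z * cnj (weighted_monomial L \<beta> z))
    (if \<alpha> = \<beta> then complex_of_real (monomial_norm2 L \<alpha>) else 0)"
proof (cases "\<alpha> = \<beta>")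
  case True
  have "has_bochner_integral lborel (\<lambda>z :: complex ^ 'd. complex_of_real ((cmod (weighted_monomial L \<alpha> z))\<^sup>2)) (complex_of_real (monomial_norm2 L \<alpha>))"
    by (rule has_bochner_integral_of_real[OF weighted_monomial_norm[OF assms(1)]])
  then show ?thesis using True by (simp only: complex_norm_square True simp_thms if_True)
next
  case False
  let ?F = "\<lambda>z :: complex ^ 'd. weighted_monomial L \<alpha> z * cnj (weighted_monomial L \<beta> z)"
  have int: "integrable lborel ?F"
    by (rule integrable_mult_cnj)
       (use weighted_monomial_norm[OF assms(1)] weighted_monomial_norm[OF assms(2)] in \<open>auto simp: has_bochner_integral_iff\<close>)
  from False obtain i where "\<alpha> i \<noteq> \<beta> i" by auto
  then obtain c where c: "cmod c = 1" "Re c \<noteq> -1" "c ^ \<alpha> i * cnj c ^ \<beta> i \<noteq> 1"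
    by (rule cis_inverse_nat_neq)
  have m: "?F \<in> borel_measurable borel" using borel_measurable_integrable[OF int] by simp
  \<comment> \<open>Rotating coordinate \<open>i\<close> preserves the measure and multiplies the
    integrand by a constant other than 1, so the integral equals that constant times itself.\<close>
  have "integral\<^sup>L lborel ?F = integral\<^sup>L (distr lborel borel (rotate_coord i c)) ?F"
    by (simp add: distr_rotate_coord[OF c(1,2)])
  also have "\<dots> = (\<integral>z. ?F (rotate_coord i c z) \<partial>lborel)"
    by (rule integral_distr) (use m in auto)
  also have "\<dots> = (\<integral>z. (c ^ \<alpha> i * cnj c ^ \<beta> i) * ?F z \<partial>lborel)"
    by (simp add: weighted_monomial_rotate_coord[OF c(1)] mult_ac)
  also have "\<dots> = (c ^ \<alpha> i * cnj c ^ \<beta> i) * integral\<^sup>L lborel ?F"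
    by simp
  finally have "integral\<^sup>L lborel ?F = 0" using c(3) by simp
  then show ?thesis using int False by (simp add: has_bochner_integral_iff)
qed

section \<open>The explicit reproducing kernel and its uniqueness\<close>

lemma span_of_integrable:
  assumes f: "f \<in> span_of A e" and g: "g \<in> span_of A e"
    and e: "\<And>\<alpha> \<beta>. \<alpha> \<in> A \<Longrightarrow> \<beta> \<in> A \<Longrightarrow> integrable M (\<lambda>x. e \<alpha> x * cnj (e \<beta> x))"
  shows "integrable M (\<lambda>x. f x * cnj (g x))"
proof -
  obtain c where c: "f = (\<lambda>x. \<Sum>i\<in>A. c i * e i x)" using f by (auto simp: span_of_def)
  obtain c' where c': "g = (\<lambda>x. \<Sum>i\<in>A. c' i * e i x)" using g by (auto simp: span_of_def)
  have "(\<lambda>x. f x * cnj (g x)) = (\<lambda>x. \<Sum>i\<in>A. \<Sum>j\<in>A. (c i * cnj (c' j)) * (e i x * cnj (e j x)))"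
    by (simp add: c c' sum_product mult_ac)
  then show ?thesis using e by auto
qed

lemma span_of_reproducing:
  assumes f: "f \<in> span_of A e" and A: "finite A"
    and e: "\<And>\<alpha> \<beta>. \<alpha> \<in> A \<Longrightarrow> \<beta> \<in> A \<Longrightarrow>
      has_bochner_integral M (\<lambda>x. e \<alpha> x * cnj (e \<beta> x)) (if \<alpha> = \<beta> then complex_of_real (n \<alpha>) else 0)"
    and n: "\<And>\<alpha>. \<alpha> \<in> A \<Longrightarrow> n \<alpha> \<noteq> 0"
  shows "(\<integral>z. f z * cnj (\<Sum>\<beta>\<in>A. e \<beta> z * cnj (e \<beta> w) / complex_of_real (n \<beta>)) \<partial>M) = f w"
proof -
  obtain c where c: "f = (\<lambda>x. \<Sum>i\<in>A. c i * e i x)" using f by (auto simp: span_of_def)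
  have "has_bochner_integral M (\<lambda>z. \<Sum>i\<in>A. \<Sum>j\<in>A. (c i * (e j w / complex_of_real (n j))) * (e i z * cnj (e j z)))
     (\<Sum>i\<in>A. \<Sum>j\<in>A. (c i * (e j w / complex_of_real (n j))) * (if i = j then complex_of_real (n i) else 0))"
    by (intro has_bochner_integral_sum has_bochner_integral_mult_right e)
  also have "(\<lambda>z. \<Sum>i\<in>A. \<Sum>j\<in>A. (c i * (e j w / complex_of_real (n j))) * (e i z * cnj (e j z)))
    = (\<lambda>z. f z * cnj (\<Sum>\<beta>\<in>A. e \<beta> z * cnj (e \<beta> w) / complex_of_real (n \<beta>)))"
    by (simp add: c sum_product mult_ac)
  also have "(\<Sum>i\<in>A. \<Sum>j\<in>A. (c i * (e j w / complex_of_real (n j))) * (if i = j then complex_of_real (n i) else 0)) = f w"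
    using A n by (simp add: c if_distrib[of "\<lambda>x. _ * x"] sum.delta cong: if_cong)
  finally show ?thesis by (rule has_bochner_integral_integral_eq)
qed

text \<open>The prefactor is the reciprocal of the squared norm of the constant monomial,
  \<open>monomial_norm2 L (\<lambda>_. 0)\<close>.\<close>

definition H_kernel :: "nat \<Rightarrow> complex ^ 'd \<Rightarrow> complex ^ 'd \<Rightarrow> complex" where
  "H_kernel L z w = complex_of_real (fact (CARD('d) + L) / (pi ^ CARD('d) * fact L)) * (1 + hermitian_prod z w) ^ L /
     complex_of_real (FS_weight L z * FS_weight L w)"

text \<open>Squared norms are proportional to \<open>fact (L - |\<alpha>|)\<close> times the product
  of the \<open>fact (\<alpha> i)\<close>, which is the denominator of the multinomial coefficient.
  Hence every coefficient of the expanded power, times the prefactor, is the reciprocal of a squared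
  norm.\<close>

lemma H_kernel_eq_sum:
  fixes z w :: "complex ^ 'd"
  shows "H_kernel L z w = (\<Sum>\<alpha> | (\<Sum>i\<in>UNIV. \<alpha> i) \<le> L. weighted_monomial L \<alpha> z * cnj (weighted_monomial L \<alpha> w) / complex_of_real (monomial_norm2 L \<alpha>))"
proof -
  have "(1 + hermitian_prod z w) ^ L = (\<Sum>\<alpha> | (\<Sum>i\<in>UNIV. \<alpha> i) \<le> L. fact L / (fact (L - (\<Sum>i\<in>UNIV. \<alpha> i)) * (\<Prod>i\<in>UNIV. fact (\<alpha> i))) * (\<Prod>i\<in>UNIV. (z $ i * cnj (w $ i)) ^ \<alpha> i))"
    unfolding hermitian_prod_def by (rule multinomial_one_plus)
  then have "H_kernel L z w = (\<Sum>\<alpha> | (\<Sum>i\<in>UNIV. \<alpha> i) \<le> L. complex_of_real (fact (CARD('d) + L) / (pi ^ CARD('d) * fact L)) *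
     (fact L / (fact (L - (\<Sum>i\<in>UNIV. \<alpha> i)) * (\<Prod>i\<in>UNIV. fact (\<alpha> i))) * (\<Prod>i\<in>UNIV. (z $ i * cnj (w $ i)) ^ \<alpha> i)) /
     complex_of_real (FS_weight L z * FS_weight L w))"
    by (simp only: H_kernel_def sum_distrib_left sum_divide_distrib)
  also have "\<dots> = (\<Sum>\<alpha> | (\<Sum>i\<in>UNIV. \<alpha> i) \<le> L. weighted_monomial L \<alpha> z * cnj (weighted_monomial L \<alpha> w) / complex_of_real (monomial_norm2 L \<alpha>))"
    by (rule sum.cong)
       (simp_all add: weighted_monomial_eq monomial_norm2_def power_mult_distrib prod.distrib field_simps)
  finally show ?thesis .
qed

lemma H_kernel_in_H_space:
  fixes w :: "complex ^ 'd"
  shows "(\<lambda>z. H_kernel L z w) \<in> H_space L"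
  unfolding H_space_def span_of_def H_kernel_eq_sum
  by (intro CollectI exI[of _ "\<lambda>\<alpha>. cnj (weighted_monomial L \<alpha> w) / complex_of_real (monomial_norm2 L \<alpha>)"])
     (simp add: mult_ac)

lemma H_space_reproducing:
  fixes f :: "complex ^ 'd \<Rightarrow> complex"
  assumes "f \<in> H_space L"
  shows "(\<integral>z. f z * cnj (H_kernel L z w) \<partial>lborel) = f w"
  unfolding H_kernel_eq_sum
proof (rule span_of_reproducing[OF assms[unfolded H_space_def] finite_multi_indices])
  show "monomial_norm2 L \<alpha> \<noteq> 0" for \<alpha> :: "'d \<Rightarrow> nat"
    using monomial_norm2_pos[of L \<alpha>] by simp
qed (rule weighted_monomial_inner, simp_all)

lemma H_space_integrable:
  fixes f g :: "complex ^ 'd \<Rightarrow> complex"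
  assumes "f \<in> H_space L" "g \<in> H_space L"
  shows "integrable lborel (\<lambda>z. f z * cnj (g z))"
proof (rule span_of_integrable[OF assms[unfolded H_space_def]])
  fix \<alpha> \<beta> :: "'d \<Rightarrow> nat"
  assume "\<alpha> \<in> {\<alpha>. sum \<alpha> UNIV \<le> L}" "\<beta> \<in> {\<alpha>. sum \<alpha> UNIV \<le> L}"
  then show "integrable lborel (\<lambda>z. weighted_monomial L \<alpha> z * cnj (weighted_monomial L \<beta> z))"
    using weighted_monomial_inner[of \<alpha> L \<beta>] by (simp add: has_bochner_integral_iff)
qed

lemma H_space_measurable: "f \<in> H_space L \<Longrightarrow> f \<in> borel_measurable (borel :: (complex ^ 'd) measure)"
  by (auto simp: H_space_def span_of_def)

lemma H_space_diff:
  assumes "f \<in> H_space L" "g \<in> H_space L" shows "(\<lambda>z. f z - g z) \<in> H_space L"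
proof -
  let ?A = "{\<alpha>. (\<Sum>i\<in>UNIV. \<alpha> i) \<le> L}"
  from assms obtain c c' where "f = (\<lambda>x. \<Sum>i\<in>?A. c i * weighted_monomial L i x)" "g = (\<lambda>x. \<Sum>i\<in>?A. c' i * weighted_monomial L i x)"
    by (auto simp: H_space_def span_of_def)
  then have "(\<lambda>z. f z - g z) = (\<lambda>x. \<Sum>i\<in>?A. (c i - c' i) * weighted_monomial L i x)"
    by (simp add: sum_subtractf left_diff_distrib)
  then show ?thesis by (auto simp: H_space_def span_of_def)
qed

text \<open>For \<open>y\<close> off the exceptional set the representer \<open>h\<close> and the
  section of \<open>H_kernel\<close> evaluate alike on the space. Their difference \<open>f\<close>
  belongs to the space and is therefore orthogonal to itself.\<close>

lemma reproducing_kernel_H_space_unique: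
  fixes K :: "complex ^ 'd \<Rightarrow> complex ^ 'd \<Rightarrow> complex"
  assumes "reproducing_kernel lborel (H_space L) K"
  obtains Z where "Z \<in> null_sets lborel" "\<And>x y. x \<notin> Z \<Longrightarrow> y \<notin> Z \<Longrightarrow> K x y = H_kernel L x y"
proof -
  from assms obtain Z where Z: "Z \<in> null_sets lborel"
    and ex: "\<forall>y\<in>space lborel - Z. \<exists>h\<in>H_space L. (\<forall>x\<in>space lborel - Z. K x y = h x) \<and> (\<forall>f\<in>H_space L. f y = (\<integral>x. f x * cnj (h x) \<partial>lborel))"
    unfolding reproducing_kernel_def by blast
  have "K x y = H_kernel L x y" if xy: "x \<notin> Z" "y \<notin> Z" for x y
  proof -
    obtain h where h: "h \<in> H_space L" "\<And>x. x \<notin> Z \<Longrightarrow> K x y = h x"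
      and rep: "\<And>f. f \<in> H_space L \<Longrightarrow> f y = (\<integral>x. f x * cnj (h x) \<partial>lborel)"
      using bspec[OF ex, of y] xy(2) by auto
    define k where "k = (\<lambda>z. H_kernel L z y)"
    have k: "k \<in> H_space L" unfolding k_def by (rule H_kernel_in_H_space)
    define f where "f = (\<lambda>z. h z - k z)"
    have f: "f \<in> H_space L" unfolding f_def by (rule H_space_diff[OF h(1) k])
    have "(\<integral>z. f z * cnj (f z) \<partial>lborel) = (\<integral>z. f z * cnj (h z) - f z * cnj (k z) \<partial>lborel)"
      by (rule Bochner_Integration.integral_cong) (simp_all add: f_def algebra_simps)
    also have "\<dots> = (\<integral>z. f z * cnj (h z) \<partial>lborel) - (\<integral>z. f z * cnj (k z) \<partial>lborel)"
      by (rule Bochner_Integration.integral_diff[OF H_space_integrable[OF f h(1)] H_space_integrable[OF f k]])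
    also have "\<dots> = 0"
      using rep[OF f] H_space_reproducing[OF f, of y] by (simp add: k_def)
    finally have 0: "(\<integral>z. f z * cnj (f z) \<partial>lborel) = 0" .
    have int: "integrable lborel (\<lambda>z. (cmod (f z))\<^sup>2)"
      using integrable_norm[OF H_space_integrable[OF f f]] by (simp add: norm_mult power2_eq_square)
    have "complex_of_real (\<integral>z. (cmod (f z))\<^sup>2 \<partial>lborel) = (\<integral>z. complex_of_real ((cmod (f z))\<^sup>2) \<partial>lborel)"
      by (rule integral_complex_of_real[symmetric])
    also have "\<dots> = 0" using 0 by (simp only: complex_norm_square)
    finally have "AE z in lborel. (cmod (f z))\<^sup>2 = 0"
      using integral_nonneg_eq_0_iff_AE[OF int] by simp
    \<comment> \<open>From almost everywhere to a given point: \<open>H_kernel\<close> reproduces at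
      every \<open>x\<close>, so \<open>f x\<close> is an integral of a function that vanishes
      almost everywhere.\<close>
    then have "AE z in lborel. f z * cnj (H_kernel L z x) = 0" by auto
    then have "(\<integral>z. f z * cnj (H_kernel L z x) \<partial>lborel) = 0"
      by (rule integral_eq_zero_AE)
    then have "f x = 0" using H_space_reproducing[OF f, of x] by simp
    then show ?thesis using h(2)[OF xy(1)] by (simp add: f_def k_def)
  qed
  then show ?thesis using that[OF Z] by blast
qed

section \<open>Transport of the process to the sphere\<close>

text \<open>
  The density at \<open>z\<close> of Lebesgue measure with respect to the image of the surface measure under
  \<open>from_sphere\<close>.
\<close>

definition sphere_weight :: "complex ^ 'd \<Rightarrow> real" where
  "sphere_weight z = (1 + (norm z)\<^sup>2) ^ (CARD('d) + 1) / cone_constant CARD('d)"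

lemma sphere_weight_pos: "sphere_weight (z :: complex ^ 'd) > 0"
  unfolding sphere_weight_def
  by (intro divide_pos_pos zero_less_power cone_constant_pos one_le_CARD) (simp add: add_pos_nonneg)

lemma sphere_weight_nonneg [simp]: "0 \<le> sphere_weight z"
  using sphere_weight_pos[of z] by simp

lemma sphere_weight_measurable [measurable]: "sphere_weight \<in> borel_measurable borel"
  unfolding sphere_weight_def[abs_def] by measurable

lemma from_sphere_measurable_surface [measurable]:
  "from_sphere \<in> (surface_measure :: ((complex ^ 'd) \<times> real) measure) \<rightarrow>\<^sub>M lborel"
  using from_sphere_measurable[where 'd='d] by (simp cong: measurable_cong_sets)

lemma to_sphere_measurable_surface [measurable]:
  "to_sphere \<in> lborel \<rightarrow>\<^sub>M (surface_measure :: ((complex ^ 'd) \<times> real) measure)"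
  using to_sphere_measurable[where 'd='d] by (simp cong: measurable_cong_sets)

text \<open>The change of variables as an equation of measures. In this form integrals,
  almost-everywhere statements and, through product measures, joint intensities can all be moved to
  the sphere.\<close>

lemma distr_from_sphere:
  "distr (density surface_measure (\<lambda>p. ennreal (sphere_weight (from_sphere p)))) lborel from_sphere
    = (lborel :: (complex ^ 'd) measure)"
proof (rule measure_eqI)
  fix A :: "(complex ^ 'd) set"
  assume "A \<in> sets (distr (density surface_measure (\<lambda>p. ennreal (sphere_weight (from_sphere p)))) lborel from_sphere)"
  then have A [measurable]: "A \<in> sets lborel" by simp
  have "emeasure (distr (density surface_measure (\<lambda>p. ennreal (sphere_weight (from_sphere p)))) lborel from_sphere) A
     = (\<integral>\<^sup>+z. indicator A z \<partial>distr (density surface_measure (\<lambda>p. ennreal (sphere_weight (from_sphere p)))) lborel from_sphere)"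
    by (rule nn_integral_indicator[symmetric]) (use A in simp)
  also have "\<dots> = (\<integral>\<^sup>+p. indicator A (from_sphere p) \<partial>density surface_measure (\<lambda>p. ennreal (sphere_weight (from_sphere p))))"
    by (rule nn_integral_distr) measurable
  also have "\<dots> = (\<integral>\<^sup>+p. ennreal (sphere_weight (from_sphere p)) * indicator A (from_sphere p) \<partial>surface_measure)"
    by (rule nn_integral_density) measurable
  also have "\<dots> = (\<integral>\<^sup>+z. ennreal (cone_constant CARD('d) / (1 + (norm z)\<^sup>2) ^ (CARD('d) + 1)) * (ennreal (sphere_weight z) * indicator A z) \<partial>lborel)"
    by (rule nn_integral_surface_from_sphere) measurable
  also have "\<dots> = (\<integral>\<^sup>+z. indicator A z \<partial>lborel)"
  proof (rule nn_integral_cong)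
    fix z :: "complex ^ 'd"
    have "1 + (norm z)\<^sup>2 > 0" by (simp add: add_pos_nonneg)
    then have 1: "cone_constant CARD('d) / (1 + (norm z)\<^sup>2) ^ (CARD('d) + 1) * sphere_weight z = 1"
      using cone_constant_pos[OF one_le_CARD[where 'd='d]] by (simp add: sphere_weight_def)
    have "ennreal (cone_constant CARD('d) / (1 + (norm z)\<^sup>2) ^ (CARD('d) + 1)) * ennreal (sphere_weight z)
      = ennreal (cone_constant CARD('d) / (1 + (norm z)\<^sup>2) ^ (CARD('d) + 1) * sphere_weight z)"
      by (rule ennreal_mult''[symmetric]) simp
    then have "ennreal (cone_constant CARD('d) / (1 + (norm z)\<^sup>2) ^ (CARD('d) + 1)) * ennreal (sphere_weight z) = 1"
      by (simp only: 1 ennreal_1)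
    then show "ennreal (cone_constant CARD('d) / (1 + (norm z)\<^sup>2) ^ (CARD('d) + 1)) * (ennreal (sphere_weight z) * indicator A z) = indicator A z"
      by (simp only: mult.assoc[symmetric] mult_1_left)
  qed
  also have "\<dots> = emeasure lborel A" by (rule nn_integral_indicator[OF A])
  finally show "emeasure (distr (density surface_measure (\<lambda>p. ennreal (sphere_weight (from_sphere p)))) lborel from_sphere) A = emeasure lborel A" .
qed simp

lemma sphere_weight_from_sphere_measurable [measurable]:
  "(\<lambda>p. sphere_weight (from_sphere p)) \<in> borel_measurable (surface_measure :: ((complex ^ 'd) \<times> real) measure)"
  by measurable

lemma integral_from_sphere:
  fixes f :: "complex ^ 'd \<Rightarrow> complex"
  assumes [measurable]: "f \<in> borel_measurable borel"
  shows "(\<integral>p. sphere_weight (from_sphere p) *\<^sub>R f (from_sphere p) \<partial>surface_measure) = (\<integral>z. f z \<partial>lborel)"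
proof -
  have [simp]: "(\<lambda>p. f (from_sphere p)) \<in> borel_measurable (surface_measure :: ((complex ^ 'd) \<times> real) measure)"
    by measurable
  note sphere_weight_from_sphere_measurable [simp]
  have "(\<integral>z. f z \<partial>lborel) = (\<integral>z. f z \<partial>distr (density surface_measure (\<lambda>p. ennreal (sphere_weight (from_sphere p)))) lborel from_sphere)"
    by (simp only: distr_from_sphere)
  also have "\<dots> = (\<integral>p. f (from_sphere p) \<partial>density surface_measure (\<lambda>p. ennreal (sphere_weight (from_sphere p))))"
    by (rule integral_distr) measurable
  also have "\<dots> = (\<integral>p. sphere_weight (from_sphere p) *\<^sub>R f (from_sphere p) \<partial>surface_measure)"
    by (rule integral_density) simp_all
  finally show ?thesis ..
qed

lemma integrable_from_sphere:
  fixes f :: "complex ^ 'd \<Rightarrow> real"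
  assumes "integrable lborel f"
  shows "integrable surface_measure (\<lambda>p. sphere_weight (from_sphere p) * f (from_sphere p))"
proof -
  have [measurable]: "f \<in> borel_measurable borel" using assms by auto
  have "integrable (distr (density surface_measure (\<lambda>p. ennreal (sphere_weight (from_sphere p)))) lborel from_sphere) f"
    using assms by (simp only: distr_from_sphere)
  then have "integrable (density surface_measure (\<lambda>p. ennreal (sphere_weight (from_sphere p)))) (\<lambda>p. f (from_sphere p))"
    by (subst (asm) integrable_distr_eq) measurable
  moreover have "(\<lambda>p. f (from_sphere p)) \<in> borel_measurable (surface_measure :: ((complex ^ 'd) \<times> real) measure)"
    by measurable
  ultimately show ?thesis
    by (subst (asm) integrable_density) simp_all
qed

section \<open>The volume of the sphere and the transported kernel\<close>

text \<open>Apart from \<open>cone_constant\<close>, the volume is the squared norm of the constant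
  monomial for \<open>L = 0\<close>, so the norm formula already contains it.\<close>

lemma emeasure_surface_measure_sphere:
  "emeasure (surface_measure :: ((complex ^ 'd) \<times> real) measure) (sphere 0 1) = ennreal (cone_constant CARD('d) * pi ^ CARD('d) / fact CARD('d))"
proof -
  have c: "cone_constant CARD('d) > 0" by (rule cone_constant_pos[OF one_le_CARD])
  have "emeasure (surface_measure :: ((complex ^ 'd) \<times> real) measure) (sphere 0 1) = (\<integral>\<^sup>+p. 1 \<partial>(surface_measure :: ((complex ^ 'd) \<times> real) measure))"
    by simp
  also have "\<dots> = (\<integral>\<^sup>+z. ennreal (cone_constant CARD('d) / (1 + (norm z)\<^sup>2) ^ (CARD('d) + 1)) * 1 \<partial>(lborel :: (complex ^ 'd) measure))"
    by (rule nn_integral_surface_from_sphere[of "\<lambda>_. 1"]) simp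
  also have "\<dots> = (\<integral>\<^sup>+z. ennreal (cone_constant CARD('d)) * ennreal (1 / (1 + (norm z)\<^sup>2) ^ (CARD('d) + 1)) \<partial>(lborel :: (complex ^ 'd) measure))"
    using c by (subst ennreal_mult'[symmetric]) auto
  also have "\<dots> = ennreal (cone_constant CARD('d)) * (\<integral>\<^sup>+z. ennreal (1 / (1 + (norm z)\<^sup>2) ^ (CARD('d) + 1)) \<partial>(lborel :: (complex ^ 'd) measure))"
    by (rule nn_integral_cmult) measurable
  also have "(\<integral>\<^sup>+z. ennreal (1 / (1 + (norm z)\<^sup>2) ^ (CARD('d) + 1)) \<partial>(lborel :: (complex ^ 'd) measure)) = ennreal (pi ^ CARD('d) / fact CARD('d))"
    using nn_integral_monomial_norm[of "\<lambda>_::'d. 0" 0] by simp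
  finally show ?thesis using c by (simp add: ennreal_mult'[symmetric])
qed

lemma measure_surface_measure_sphere:
  "measure (surface_measure :: ((complex ^ 'd) \<times> real) measure) (sphere 0 1) = cone_constant CARD('d) * pi ^ CARD('d) / fact CARD('d)"
  using cone_constant_pos[OF one_le_CARD[where 'd='d]]
  by (simp add: measure_def emeasure_surface_measure_sphere)

lemma sigma_finite_surface_measure: "sigma_finite_measure (surface_measure :: ((complex ^ 'd) \<times> real) measure)"
proof -
  interpret finite_measure "surface_measure :: ((complex ^ 'd) \<times> real) measure"
    by standard (simp add: emeasure_surface_measure_sphere)
  show ?thesis by unfold_locales
qed

lemma hermitian_prod_self: "hermitian_prod z z = complex_of_real ((norm z)\<^sup>2)"
  unfolding hermitian_prod_def norm_vec_power2 of_real_sum complex_norm_square ..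

text \<open>The square root of the weight carries the power \<open>(d + 1) / 2\<close> of
  \<open>1 + |z|^2\<close>, and \<open>FS_weight\<close> the power \<open>(d + L + 1) / 2\<close>;
  the quotient leaves \<open>L / 2\<close> in the denominator.\<close>

lemma K_star_eq:
  fixes p q :: "(complex ^ 'd) \<times> real"
  shows "K_star L p q = complex_of_real (sqrt (sphere_weight (from_sphere p)) * sqrt (sphere_weight (from_sphere q))) * H_kernel L (from_sphere p) (from_sphere q)"
proof -
  define c where "c = cone_constant CARD('d)"
  have c: "c > 0" unfolding c_def by (rule cone_constant_pos[OF one_le_CARD])
  have sw: "sqrt (sphere_weight z) / FS_weight L z = 1 / (sqrt c * (1 + (norm z)\<^sup>2) powr (real L / 2))" for z :: "complex ^ 'd"
  proof -
    have p: "1 + (norm z)\<^sup>2 > 0" by (simp add: add_pos_nonneg)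
    have "sqrt (sphere_weight z) = (1 + (norm z)\<^sup>2) powr ((real CARD('d) + 1) / 2) / sqrt c"
    proof -
      have "(1 + (norm z)\<^sup>2) ^ (CARD('d) + 1) = ((1 + (norm z)\<^sup>2) powr ((real CARD('d) + 1) / 2))\<^sup>2"
        unfolding powr_realpow[OF p, symmetric, of "CARD('d) + 1"] unfolding power2_eq_square[of "_ powr _"] powr_add[symmetric] field_sum_of_halves by (simp add: add.commute)
      then show ?thesis
        unfolding sphere_weight_def c_def[symmetric] by (simp add: real_sqrt_divide)
    qed
    moreover have "FS_weight L z = (1 + (norm z)\<^sup>2) powr ((real CARD('d) + 1) / 2) * (1 + (norm z)\<^sup>2) powr (real L / 2)"
      unfolding FS_weight_def powr_add[symmetric] by (simp add: add_divide_distrib add_ac)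
    ultimately show ?thesis using p by simp
  qed
  define z w where "z = from_sphere p" and "w = from_sphere q"
  have "fact CARD('d) * real ((CARD('d) + L) choose CARD('d)) = fact (CARD('d) + L) / fact L"
    by (simp add: binomial_fact)
  \<comment> \<open>The constant \<open>c\<close> of the weights reappears in the volume, so
    \<open>N / V\<close> is the prefactor of \<open>H_kernel\<close> divided by
    \<open>c\<close>.\<close>
  then have N: "real ((CARD('d) + L) choose CARD('d)) / (c * pi ^ CARD('d) / fact CARD('d)) = fact (CARD('d) + L) / (pi ^ CARD('d) * fact L) / c"
    using c by (simp add: field_simps)
  have "complex_of_real (sqrt (sphere_weight z) * sqrt (sphere_weight w)) * H_kernel L z w
    = complex_of_real (fact (CARD('d) + L) / (pi ^ CARD('d) * fact L)) * (1 + hermitian_prod z w) ^ L *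
      complex_of_real ((sqrt (sphere_weight z) / FS_weight L z) * (sqrt (sphere_weight w) / FS_weight L w))"
    by (simp add: H_kernel_def mult_ac)
  also have "(sqrt (sphere_weight z) / FS_weight L z) * (sqrt (sphere_weight w) / FS_weight L w)
    = 1 / c * (1 / ((1 + (norm z)\<^sup>2) powr (real L / 2) * (1 + (norm w)\<^sup>2) powr (real L / 2)))"
    unfolding sw using c by simp
  finally show ?thesis
    unfolding K_star_def Let_def measure_surface_measure_sphere c_def[symmetric] N z_def[symmetric] w_def[symmetric]
    by simp
qed

lemma homogeneous_K_star: "homogeneous_kernel (K_star L :: (complex ^ 'd) \<times> real \<Rightarrow> _)"
  unfolding homogeneous_kernel_def
proof (intro exI ballI)
  fix p :: "(complex ^ 'd) \<times> real"
  define x where "x = 1 + (norm (from_sphere p))\<^sup>2"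
  have x: "x > 0" by (simp add: x_def add_pos_nonneg)
  have "x powr (real L / 2) * x powr (real L / 2) = x ^ L"
    using x by (simp add: powr_add[symmetric] powr_realpow)
  moreover have "1 + hermitian_prod (from_sphere p) (from_sphere p) = complex_of_real x"
    by (simp add: hermitian_prod_self x_def)
  ultimately show "K_star L p p = complex_of_real (real ((CARD('d) + L) choose CARD('d)) / measure (surface_measure :: ((complex ^ 'd) \<times> real) measure) (sphere 0 1))"
    using x unfolding K_star_def Let_def x_def[symmetric] by (simp flip: of_real_power)
qed

section \<open>Product measures, counts and determinants\<close>

text \<open>Joint intensities are functions of tuples, so the weighted change of variables is
  applied in all coordinates at once. On a rectangle both weight and indicator are products, and the
  integral splits into one-coordinate factors given by \<open>eq\<close>. The map is restricted to
  \<open>I\<close> because product spaces consist of extensional functions.\<close>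

lemma distr_PiM_density:
  assumes M: "sigma_finite_measure M" and N: "sigma_finite_measure N" and I: "finite I"
    and T [measurable]: "T \<in> M \<rightarrow>\<^sub>M N" and w [measurable]: "w \<in> borel_measurable M"
    and eq: "distr (density M w) N T = N"
  shows "distr (density (PiM I (\<lambda>_. M)) (\<lambda>x. \<Prod>i\<in>I. w (x i))) (PiM I (\<lambda>_. N)) (\<lambda>x. \<lambda>i\<in>I. T (x i)) = PiM I (\<lambda>_. N)"
proof -
  interpret M: product_sigma_finite "\<lambda>_. M" using M by (simp add: product_sigma_finite_def)
  interpret N: product_sigma_finite "\<lambda>_. N" using N by (simp add: product_sigma_finite_def)
  have [measurable]: "(\<lambda>x. \<lambda>i\<in>I. T (x i)) \<in> PiM I (\<lambda>_. M) \<rightarrow>\<^sub>M PiM I (\<lambda>_. N)"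
    by (rule measurable_restrict) measurable
  have [measurable]: "(\<lambda>x. \<Prod>i\<in>I. w (x i)) \<in> borel_measurable (PiM I (\<lambda>_. M))"
    by measurable
  show ?thesis
  proof (rule N.PiM_eqI[OF I])
    fix A assume A: "\<And>i. i \<in> I \<Longrightarrow> A i \<in> sets N"
    have PA [measurable]: "PiE I A \<in> sets (PiM I (\<lambda>_. N))" using A I by (intro sets_PiM_I_finite)
    have "emeasure (distr (density (PiM I (\<lambda>_. M)) (\<lambda>x. \<Prod>i\<in>I. w (x i))) (PiM I (\<lambda>_. N)) (\<lambda>x. \<lambda>i\<in>I. T (x i))) (PiE I A)
      = (\<integral>\<^sup>+x. indicator (PiE I A) x \<partial>distr (density (PiM I (\<lambda>_. M)) (\<lambda>x. \<Prod>i\<in>I. w (x i))) (PiM I (\<lambda>_. N)) (\<lambda>x. \<lambda>i\<in>I. T (x i)))"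
      using PA by simp
    also have "\<dots> = (\<integral>\<^sup>+x. (\<Prod>i\<in>I. w (x i)) * indicator (PiE I A) (\<lambda>i\<in>I. T (x i)) \<partial>PiM I (\<lambda>_. M))"
      by (subst nn_integral_distr, measurable) (subst nn_integral_density, measurable)
    also have "\<dots> = (\<integral>\<^sup>+x. (\<Prod>i\<in>I. w (x i) * indicator (A i) (T (x i))) \<partial>PiM I (\<lambda>_. M))"
    proof (rule nn_integral_cong)
      fix x
      have "indicator (PiE I A) (\<lambda>i\<in>I. T (x i)) = (\<Prod>i\<in>I. indicator (A i) (T (x i)) :: ennreal)"
        using I by (auto simp: indicator_def PiE_def Pi_def prod.If_cases intro!: prod_zero)
      then show "(\<Prod>i\<in>I. w (x i)) * indicator (PiE I A) (\<lambda>i\<in>I. T (x i)) = (\<Prod>i\<in>I. w (x i) * indicator (A i) (T (x i)))"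
        by (simp add: prod.distrib)
    qed
    also have "\<dots> = (\<Prod>i\<in>I. \<integral>\<^sup>+x. w x * indicator (A i) (T x) \<partial>M)"
    proof (rule M.product_nn_integral_prod[OF I])
      fix i assume "i \<in> I"
      then have [measurable]: "A i \<in> sets N" by (rule A)
      show "(\<lambda>x. w x * indicator (A i) (T x)) \<in> borel_measurable M" by measurable
    qed
    also have "\<dots> = (\<Prod>i\<in>I. emeasure N (A i))"
    proof (rule prod.cong[OF refl])
      fix i assume "i \<in> I"
      then have [measurable]: "A i \<in> sets N" by (rule A)
      have "emeasure N (A i) = (\<integral>\<^sup>+x. indicator (A i) x \<partial>distr (density M w) N T)"
        by (simp add: eq)
      also have "\<dots> = (\<integral>\<^sup>+x. w x * indicator (A i) (T x) \<partial>M)"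
        by (subst nn_integral_distr, measurable) (subst nn_integral_density, measurable)
      finally show "(\<integral>\<^sup>+x. w x * indicator (A i) (T x) \<partial>M) = emeasure N (A i)" ..
    qed
    finally show "emeasure (distr (density (PiM I (\<lambda>_. M)) (\<lambda>x. \<Prod>i\<in>I. w (x i))) (PiM I (\<lambda>_. N)) (\<lambda>x. \<lambda>i\<in>I. T (x i))) (PiE I A)
      = (\<Prod>i\<in>I. emeasure N (A i))" .
  qed simp
qed

text \<open>The tuples with \<open>x i\<close> in \<open>Z\<close> form a rectangle with one null
  side; its measure is a product with a zero factor, even if other sides have infinite
  measure.\<close>

lemma AE_PiM_notin_null_set:
  assumes M: "sigma_finite_measure M" and I: "finite I" and Z: "Z \<in> null_sets M"
  shows "AE x in PiM I (\<lambda>_. M). \<forall>i\<in>I. x i \<notin> Z"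
proof (subst AE_ball_countable)
  interpret product_sigma_finite "\<lambda>_. M" using M by (simp add: product_sigma_finite_def)
  show "\<forall>i\<in>I. AE x in PiM I (\<lambda>_. M). x i \<notin> Z"
  proof
    fix i assume i: "i \<in> I"
    define A where "A = (\<lambda>j. if j = i then Z else space M)"
    have A: "A j \<in> sets M" for j using Z by (auto simp: A_def)
    have "emeasure (PiM I (\<lambda>_. M)) (PiE I A) = (\<Prod>j\<in>I. emeasure M (A j))"
      using A I by (intro emeasure_PiM) auto
    also have "\<dots> = 0"
      using i I Z by (intro prod_zero) (auto simp: A_def)
    finally have "PiE I A \<in> null_sets (PiM I (\<lambda>_. M))"
      using A I by (auto intro!: null_setsI sets_PiM_I_finite)
    then show "AE x in PiM I (\<lambda>_. M). x i \<notin> Z"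
      by (rule AE_I') (use i in \<open>auto simp: A_def space_PiM PiE_def Pi_def\<close>)
  qed
qed (use I in \<open>auto intro: countable_finite\<close>)

lemma num_points_image:
  assumes "inj_on f A" shows "num_points (f ` A) = num_points A"
proof (cases "finite A")
  case True
  then show ?thesis using assms by (simp add: num_points_def emeasure_count_space card_image)
next
  case False
  then have "infinite (f ` A)" using assms finite_imageD by blast
  then show ?thesis using False by (simp add: num_points_def emeasure_count_space)
qed

lemma finite_iff_num_points: "finite A \<longleftrightarrow> num_points A \<noteq> \<infinity>"
  by (cases "finite A") (simp_all add: num_points_def emeasure_count_space)

lemma num_points_to_sphere:
  "num_points (to_sphere ` X \<inter> A) = num_points (X \<inter> to_sphere -` A)"
proof -
  have "to_sphere ` X \<inter> A = to_sphere ` (X \<inter> to_sphere -` A)" by auto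
  then show ?thesis
    using num_points_image[OF inj_on_subset[OF inj_to_sphere subset_UNIV], of "X \<inter> to_sphere -` A"] by simp
qed

text \<open>In each term of the Leibniz expansion the column factors \<open>a (p i)\<close> are a
  rearrangement of the row factors, so all terms share the factor \<open>a i * a i\<close> over all
  \<open>i\<close>.\<close>

lemma det_scale:
  fixes a :: "nat \<Rightarrow> 'a::comm_ring_1"
  shows "Determinant.det (Matrix.mat k k (\<lambda>(i, j). a i * a j * K i j)) =
    (\<Prod>i<k. a i * a i) * Determinant.det (Matrix.mat k k (\<lambda>(i, j). K i j))"
proof -
  have "(\<Prod>i = 0..<k. a i * a (p i) * K i (p i)) = (\<Prod>i<k. a i * a i) * (\<Prod>i = 0..<k. K i (p i))"
    if p: "p permutes {0..<k}" for p
  proof -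
    have "(\<Prod>i = 0..<k. a (p i)) = (\<Prod>i = 0..<k. a i)"
      using prod.permute[OF p, of a] by (simp add: comp_def)
    then show ?thesis by (simp add: prod.distrib lessThan_atLeast0)
  qed
  moreover have "p i < k" if "p permutes {0..<k}" "i < k" for p i
    using permutes_in_image[OF that(1), of i] that(2) by simp
  ultimately show ?thesis
    by (simp add: Determinant.det_def sum_distrib_left mult.left_commute)
qed

section \<open>Finiteness of the process and its joint intensities on the sphere\<close>

lemma H_kernel_diag_integrable:
  "integrable lborel (\<lambda>z :: complex ^ 'd. cmod (H_kernel L z z))"
proof -
  have "integrable lborel (\<lambda>z :: complex ^ 'd. \<Sum>\<alpha> | (\<Sum>i\<in>UNIV. \<alpha> i) \<le> L. weighted_monomial L \<alpha> z * cnj (weighted_monomial L \<alpha> z) / complex_of_real (monomial_norm2 L \<alpha>))"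
  proof (intro Bochner_Integration.integrable_sum integrable_divide)
    fix \<alpha> :: "'d \<Rightarrow> nat" assume "\<alpha> \<in> {\<alpha>. sum \<alpha> UNIV \<le> L}"
    then show "integrable lborel (\<lambda>z :: complex ^ 'd. weighted_monomial L \<alpha> z * cnj (weighted_monomial L \<alpha> z))"
      using weighted_monomial_inner[of \<alpha> L \<alpha>] by (simp add: has_bochner_integral_iff)
  qed
  then have "integrable lborel (\<lambda>z :: complex ^ 'd. H_kernel L z z)"
    by (simp only: H_kernel_eq_sum)
  then show ?thesis by (rule integrable_norm)
qed

text \<open>The expected number of all points is the integral of the one-point intensity. Almost
  everywhere this intensity is the diagonal of \<open>H_kernel\<close>, a finite sum of integrable
  functions. Finiteness of the whole configuration is what local finiteness on the compact sphere
  requires.\<close>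

lemma determinantal_H_kernel_AE_finite:
  fixes X :: "'w \<Rightarrow> (complex ^ 'd) set"
  assumes det: "determinantal M lborel X K" and K: "reproducing_kernel lborel (H_space L) K"
  shows "AE \<omega> in M. finite (X \<omega>)"
proof -
  let ?P = "PiM {..<1::nat} (\<lambda>_. lborel :: (complex ^ 'd) measure)"
  interpret product_sigma_finite "\<lambda>_::nat. lborel :: (complex ^ 'd) measure" by standard
  obtain Z where Z: "Z \<in> null_sets lborel" "\<And>x y. x \<notin> Z \<Longrightarrow> y \<notin> Z \<Longrightarrow> K x y = H_kernel L x y"
    using reproducing_kernel_H_space_unique[OF K] by blast
  obtain \<rho> where \<rho>: "joint_intensity M lborel X 1 \<rho>"
      "AE x in ?P. complex_of_real (\<rho> x) = Determinant.det (Matrix.mat 1 1 (\<lambda>(i, j). K (x i) (x j)))"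
    using det unfolding determinantal_def by blast
  have meas: "(\<lambda>\<omega>. num_points (X \<omega> \<inter> UNIV)) \<in> borel_measurable M"
  proof -
    have "\<forall>D\<in>sets lborel. (\<lambda>\<omega>. num_points (X \<omega> \<inter> D)) \<in> borel_measurable M"
      using det unfolding determinantal_def point_process_def by (elim conjE)
    from bspec[OF this, of UNIV] show ?thesis by simp
  qed
  have "(\<integral>\<^sup>+\<omega>. (\<Prod>i<1::nat. num_points (X \<omega> \<inter> UNIV)) \<partial>M) = (\<integral>\<^sup>+x\<in>PiE {..<1} (\<lambda>_. UNIV). ennreal (\<rho> x) \<partial>?P)"
    using \<rho>(1) unfolding joint_intensity_def
    by (elim conjE allE[of _ "\<lambda>_. UNIV"]) (simp add: disjoint_family_on_def)
  then have "(\<integral>\<^sup>+\<omega>. num_points (X \<omega> \<inter> UNIV) \<partial>M) = (\<integral>\<^sup>+x\<in>PiE {..<1} (\<lambda>_. UNIV). ennreal (\<rho> x) \<partial>?P)"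
    by simp
  also have "\<dots> \<le> (\<integral>\<^sup>+x. ennreal (cmod (H_kernel L (x 0) (x 0))) \<partial>?P)"
  proof (rule nn_integral_mono_AE)
    have "AE x in ?P. \<forall>i\<in>{..<1}. x i \<notin> Z"
      by (rule AE_PiM_notin_null_set) (use Z sigma_finite_lborel in auto)
    with \<rho>(2) show "AE x in ?P. ennreal (\<rho> x) * indicator (PiE {..<1} (\<lambda>_. UNIV)) x \<le> ennreal (cmod (H_kernel L (x 0) (x 0)))"
    proof eventually_elim
      case (elim x)
      then have "complex_of_real (\<rho> x) = H_kernel L (x 0) (x 0)"
        by (simp add: Z(2) Determinant.det_def)
      then have "\<bar>\<rho> x\<bar> = cmod (H_kernel L (x 0) (x 0))" by (metis norm_of_real)
      then have "\<rho> x \<le> cmod (H_kernel L (x 0) (x 0))" by linarith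
      then show ?case by (auto simp: indicator_def intro: ennreal_leI)
    qed
  qed
  also have "\<dots> = (\<integral>\<^sup>+z. ennreal (cmod (H_kernel L z z)) \<partial>(lborel :: (complex ^ 'd) measure))"
  proof -
    have "{..<1} = {0::nat}" by auto
    moreover have "(\<lambda>z :: complex ^ 'd. ennreal (cmod (H_kernel L z z))) \<in> borel_measurable lborel"
      using borel_measurable_integrable[OF H_kernel_diag_integrable[of L, where 'd='d]] by simp
    ultimately show ?thesis
      using product_nn_integral_singleton[of "\<lambda>z. ennreal (cmod (H_kernel L z z))" 0] by simp
  qed
  also have "\<dots> < \<infinity>"
    using H_kernel_diag_integrable[of L, where 'd='d] by (simp add: integrable_iff_bounded)
  finally have "AE \<omega> in M. num_points (X \<omega> \<inter> UNIV) \<noteq> \<infinity>"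
    by (intro nn_integral_noteq_infinite meas) simp
  then show ?thesis by (simp add: finite_iff_num_points)
qed

lemma point_process_to_sphere:
  fixes X :: "'w \<Rightarrow> (complex ^ 'd) set"
  assumes X: "point_process M lborel X" and fin: "AE \<omega> in M. finite (X \<omega>)"
  shows "point_process M surface_measure (\<lambda>\<omega>. to_sphere ` X \<omega>)"
  unfolding point_process_def
proof (intro conjI ballI)
  show "prob_space M" using X by (simp add: point_process_def)
  show "to_sphere ` X \<omega> \<subseteq> space surface_measure" for \<omega>
    using to_sphere_in_sphere by auto
  fix D assume "D \<in> sets (surface_measure :: ((complex ^ 'd) \<times> real) measure)"
  from measurable_sets[OF to_sphere_measurable_surface this]
  have "to_sphere -` D \<in> sets (lborel :: (complex ^ 'd) measure)" by simp
  then show "(\<lambda>\<omega>. num_points (to_sphere ` X \<omega> \<inter> D)) \<in> borel_measurable M"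
    using X by (simp add: point_process_def num_points_to_sphere)
next
  show "AE \<omega> in M. \<forall>C. compact C \<and> C \<subseteq> space surface_measure \<longrightarrow> finite (to_sphere ` X \<omega> \<inter> C)"
    using fin by eventually_elim auto
qed

text \<open>
  \<open>from_sphere\<close> is constant on the poles (its junk value there), so the case where \<open>c\<close> is that value
  shows that the poles are a null set.
\<close>

lemma null_sets_from_sphere_eq:
  "{p \<in> sphere 0 1. from_sphere p = c} \<in> null_sets (surface_measure :: ((complex ^ 'd) \<times> real) measure)"
proof -
  let ?A = "{p \<in> sphere 0 1. from_sphere p = c} :: ((complex ^ 'd) \<times> real) set"
  have "from_sphere -` {c} \<inter> space surface_measure = ?A" by auto
  then have A: "?A \<in> sets surface_measure"
    using measurable_sets[OF from_sphere_measurable_surface, of "{c}"] by (simp del: sets_surface_measure)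
  have "emeasure surface_measure ?A = (\<integral>\<^sup>+p. indicator ?A p \<partial>surface_measure)"
    by (rule nn_integral_indicator[OF A, symmetric])
  also have "\<dots> = (\<integral>\<^sup>+p. indicator {c} (from_sphere p) \<partial>surface_measure)"
    by (rule nn_integral_cong) (auto simp: indicator_def)
  also have "\<dots> = (\<integral>\<^sup>+z. ennreal (cone_constant CARD('d) / (1 + (norm z)\<^sup>2) ^ (CARD('d) + 1)) * indicator {c} z \<partial>lborel)"
    by (rule nn_integral_surface_from_sphere) simp
  also have "\<dots> = (\<integral>\<^sup>+z. 0 \<partial>(lborel :: (complex ^ 'd) measure))"
    by (rule nn_integral_cong_AE, rule AE_mp[OF AE_lborel_singleton[of c]]) (auto simp: indicator_def)
  finally show ?thesis using A by (intro null_setsI) auto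
qed

lemma distr_PiM_from_sphere:
  fixes k :: nat
  shows
  "distr (density (PiM {..<k} (\<lambda>_. surface_measure)) (\<lambda>x. \<Prod>i<k. ennreal (sphere_weight (from_sphere (x i)))))
     (PiM {..<k} (\<lambda>_. lborel)) (\<lambda>x. \<lambda>i\<in>{..<k}. from_sphere (x i))
   = PiM {..<k} (\<lambda>_. lborel :: (complex ^ 'd) measure)"
proof (rule distr_PiM_density[where w="\<lambda>p. ennreal (sphere_weight (from_sphere p))"])
  show "(\<lambda>p. ennreal (sphere_weight (from_sphere p))) \<in> borel_measurable (surface_measure :: ((complex ^ 'd) \<times> real) measure)"
    by measurable
qed (simp_all add: sigma_finite_surface_measure sigma_finite_lborel from_sphere_measurable_surface distr_from_sphere del: sets_surface_measure)

lemma from_sphere_map_measurable [measurable]: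
  fixes k :: nat
  shows
  "(\<lambda>x. \<lambda>i\<in>{..<k}. from_sphere (x i)) \<in>
     PiM {..<k} (\<lambda>_. surface_measure :: ((complex ^ 'd) \<times> real) measure) \<rightarrow>\<^sub>M PiM {..<k} (\<lambda>_. lborel)"
  by (rule measurable_restrict) measurable

text \<open>Points of the image in \<open>D i\<close> are points of \<open>X\<close> in the preimage
  of \<open>D i\<close>, and preimages stay disjoint. The intensity of \<open>X\<close> over these
  preimages is then pulled back to the sphere, each coordinate contributing its weight as a
  Jacobian.\<close>

lemma joint_intensity_to_sphere:
  fixes X :: "'w \<Rightarrow> (complex ^ 'd) set"
  assumes \<rho>: "joint_intensity M lborel X k \<rho>"
  shows "joint_intensity M surface_measure (\<lambda>\<omega>. to_sphere ` X \<omega>) k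
    (\<lambda>x. (\<Prod>i<k. sphere_weight (from_sphere (x i))) * \<rho> (\<lambda>i\<in>{..<k}. from_sphere (x i)))"
  unfolding joint_intensity_def
proof (intro conjI allI impI)
  let ?S = "PiM {..<k} (\<lambda>_. surface_measure :: ((complex ^ 'd) \<times> real) measure)"
  let ?P = "PiM {..<k} (\<lambda>_. lborel :: (complex ^ 'd) measure)"
  let ?T = "\<lambda>x :: nat \<Rightarrow> (complex ^ 'd) \<times> real. \<lambda>i\<in>{..<k}. from_sphere (x i)"
  have [measurable]: "\<rho> \<in> borel_measurable ?P" and nonneg: "\<And>x. \<rho> x \<ge> 0"
    using \<rho> by (auto simp: joint_intensity_def)
  have W [measurable]: "(\<lambda>x. \<Prod>i<k. sphere_weight (from_sphere (x i))) \<in> borel_measurable ?S"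
    by measurable
  have [measurable]: "(\<lambda>x. \<rho> (?T x)) \<in> borel_measurable ?S"
    by (rule measurable_compose[OF from_sphere_map_measurable]) measurable
  show "(\<lambda>x. (\<Prod>i<k. sphere_weight (from_sphere (x i))) * \<rho> (?T x)) \<in> borel_measurable ?S"
    by measurable
  show "0 \<le> (\<Prod>i<k. sphere_weight (from_sphere (x i))) * \<rho> (?T x)" for x
    by (intro mult_nonneg_nonneg prod_nonneg nonneg) simp
  fix D :: "nat \<Rightarrow> ((complex ^ 'd) \<times> real) set"
  assume D: "(\<forall>i<k. D i \<in> sets surface_measure) \<and> disjoint_family_on D {..<k}"
  define E where "E i = to_sphere -` D i" for i
  have E: "E i \<in> sets lborel" if "i < k" for i
    using measurable_sets[OF to_sphere_measurable_surface, of "D i"] D that by (simp add: E_def)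
  have "disjoint_family_on E {..<k}"
    using D unfolding disjoint_family_on_def E_def vimage_Int[symmetric] by (metis vimage_empty)
  with E \<rho> have "(\<integral>\<^sup>+\<omega>. (\<Prod>i<k. num_points (X \<omega> \<inter> E i)) \<partial>M) = (\<integral>\<^sup>+x\<in>PiE {..<k} E. ennreal (\<rho> x) \<partial>?P)"
    unfolding joint_intensity_def by blast
  then have "(\<integral>\<^sup>+\<omega>. (\<Prod>i<k. num_points (to_sphere ` X \<omega> \<inter> D i)) \<partial>M) = (\<integral>\<^sup>+x\<in>PiE {..<k} E. ennreal (\<rho> x) \<partial>?P)"
    by (simp add: num_points_to_sphere E_def)
  also have "\<dots> = (\<integral>\<^sup>+x\<in>PiE {..<k} E. ennreal (\<rho> x) \<partial>distr (density ?S (\<lambda>x. \<Prod>i<k. ennreal (sphere_weight (from_sphere (x i))))) ?P ?T)"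
    by (simp only: distr_PiM_from_sphere)
  also have "\<dots> = (\<integral>\<^sup>+x. (\<Prod>i<k. ennreal (sphere_weight (from_sphere (x i)))) * (ennreal (\<rho> (?T x)) * indicator (PiE {..<k} E) (?T x)) \<partial>?S)"
  proof -
    have PE [measurable]: "PiE {..<k} E \<in> sets ?P" using E by (intro sets_PiM_I_finite) auto
    have [measurable]: "(\<lambda>x. \<Prod>i<k. ennreal (sphere_weight (from_sphere (x i)))) \<in> borel_measurable ?S"
      by measurable
    have "(\<lambda>x. ennreal (\<rho> x) * indicator (PiE {..<k} E) x) \<in> borel_measurable ?P" by measurable
    note m = this measurable_compose[OF from_sphere_map_measurable this]
    show ?thesis
      by (subst nn_integral_distr) (measurable, subst nn_integral_density, use m in auto)
  qed
  also have "\<dots> = (\<integral>\<^sup>+x\<in>PiE {..<k} D. ennreal ((\<Prod>i<k. sphere_weight (from_sphere (x i))) * \<rho> (?T x)) \<partial>?S)"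
  proof (rule nn_integral_cong_AE)
    \<comment> \<open>The excluded set contains both poles. Off it \<open>to_sphere\<close> undoes
      \<open>from_sphere\<close>, so \<open>from_sphere (x i)\<close> lies in the preimage of
      \<open>D i\<close> exactly when \<open>x i\<close> lies in \<open>D i\<close>.\<close>
    have "AE x in ?S. \<forall>i\<in>{..<k}. x i \<notin> {p :: (complex ^ 'd) \<times> real. p \<in> sphere 0 1 \<and> from_sphere p = radial_map_inv (g_fun CARD('d)) 0}"
      by (rule AE_PiM_notin_null_set[OF sigma_finite_surface_measure _ null_sets_from_sphere_eq]) simp
    then show "AE x in ?S. (\<Prod>i<k. ennreal (sphere_weight (from_sphere (x i)))) * (ennreal (\<rho> (?T x)) * indicator (PiE {..<k} E) (?T x))
      = ennreal ((\<Prod>i<k. sphere_weight (from_sphere (x i))) * \<rho> (?T x)) * indicator (PiE {..<k} D) x"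
    proof (rule AE_mp, intro AE_I2 impI)
      fix x assume x: "x \<in> space ?S" and nz: "\<forall>i\<in>{..<k}. x i \<notin> {p :: (complex ^ 'd) \<times> real. p \<in> sphere 0 1 \<and> from_sphere p = radial_map_inv (g_fun CARD('d)) 0}"
      have sph: "x i \<in> sphere 0 1" if "i < k" for i
        using x that by (auto simp: space_PiM PiE_def Pi_def)
      have "to_sphere (from_sphere (x i)) = x i" if "i < k" for i
        using nz sph[OF that] that from_sphere_eq[OF sph[OF that]] by (intro to_sphere_from_sphere) auto
      then have "?T x \<in> PiE {..<k} E \<longleftrightarrow> x \<in> PiE {..<k} D"
        using x by (auto simp: E_def PiE_iff space_PiM)
      then have "indicator (PiE {..<k} E) (?T x) = (indicator (PiE {..<k} D) x :: ennreal)"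
        by (simp add: indicator_def)
      moreover have "(\<Prod>i<k. ennreal (sphere_weight (from_sphere (x i)))) = ennreal (\<Prod>i<k. sphere_weight (from_sphere (x i)))"
        by (rule prod_ennreal) simp
      moreover have "ennreal ((\<Prod>i<k. sphere_weight (from_sphere (x i))) * \<rho> (?T x)) = ennreal (\<Prod>i<k. sphere_weight (from_sphere (x i))) * ennreal (\<rho> (?T x))"
        by (rule ennreal_mult') (simp add: prod_nonneg)
      ultimately show "(\<Prod>i<k. ennreal (sphere_weight (from_sphere (x i)))) * (ennreal (\<rho> (?T x)) * indicator (PiE {..<k} E) (?T x))
        = ennreal ((\<Prod>i<k. sphere_weight (from_sphere (x i))) * \<rho> (?T x)) * indicator (PiE {..<k} D) x"
        by (simp only: mult.assoc)
    qed
  qed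
  finally show "(\<integral>\<^sup>+\<omega>. (\<Prod>i<k. num_points (to_sphere ` X \<omega> \<inter> D i)) \<partial>M) =
     (\<integral>\<^sup>+x\<in>PiE {..<k} D. ennreal ((\<Prod>i<k. sphere_weight (from_sphere (x i))) * \<rho> (?T x)) \<partial>?S)" .
qed

lemma determinantal_to_sphere:
  fixes X :: "'w \<Rightarrow> (complex ^ 'd) set"
  assumes det: "determinantal M lborel X K" and K: "reproducing_kernel lborel (H_space L) K"
  shows "determinantal M surface_measure (\<lambda>\<omega>. to_sphere ` X \<omega>) (K_star L)"
  unfolding determinantal_def
proof (intro conjI allI impI)
  show "point_process M surface_measure (\<lambda>\<omega>. to_sphere ` X \<omega>)"
    using det by (intro point_process_to_sphere determinantal_H_kernel_AE_finite[OF det K]) (simp add: determinantal_def)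
  obtain Z where Z: "Z \<in> null_sets lborel" "\<And>x y. x \<notin> Z \<Longrightarrow> y \<notin> Z \<Longrightarrow> K x y = H_kernel L x y"
    using reproducing_kernel_H_space_unique[OF K] by blast
  fix k :: nat assume "1 \<le> k"
  let ?S = "PiM {..<k} (\<lambda>_. surface_measure :: ((complex ^ 'd) \<times> real) measure)"
  let ?P = "PiM {..<k} (\<lambda>_. lborel :: (complex ^ 'd) measure)"
  let ?T = "\<lambda>x :: nat \<Rightarrow> (complex ^ 'd) \<times> real. \<lambda>i\<in>{..<k}. from_sphere (x i)"
  obtain \<rho> where \<rho>: "joint_intensity M lborel X k \<rho>"
      "AE x in ?P. complex_of_real (\<rho> x) = Determinant.det (Matrix.mat k k (\<lambda>(i, j). K (x i) (x j)))"
    using det \<open>1 \<le> k\<close> unfolding determinantal_def by blast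
  have "AE x in ?P. \<forall>i\<in>{..<k}. x i \<notin> Z"
    by (rule AE_PiM_notin_null_set) (use Z sigma_finite_lborel in auto)
  with \<rho>(2) have "AE x in ?P. complex_of_real (\<rho> x) = Determinant.det (Matrix.mat k k (\<lambda>(i, j). H_kernel L (x i) (x j)))"
  proof eventually_elim
    case (elim x)
    have "Matrix.mat k k (\<lambda>(i, j). K (x i) (x j)) = Matrix.mat k k (\<lambda>(i, j). H_kernel L (x i) (x j))"
      using elim(2) by (intro eq_matI) (auto simp: Z(2))
    with elim(1) show ?case by simp
  qed
  then have "AE x in distr (density ?S (\<lambda>x. \<Prod>i<k. ennreal (sphere_weight (from_sphere (x i))))) ?P ?T.
     complex_of_real (\<rho> x) = Determinant.det (Matrix.mat k k (\<lambda>(i, j). H_kernel L (x i) (x j)))"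
    by (simp only: distr_PiM_from_sphere)
  then have "AE x in density ?S (\<lambda>x. \<Prod>i<k. ennreal (sphere_weight (from_sphere (x i)))).
     complex_of_real (\<rho> (?T x)) = Determinant.det (Matrix.mat k k (\<lambda>(i, j). H_kernel L (?T x i) (?T x j)))"
    by (rule AE_distrD[rotated]) simp
  \<comment> \<open>The weights are positive everywhere, so the density has the same null sets as
    the product measure itself and the condition can be discharged.\<close>
  then have "AE x in ?S. 0 < (\<Prod>i<k. ennreal (sphere_weight (from_sphere (x i)))) \<longrightarrow>
     complex_of_real (\<rho> (?T x)) = Determinant.det (Matrix.mat k k (\<lambda>(i, j). H_kernel L (?T x i) (?T x j)))"
    by (subst (asm) AE_density) measurable
  then have "AE x in ?S. complex_of_real ((\<Prod>i<k. sphere_weight (from_sphere (x i))) * \<rho> (?T x)) = Determinant.det (Matrix.mat k k (\<lambda>(i, j). K_star L (x i) (x j)))"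
  proof eventually_elim
    case (elim x)
    \<comment> \<open>The Jacobian is split evenly: one square root per row and one per column. This
      keeps the kernel Hermitian, and \<open>det_scale\<close> restores the full weight.\<close>
    define a where "a i = complex_of_real (sqrt (sphere_weight (from_sphere (x i))))" for i
    have "(\<Prod>i<k. ennreal (sphere_weight (from_sphere (x i)))) = ennreal (\<Prod>i<k. sphere_weight (from_sphere (x i)))"
      by (rule prod_ennreal) simp
    then have "0 < (\<Prod>i<k. ennreal (sphere_weight (from_sphere (x i))))"
      by (simp add: prod_pos sphere_weight_pos)
    with elim have "complex_of_real (\<rho> (?T x)) = Determinant.det (Matrix.mat k k (\<lambda>(i, j). H_kernel L (?T x i) (?T x j)))"
      by blast
    also have "Matrix.mat k k (\<lambda>(i, j). H_kernel L (?T x i) (?T x j)) = Matrix.mat k k (\<lambda>(i, j). H_kernel L (from_sphere (x i)) (from_sphere (x j)))"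
      by (intro eq_matI) auto
    finally have 1: "complex_of_real (\<rho> (?T x)) = Determinant.det (Matrix.mat k k (\<lambda>(i, j). H_kernel L (from_sphere (x i)) (from_sphere (x j))))" .
    have 2: "complex_of_real (\<Prod>i<k. sphere_weight (from_sphere (x i))) = (\<Prod>i<k. a i * a i)"
      by (simp add: a_def of_real_mult[symmetric] del: of_real_mult)
    have 3: "K_star L (x i) (x j) = a i * a j * H_kernel L (from_sphere (x i)) (from_sphere (x j))" for i j
      by (simp add: K_star_eq a_def)
    show ?case
      unfolding of_real_mult 1 2 3 det_scale ..
  qed
  with joint_intensity_to_sphere[OF \<rho>(1)]
  show "\<exists>\<rho>. joint_intensity M surface_measure (\<lambda>\<omega>. to_sphere ` X \<omega>) k \<rho> \<and>
      (AE x in ?S. complex_of_real (\<rho> x) = Determinant.det (Matrix.mat k k (\<lambda>(i, j). K_star L (x i) (x j))))"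
    by blast
qed

section \<open>The transported subspace and the conclusion\<close>

text \<open>The isometry of \<open>L\<^sup>2\<close> spaces induced by \<open>from_sphere\<close>.\<close>

definition sphere_lift :: "(complex ^ 'd \<Rightarrow> complex) \<Rightarrow> (complex ^ 'd) \<times> real \<Rightarrow> complex" where
  "sphere_lift f p = complex_of_real (sqrt (sphere_weight (from_sphere p))) * f (from_sphere p)"

lemma sphere_lift_span_of: "sphere_lift ` span_of I b = span_of I (\<lambda>i. sphere_lift (b i))"
proof -
  have *: "sphere_lift (\<lambda>x. \<Sum>i\<in>I. c i * b i x) = (\<lambda>p. \<Sum>i\<in>I. c i * sphere_lift (b i) p)" for c
    by (auto simp: sphere_lift_def sum_distrib_left mult.left_commute)
  show ?thesis
    unfolding span_of_def
  proof (intro equalityI subsetI)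
    fix g assume "g \<in> sphere_lift ` {f. \<exists>c. f = (\<lambda>x. \<Sum>i\<in>I. c i * b i x)}"
    then show "g \<in> {f. \<exists>c. f = (\<lambda>p. \<Sum>i\<in>I. c i * sphere_lift (b i) p)}" using * by auto
  next
    fix g assume "g \<in> {f. \<exists>c. f = (\<lambda>p. \<Sum>i\<in>I. c i * sphere_lift (b i) p)}"
    then obtain c where "g = (\<lambda>p. \<Sum>i\<in>I. c i * sphere_lift (b i) p)" by auto
    then have "g = sphere_lift (\<lambda>x. \<Sum>i\<in>I. c i * b i x)" by (simp only: *)
    then show "g \<in> sphere_lift ` {f. \<exists>c. f = (\<lambda>x. \<Sum>i\<in>I. c i * b i x)}" by blast
  qed
qed

lemma L2_functions_sphere_lift:
  fixes f :: "complex ^ 'd \<Rightarrow> complex"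
  assumes "f \<in> L2_functions lborel"
  shows "sphere_lift f \<in> L2_functions surface_measure"
proof -
  have [measurable]: "f \<in> borel_measurable borel" and i: "integrable lborel (\<lambda>x. (cmod (f x))\<^sup>2)"
    using assms by (auto simp: L2_functions_def)
  have "sphere_lift f \<in> borel_measurable surface_measure"
    unfolding sphere_lift_def[abs_def] by measurable
  moreover have "(cmod (sphere_lift f p))\<^sup>2 = sphere_weight (from_sphere p) * (cmod (f (from_sphere p)))\<^sup>2" for p
    by (simp add: sphere_lift_def norm_mult power_mult_distrib)
  ultimately show ?thesis
    using integrable_from_sphere[OF i] by (simp add: L2_functions_def)
qed

text \<open>The lifted basis serves as a basis. A relation that holds almost everywhere on the
  sphere can be divided by the positive factor and pushed forward by \<open>from_sphere\<close>,
  where independence in C^d applies.\<close>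

lemma L2_subspace_sphere_lift:
  fixes H :: "(complex ^ 'd \<Rightarrow> complex) set"
  assumes "L2_subspace lborel n H"
  shows "L2_subspace surface_measure n (sphere_lift ` H)"
proof -
  obtain b where b: "\<And>i. i < n \<Longrightarrow> b i \<in> L2_functions lborel"
      and indep: "\<And>c. (AE x in lborel. (\<Sum>i<n. c i * b i x) = 0) \<Longrightarrow> \<forall>i<n. c i = 0"
      and H: "H = span_of {..<n} b"
    using assms unfolding L2_subspace_def by blast
  show ?thesis
    unfolding L2_subspace_def
  proof (intro exI[of _ "\<lambda>i. sphere_lift (b i)"] conjI allI impI)
    show "sphere_lift (b i) \<in> L2_functions surface_measure" if "i < n" for i
      using L2_functions_sphere_lift[OF b[OF that]] .
    show "sphere_lift ` H = span_of {..<n} (\<lambda>i. sphere_lift (b i))"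
      unfolding H by (rule sphere_lift_span_of)
    fix c i assume 0: "AE p in surface_measure. (\<Sum>i<n. c i * sphere_lift (b i) p) = 0" and i: "i < n"
    have bm [measurable]: "b i \<in> borel_measurable borel" if "i < n" for i
      using b[OF that] by (simp add: L2_functions_def)
    have "(\<Sum>i<n. c i * sphere_lift (b i) p) = complex_of_real (sqrt (sphere_weight (from_sphere p))) * (\<Sum>i<n. c i * b i (from_sphere p))" for p
      by (simp add: sphere_lift_def sum_distrib_left mult.left_commute)
    then have "AE p in surface_measure. (\<Sum>i<n. c i * b i (from_sphere p)) = 0"
    proof -
      have "sphere_weight z \<noteq> 0" for z :: "complex ^ 'd" using sphere_weight_pos[of z] by simp
      then show ?thesis using 0 \<open>\<And>p. (\<Sum>i<n. c i * sphere_lift (b i) p) = _\<close> by simp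
    qed
    then have "AE p in density surface_measure (\<lambda>p. ennreal (sphere_weight (from_sphere p))). (\<Sum>i<n. c i * b i (from_sphere p)) = 0"
      by (subst AE_density) auto
    moreover have "{x \<in> space lborel. (\<Sum>i<n. c i * b i x) = 0} \<in> sets lborel"
    proof -
      have [measurable]: "(\<lambda>x. \<Sum>i<n. c i * b i x) \<in> borel_measurable lborel"
        by (intro borel_measurable_sum borel_measurable_times) (use bm in auto)
      show ?thesis by measurable
    qed
    ultimately have "AE x in distr (density surface_measure (\<lambda>p. ennreal (sphere_weight (from_sphere p)))) lborel from_sphere. (\<Sum>i<n. c i * b i x) = 0"
      by (subst AE_distr_iff) simp_all
    then have "AE x in lborel. (\<Sum>i<n. c i * b i x) = 0"
      by (simp only: distr_from_sphere)
    then show "c i = 0" using indep i by blast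
  qed
qed

lemma reproducing_kernel_K_star:
  "reproducing_kernel surface_measure (sphere_lift ` H_space L) (K_star L :: (complex ^ 'd) \<times> real \<Rightarrow> _)"
  unfolding reproducing_kernel_def
\<comment> \<open>The empty exceptional set covers the poles as well: \<open>K_star\<close> and
  every lifted function depend on a point only through its \<open>from_sphere\<close>, and
  \<open>H_kernel\<close> reproduces at every point of C^d.\<close>
proof (intro bexI[of _ "{}"] ballI)
  fix q :: "(complex ^ 'd) \<times> real"
  define s where "s p = complex_of_real (sqrt (sphere_weight (from_sphere p)))" for p :: "(complex ^ 'd) \<times> real"
  define k where "k = (\<lambda>z. s q * H_kernel L z (from_sphere q))"
  have k: "k \<in> H_space L"
  proof -
    obtain c where "(\<lambda>z. H_kernel L z (from_sphere q)) = (\<lambda>x. \<Sum>i | sum i UNIV \<le> L. c i * weighted_monomial L i x)"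
      using H_kernel_in_H_space[of L "from_sphere q"] by (auto simp: H_space_def span_of_def)
    then have "k = (\<lambda>x. \<Sum>i | sum i UNIV \<le> L. (s q * c i) * weighted_monomial L i x)"
      by (simp add: k_def sum_distrib_left mult.assoc fun_eq_iff)
    then show ?thesis by (auto simp: H_space_def span_of_def)
  qed
  have K: "K_star L p q = sphere_lift k p" for p
    by (simp add: K_star_eq sphere_lift_def k_def s_def)
  have "F q = (\<integral>p. F p * cnj (sphere_lift k p) \<partial>surface_measure)" if F: "F \<in> sphere_lift ` H_space L" for F
  proof -
    obtain f where f: "f \<in> H_space L" "F = sphere_lift f" using F by auto
    have [measurable]: "f \<in> borel_measurable borel" "k \<in> borel_measurable borel"
      using H_space_measurable[OF f(1)] H_space_measurable[OF k] by auto
    have "F p * cnj (sphere_lift k p) = sphere_weight (from_sphere p) *\<^sub>R (f (from_sphere p) * cnj (k (from_sphere p)))" for p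
    proof -
      have "s p * s p = complex_of_real (sphere_weight (from_sphere p))"
        by (simp add: s_def of_real_mult[symmetric] del: of_real_mult)
      then show ?thesis
        by (simp add: f(2) sphere_lift_def scaleR_conv_of_real s_def[symmetric] mult_ac)
           (simp add: s_def mult_ac)
    qed
    then have "(\<integral>p. F p * cnj (sphere_lift k p) \<partial>surface_measure) = (\<integral>z. f z * cnj (k z) \<partial>lborel)"
      using integral_from_sphere[of "\<lambda>z. f z * cnj (k z)"] borel_measurable_integrable[OF H_space_integrable[OF f(1) k]] by simp
    also have "\<dots> = (\<integral>z. s q * (f z * cnj (H_kernel L z (from_sphere q))) \<partial>lborel)"
      by (simp add: k_def s_def mult.left_commute)
    also have "\<dots> = s q * f (from_sphere q)"
      using H_space_reproducing[OF f(1), of "from_sphere q"] by simp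
    finally show ?thesis by (simp add: f(2) sphere_lift_def s_def)
  qed
  then show "\<exists>h\<in>sphere_lift ` H_space L. (\<forall>p\<in>space surface_measure - {}. K_star L p q = h p) \<and>
      (\<forall>f\<in>sphere_lift ` H_space L. f q = (\<integral>p. f p * cnj (h p) \<partial>surface_measure))"
    using K k by blast
qed simp

theorem theorem4p4:
  fixes L N :: nat
    and M :: "'w measure"
    and X_H :: "'w \<Rightarrow> (complex ^ 'd) set"
    and K_H :: "complex ^ 'd \<Rightarrow> complex ^ 'd \<Rightarrow> complex"
    and X_star :: "'w \<Rightarrow> ((complex ^ 'd) \<times> real) set"
  assumes N: "N = (CARD('d) + L) choose CARD('d)"
    and X_H: "projection_DPP M lborel X_H N (H_space L) K_H"
    and X_star: "\<And>\<omega>. X_star \<omega> = to_sphere ` X_H \<omega>"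
  shows "(\<exists>H. projection_DPP M surface_measure X_star N H (K_star L)) \<and>
         homogeneous_kernel (K_star L :: (complex ^ 'd) \<times> real \<Rightarrow> _)"
proof
  have "L2_subspace lborel N (H_space L :: (complex ^ 'd \<Rightarrow> complex) set)"
    and "reproducing_kernel lborel (H_space L) K_H" and "determinantal M lborel X_H K_H"
    using X_H by (auto simp: projection_DPP_def)
  moreover have "X_star = (\<lambda>\<omega>. to_sphere ` X_H \<omega>)" using X_star by auto
  \<comment> \<open>The witness for the subspace is the isometric image of \<open>H_space L\<close>
    under \<open>sphere_lift\<close>.\<close>
  ultimately have "projection_DPP M surface_measure X_star N (sphere_lift ` H_space L) (K_star L)"
    unfolding projection_DPP_def
    using L2_subspace_sphere_lift reproducing_kernel_K_star determinantal_to_sphere by blast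
  then show "\<exists>H. projection_DPP M surface_measure X_star N H (K_star L)" by blast
qed (rule homogeneous_K_star)

end
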